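(* Let $EI,\rho\in C^4([0,1])$ be real-valued and uniformly positive (here $EI$ denotes a single function), let $m,J>0$, and suppose that there exist $a,b>0$ and $\zeta\in C^2([0,1])$ with $\zeta(0)=0$ such that $$2(1-a)\rho(x)-(\rho\zeta)'(x)<-b\quad\text{and}\quad EI(x)(1-a-2\zeta'(x))+\tfrac12(EI\,\zeta)'(x)<-b$$ for all $x\in[0,1]$. Let $H_L^2(0,1)=\{u\in H^2(0,1):u(0)=u'(0)=0\}$, $X=H_L^2(0,1)\times L^2(0,1)\times\mathbb{C}^2$ and $U=\mathbb{C}^2$. Let $A$ be the operator on $X$ defined by $$A(u,v,\lambda,\mu)=\big(v,\,-\rho^{-1}(EI\,u'')'',\,m^{-1}(EI\,u'')'(1),\,-J^{-1}EI(1)u''(1)\big)$$ with domain $$D(A)=\big\{(u,v,\lambda,\mu)\in (H^4(0,1)\cap H_L^2(0,1))\times H_L^2(0,1)\times\mathbb{C}^2: v(1)=\lambda,\ v'(1)=\mu\big\},$$ and let $B\colon U\to X$ be the bounded linear operator $B(\lambda,\mu)=(0,0,\lambda,\mu)$. Let $\phi_1,\phi_2\colon\mathbb{C}^2\to\mathbb{C}$ and define $\phi\colon U\to U$ by $\phi(\lambda,\mu)=(m^{-1}\phi_1(\lambda,\mu),J^{-1}\phi_2(\lambda,\mu))$. Suppose that $\phi$ is monotone and locally Lipschitz continuous, and that there exist $\delta>0$ and $c>0$ such that $$\operatorname{Re}\langle\phi(w),w\rangle\ge c\|w\|^2 \ \text{ if } \|w\|\le\delta,\qquad \operatorname{Re}\langle\phi(w),w\rangle\ge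 c\ \text{ if } \|w\|>\delta ,$$ where $w\in U$. Then all mild solutions of $$\dot x(t)=Ax(t)-B\phi(B^*x(t)),\qquad t\ge0,$$ satisfy $\|x(t)\|\to0$ as $t\to\infty$, and all classical solutions of this equation satisfy $\|x(t)\|=O(t^{-1/2})$ as $t\to\infty$.
   Context: All function spaces are complex-valued unless indicated. $X$ carries the energy inner product $$\langle(u_1,v_1,\lambda_1,\mu_1),(u_2,v_2,\lambda_2,\mu_2)\rangle=\int_0^1EI\,u_1''\overline{u_2''}\,\mathrm{d}x+\int_0^1\rho\,v_1\overline{v_2}\,\mathrm{d}x+m\lambda_1\overline{\lambda_2}+J\mu_1\overline{\mu_2},$$ for which $A$ is skew-adjoint and hence generates a contraction semigroup $(T(t))_{t\ge0}$ on $X$. $U=\mathbb{C}^2$ carries the inner product $\langle(\lambda_1,\mu_1),(\lambda_2,\mu_2)\rangle=m\lambda_1\overline{\lambda_2}+J\mu_1\overline{\mu_2}$, so that $B^*(u,v,\lambda,\mu)=(\lambda,\mu)$. The map $\phi$ is monotone if $\operatorname{Re}\langle\phi(w_1)-\phi(w_2),w_1-w_2\rangle\ge0$ for all $w_1,w_2\in U$. With $x(t)=(u(\cdot,t),u_t(\cdot,t),u_t(1,t),u_{xt}(1,t))$, the equation is the abstract formulation of the SCOLE model, an Euler–Bernoulli beam with a tip mass: $\rho(x)u_{tt}=-(EI(x)u_{xx})_{xx}$ for $x\in(0,1)$, $t>0$; $mu_{tt}(1,t)-(EI\,u_{xx})_x(1,t)=-\phi_1(u_t(1,t),u_{xt}(1,t))$;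 $Ju_{xtt}(1,t)+EI(1)u_{xx}(1,t)=-\phi_2(u_t(1,t),u_{xt}(1,t))$; $u(0,t)=u_x(0,t)=0$. A classical solution of $\dot x(t)=Ax(t)-B\phi(B^*x(t))$, $t\ge 0$, is a function $x(\cdot)\in C^1([0,\infty);X)$ such that $x(t)\in D(A)$ for all $t\ge0$ and the equation holds for all $t\ge0$. A mild solution is a function $x(\cdot)\in C([0,\infty);X)$ such that, with $x_0=x(0)\in X$, $x(t)=T(t)x_0-\int_0^tT(t-s)B\phi(B^*x(s))\,\mathrm{d}s$ for all $t\ge0$. The $O$-constants may depend on the individual solution. *)

theory Defs
  imports "HOL-Analysis.Analysis" "HOL-Library.Landau_Symbols"
begin

definition sq_integrable :: "(real \<Rightarrow> complex) \<Rightarrow> bool" where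
  "sq_integrable f \<longleftrightarrow> f \<in> borel_measurable (lebesgue_on {0..1}) \<and>
     integrable (lebesgue_on {0..1}) (\<lambda>x. (norm (f x))\<^sup>2)"

lemma sq_integrable_measurable [measurable_dest]:
  "sq_integrable f \<Longrightarrow> f \<in> borel_measurable (lebesgue_on {0..1})"
  by (simp add: sq_integrable_def)

lemma sq_integrable_zero: "sq_integrable (\<lambda>_. 0)"
  by (simp add: sq_integrable_def)

lemma sq_integrable_mult_bounded:
  assumes "sq_integrable f" "g \<in> borel_measurable (lebesgue_on {0..1})"
    and B: "\<And>x. x \<in> {0..1} \<Longrightarrow> norm (g x) \<le> B"
  shows "sq_integrable (\<lambda>x. g x * f x)"
  unfolding sq_integrable_def
proof
  note [measurable] = sq_integrable_measurable[OF assms(1)] assms(2)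
  show "(\<lambda>x. g x * f x) \<in> borel_measurable (lebesgue_on {0..1})" by measurable
  show "integrable (lebesgue_on {0..1}) (\<lambda>x. (norm (g x * f x))\<^sup>2)"
  proof (rule Bochner_Integration.integrable_bound)
    show "integrable (lebesgue_on {0..1}) (\<lambda>x. B\<^sup>2 * (norm (f x))\<^sup>2)"
      using assms(1) by (simp add: sq_integrable_def)
    have "(norm (g x))\<^sup>2 \<le> B\<^sup>2" if "x \<in> {0..1}" for x
      using B[OF that] by (intro power_mono) auto
    then show "AE x in lebesgue_on {0..1}. norm ((norm (g x * f x))\<^sup>2) \<le> norm (B\<^sup>2 * (norm (f x))\<^sup>2)"
      by (intro AE_I2) (auto simp: norm_mult power_mult_distrib intro!: mult_right_mono)
  qed measurable
qed

lemma sq_integrable_cmult: "sq_integrable f \<Longrightarrow> sq_integrable (\<lambda>x. c * f x)"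
  by (rule sq_integrable_mult_bounded[where B = "norm c"]) auto

lemma sq_integrable_add:
  assumes "sq_integrable f" "sq_integrable g"
  shows "sq_integrable (\<lambda>x. f x + g x)"
  unfolding sq_integrable_def
proof
  note [measurable] = assms[THEN sq_integrable_measurable]
  show "(\<lambda>x. f x + g x) \<in> borel_measurable (lebesgue_on {0..1})" by measurable
  show "integrable (lebesgue_on {0..1}) (\<lambda>x. (norm (f x + g x))\<^sup>2)"
  proof (rule Bochner_Integration.integrable_bound)
    show "integrable (lebesgue_on {0..1}) (\<lambda>x. 2 * (norm (f x))\<^sup>2 + 2 * (norm (g x))\<^sup>2)"
      using assms by (simp add: sq_integrable_def)
    have "(norm (a + b))\<^sup>2 \<le> 2 * (norm a)\<^sup>2 + 2 * (norm b)\<^sup>2" for a b :: complex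
    proof -
      have "(norm (a + b))\<^sup>2 \<le> (norm a + norm b)\<^sup>2"
        by (intro power_mono norm_triangle_ineq) auto
      also have "\<dots> \<le> 2 * (norm a)\<^sup>2 + 2 * (norm b)\<^sup>2"
        using sum_squares_bound[of "norm a" "norm b"] by (simp add: power2_sum)
      finally show ?thesis .
    qed
    then show "AE x in lebesgue_on {0..1}. norm ((norm (f x + g x))\<^sup>2)
        \<le> norm (2 * (norm (f x))\<^sup>2 + 2 * (norm (g x))\<^sup>2)"
      by (intro AE_I2) (auto simp: abs_of_nonneg)
  qed measurable
qed

lemma integrable_mult_cnj:
  assumes "sq_integrable f" "sq_integrable g"
  shows "integrable (lebesgue_on {0..1}) (\<lambda>x. f x * cnj (g x))"
proof (rule Bochner_Integration.integrable_bound)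
  note [measurable] = assms[THEN sq_integrable_measurable]
  show "integrable (lebesgue_on {0..1}) (\<lambda>x. (norm (f x))\<^sup>2 + (norm (g x))\<^sup>2)"
    using assms by (simp add: sq_integrable_def)
  have "norm a * norm b \<le> (norm a)\<^sup>2 + (norm b)\<^sup>2" for a b :: complex
  proof -
    have "2 * (norm a * norm b) \<le> (norm a)\<^sup>2 + (norm b)\<^sup>2"
      using sum_squares_bound[of "norm a" "norm b"] by simp
    moreover have "0 \<le> norm a * norm b" by simp
    ultimately show ?thesis by linarith
  qed
  then show "AE x in lebesgue_on {0..1}. norm (f x * cnj (g x)) \<le> norm ((norm (f x))\<^sup>2 + (norm (g x))\<^sup>2)"
    by (intro AE_I2) (auto simp: norm_mult)
  have [measurable]: "cnj \<in> borel_measurable borel"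
    by (intro borel_measurable_continuous_onI continuous_intros)
  show "(\<lambda>x. f x * cnj (g x)) \<in> borel_measurable (lebesgue_on {0..1})" by measurable
qed

text \<open>The elements of \<open>l2\<close> are classes modulo equality almost everywhere. As the quotient is partial,
  \<open>abs_l2 f\<close> is unspecified unless \<open>sq_integrable f\<close>. The type class instance provides the real
  inner product \<open>Re \<integral> f \<cdot> cnj g\<close>, which induces the usual norm; multiplication by complex scalars is
  \<open>l2_mult (\<lambda>_. c)\<close> below.\<close>

quotient_type l2 = "real \<Rightarrow> complex" / partial:
  "\<lambda>f g. sq_integrable f \<and> sq_integrable g \<and> (AE x in lebesgue_on {0..1}. f x = g x)"
proof (rule part_equivpI)
  show "\<exists>f. sq_integrable f \<and> sq_integrable f \<and> (AE x in lebesgue_on {0..1}. f x = f x)"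
    using sq_integrable_zero by auto
qed (auto simp: symp_def transp_def elim: AE_mp)

lemma abs_l2_eqI:
  assumes "sq_integrable f" "sq_integrable g" "AE x in lebesgue_on {0..1}. f x = g x"
  shows "abs_l2 f = abs_l2 g"
  using assms by (intro Quotient3_rel_abs[OF Quotient3_l2]) auto

lemma abs_l2_eqD:
  assumes "sq_integrable f" "sq_integrable g" "abs_l2 f = abs_l2 g"
  shows "AE x in lebesgue_on {0..1}. f x = g x"
  using Quotient3_rel[OF Quotient3_l2, of f g] assms by auto

lemma abs_rep_l2 [simp]: "abs_l2 (rep_l2 w) = w"
  by (rule Quotient3_abs_rep[OF Quotient3_l2])

lemma sq_integrable_rep_l2 [simp]: "sq_integrable (rep_l2 w)"
  using Quotient3_rep_reflp[OF Quotient3_l2, of w] by simp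

lemma rep_abs_l2: "sq_integrable f \<Longrightarrow> AE x in lebesgue_on {0..1}. rep_l2 (abs_l2 f) x = f x"
  by (rule abs_l2_eqD) auto

instantiation l2 :: real_vector
begin

lift_definition zero_l2 :: l2 is "\<lambda>_. 0"
  by (simp add: sq_integrable_zero)

lift_definition plus_l2 :: "l2 \<Rightarrow> l2 \<Rightarrow> l2" is "\<lambda>f g x. f x + g x"
  by (auto intro: sq_integrable_add)

lift_definition uminus_l2 :: "l2 \<Rightarrow> l2" is "\<lambda>f x. - f x"
  using sq_integrable_cmult[where c = "-1"] by auto

lift_definition minus_l2 :: "l2 \<Rightarrow> l2 \<Rightarrow> l2" is "\<lambda>f g x. f x - g x"
  using sq_integrable_add[OF _ sq_integrable_cmult[where c = "-1"]] by auto

lift_definition scaleR_l2 :: "real \<Rightarrow> l2 \<Rightarrow> l2" is "\<lambda>r f x. r *\<^sub>R f x"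
  using sq_integrable_cmult by (auto simp: scaleR_conv_of_real)

instance
proof
  fix u v w :: l2 and a b :: real
  show "u + v + w = u + (v + w)" 
    by transfer (auto intro!: sq_integrable_add simp: add.assoc)
  show "u + v = v + u" 
    by transfer (auto intro!: sq_integrable_add simp: add.commute)
  show "0 + u = u" by transfer auto
  show "- u + u = 0" 
    by transfer (auto simp: sq_integrable_zero)
  show "u - v = u + - v" 
    apply transfer 
    subgoal for f g
    using sq_integrable_add[of f "\<lambda>x. - g x"] sq_integrable_cmult[of g "-1"] by auto
    done
  show "a *\<^sub>R (u + v) = a *\<^sub>R u + a *\<^sub>R v"
    apply transfer 
    subgoal for a f g
      using sq_integrable_cmult[OF sq_integrable_add[of f g], of "of_real a"] 
      by (auto simp: scaleR_conv_of_real algebra_simps)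
    done
  show "(a + b) *\<^sub>R u = a *\<^sub>R u + b *\<^sub>R u"
    apply transfer 
    subgoal for a b f
      using sq_integrable_cmult[of f "of_real (a + b)"] 
      by (auto simp: scaleR_conv_of_real algebra_simps)
    done
  show "a *\<^sub>R b *\<^sub>R u = (a * b) *\<^sub>R u"
    apply transfer 
    subgoal for a b f
      using sq_integrable_cmult[of f "of_real (a * b)"] 
      by (auto simp: scaleR_conv_of_real algebra_simps)
    done
  show "1 *\<^sub>R u = u" by transfer auto
qed

end

instantiation l2 :: real_inner
begin

lift_definition inner_l2 :: "l2 \<Rightarrow> l2 \<Rightarrow> real" is
  "\<lambda>f g. Re (LINT x|lebesgue_on {0..1}. f x * cnj (g x))"
proof -
  fix f1 f2 g1 g2 :: "real \<Rightarrow> complex"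
  assume f: "sq_integrable f1 \<and> sq_integrable f2 \<and> (AE x in lebesgue_on {0..1}. f1 x = f2 x)"
    and g: "sq_integrable g1 \<and> sq_integrable g2 \<and> (AE x in lebesgue_on {0..1}. g1 x = g2 x)"
  have "(LINT x|lebesgue_on {0..1}. f1 x * cnj (g1 x)) = (LINT x|lebesgue_on {0..1}. f2 x * cnj (g2 x))"
    using f g by (intro integral_cong_AE borel_measurable_integrable integrable_mult_cnj) (auto elim: AE_mp)
  then show "Re (LINT x|lebesgue_on {0..1}. f1 x * cnj (g1 x)) = Re (LINT x|lebesgue_on {0..1}. f2 x * cnj (g2 x))"
    by simp
qed

definition norm_l2 :: "l2 \<Rightarrow> real" where "norm_l2 w = sqrt (inner w w)"
definition sgn_l2 :: "l2 \<Rightarrow> l2" where "sgn_l2 w = w /\<^sub>R norm w"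
definition dist_l2 :: "l2 \<Rightarrow> l2 \<Rightarrow> real" where "dist_l2 w z = norm (w - z)"
definition uniformity_l2 :: "(l2 \<times> l2) filter" where
  "uniformity_l2 = (INF e\<in>{0<..}. principal {(x, y). dist x y < e})"
definition open_l2 :: "l2 set \<Rightarrow> bool" where
  "open_l2 U \<longleftrightarrow> (\<forall>x\<in>U. eventually (\<lambda>(x', y). x' = x \<longrightarrow> y \<in> U) uniformity)"

instance
proof
  fix u v w :: l2 and a :: real
  show "inner u v = inner v u"
  proof transfer
    fix f g :: "real \<Rightarrow> complex"
    have "(LINT x|lebesgue_on {0..1}. g x * cnj (f x)) = (LINT x|lebesgue_on {0..1}. cnj (f x * cnj (g x)))"
      by (simp add: mult.commute)
    then show "Re (LINT x|lebesgue_on {0..1}. f x * cnj (g x)) = Re (LINT x|lebesgue_on {0..1}. g x * cnj (f x))"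
      by (simp add: integral_cnj del: complex_cnj_mult)
  qed
  show "inner (u + v) w = inner u w + inner v w"
    by transfer (simp add: distrib_right integrable_mult_cnj)
  show "inner (a *\<^sub>R u) v = a * inner u v"
    by transfer simp
  have *: "Re (LINT x|lebesgue_on {0..1}. f x * cnj (f x)) = (LINT x|lebesgue_on {0..1}. (norm (f x))\<^sup>2)" for f
    by (simp add: complex_norm_square[symmetric] del: of_real_power)
  show "0 \<le> inner u u"
    by transfer (simp add: *)
  show "inner u u = 0 \<longleftrightarrow> u = 0"
    by transfer (auto simp: * sq_integrable_zero sq_integrable_def integral_nonneg_eq_0_iff_AE)
  show "norm u = sqrt (inner u u)" by (simp add: norm_l2_def)
  show "sgn u = u /\<^sub>R norm u" by (simp add: sgn_l2_def)
  show "dist u v = norm (u - v)" by (simp add: dist_l2_def)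
  show "(uniformity :: (l2 \<times> l2) filter) = (INF e\<in>{0<..}. principal {(x, y). dist x y < e})"
    by (simp add: uniformity_l2_def)
  show "open U \<longleftrightarrow> (\<forall>x\<in>U. eventually (\<lambda>(x', y). x' = x \<longrightarrow> y \<in> U) uniformity)" for U :: "l2 set"
    by (simp add: open_l2_def)
qed

end

text \<open>Meaningful only if the product is square integrable, e.g. for \<open>g\<close> continuous on \<open>{0..1}\<close>.\<close>

definition l2_mult :: "(real \<Rightarrow> complex) \<Rightarrow> l2 \<Rightarrow> l2" where
  "l2_mult g w = abs_l2 (\<lambda>x. g x * rep_l2 w x)"

text \<open>In dimension one, \<open>H\<^sup>1(0,1)\<close> is the space of (classes of) absolutely continuous functions with
  derivative in \<open>L\<^sup>2\<close>, that is, of indefinite integrals of \<open>L\<^sup>2\<close> functions. Here \<open>f\<close> is the continuous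
  representative of \<open>w\<close>.\<close>

definition has_weak_deriv :: "l2 \<Rightarrow> l2 \<Rightarrow> bool" where
  "has_weak_deriv w z \<longleftrightarrow>
     (\<exists>f. w = abs_l2 f \<and> (\<forall>x\<in>{0..1}. f x = f 0 + integral {0..x} (rep_l2 z)))"

primrec sobolev :: "nat \<Rightarrow> l2 set" where
  "sobolev 0 = UNIV"
| "sobolev (Suc k) = {w. \<exists>z\<in>sobolev k. has_weak_deriv w z}"

definition weak_deriv :: "l2 \<Rightarrow> l2" where
  "weak_deriv w = (THE z. has_weak_deriv w z)"

text \<open>The value at \<open>x\<close> of the continuous representative, which exists for \<open>w \<in> sobolev 1\<close>.\<close>

definition boundary_val :: "l2 \<Rightarrow> real \<Rightarrow> complex" where
  "boundary_val w x = (THE c. \<exists>f. continuous_on {0..1} f \<and> w = abs_l2 f \<and> f x = c)"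

lemma sq_integrable_integrable:
  assumes "sq_integrable f"
  shows "integrable (lebesgue_on {0..1}) f"
proof (rule Bochner_Integration.integrable_bound)
  note [measurable] = sq_integrable_measurable[OF assms]
  show "f \<in> borel_measurable (lebesgue_on {0..1})" by measurable
  show "integrable (lebesgue_on {0..1}) (\<lambda>x. 1 + (norm (f x))\<^sup>2)"
    using assms by (simp add: sq_integrable_def)
  have "norm a \<le> 1 + (norm a)\<^sup>2" for a :: complex
    using sum_squares_bound[of "norm a" 1] norm_ge_zero[of a] by (simp, linarith)
  then show "AE x in lebesgue_on {0..1}. norm (f x) \<le> norm (1 + (norm (f x))\<^sup>2)"
    by (intro AE_I2) auto
qed

lemma sq_integrable_integrable_on:
  assumes "sq_integrable f" "{a..b} \<subseteq> {0..1}"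
  shows "f integrable_on {a..b}"
  using integrable_on_lebesgue_on[OF sq_integrable_integrable[OF assms(1)]] assms(2)
  by (auto intro: integrable_on_subinterval)

lemma sq_integrable_continuous:
  assumes "continuous_on {0..1} f"
  shows "sq_integrable f"
  unfolding sq_integrable_def
proof
  show "f \<in> borel_measurable (lebesgue_on {0..1})"
    using assms by (intro continuous_imp_measurable_on_sets_lebesgue) auto
  have "continuous_on {0..1} (\<lambda>x. (norm (f x))\<^sup>2)"
    using assms by (intro continuous_intros)
  then show "integrable (lebesgue_on {0..1}) (\<lambda>x. (norm (f x))\<^sup>2)"
    by (rule integrable_continuous_real[THEN nonnegative_absolutely_integrable_1, 
      THEN absolutely_integrable_imp_integrable]) auto
qed

lemma continuous_indefinite:
  assumes "sq_integrable g" "\<And>x. x \<in> {0..1} \<Longrightarrow> f x = c + integral {0..x} g"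
  shows "continuous_on {0..1} f"
proof -
  have "continuous_on {0..1} (\<lambda>x. c + integral {0..x} g)"
    using sq_integrable_integrable_on[OF assms(1)]
    by (intro continuous_intros indefinite_integral_continuous_1) auto
  then show ?thesis
    using assms(2) by (metis (no_types, lifting) continuous_on_cong)
qed

lemma AE_eq_continuous:
  fixes f g :: "real \<Rightarrow> complex"
  assumes "continuous_on {0..1} f" "continuous_on {0..1} g"
    and "AE x in lebesgue_on {0..1}. f x = g x" "x \<in> {0..1}"
  shows "f x = g x"
proof -
  let ?C = "{0..1} \<inter> (\<lambda>x. f x - g x) -` {0}"
  have C: "closed ?C"
    using assms by (intro continuous_closed_preimage continuous_intros) auto
  have "AE x in lebesgue. x \<in> {0..1} \<longrightarrow> f x = g x"
    using assms(3) by (subst (asm) AE_restrict_space_iff) auto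
  then have "AE x\<in>{0<..<1} in lebesgue. x \<in> ?C"
    by eventually_elim auto
  then have "{0<..<1} \<subseteq> ?C"
    using mem_closed_if_AE_lebesgue_open[of "{0<..<1::real}" ?C] C by auto
  then have "closure {0<..<1} \<subseteq> ?C"
    using C by (rule closure_minimal)
  with assms(4) show ?thesis by auto
qed

lemma boundary_val_eq:
  assumes "continuous_on {0..1} f" "w = abs_l2 f" "x \<in> {0..1}"
  shows "boundary_val w x = f x"
  unfolding boundary_val_def
proof (rule the_equality)
  show "\<exists>fa. continuous_on {0..1} fa \<and> w = abs_l2 fa \<and> fa x = f x"
    using assms by auto
  fix c assume "\<exists>fa. continuous_on {0..1} fa \<and> w = abs_l2 fa \<and> fa x = c"
  then obtain g where g: "continuous_on {0..1} g" "w = abs_l2 g" "g x = c" by auto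
  have "AE x in lebesgue_on {0..1}. g x = f x"
    using g assms by (intro abs_l2_eqD sq_integrable_continuous) auto
  with AE_eq_continuous[OF g(1) assms(1) _ assms(3)] g show "c = f x" by auto
qed

lemma AE_zero_real:
  fixes h :: "real \<Rightarrow> real"
  assumes h: "integrable (lebesgue_on {0..1}) h"
    and 0: "\<And>x. x \<in> {0..1} \<Longrightarrow> integral {0..x} h = 0"
  shows "AE x in lebesgue_on {0..1}. h x = 0"
proof -
  define k where "k = (\<lambda>x. if x \<in> {0..1} then h x else 0)"
  have k: "integrable lebesgue k"
    unfolding k_def using h by (intro Lebesgue_Measure.integrable_restrict_UNIV[THEN iffD2]) auto
  obtain l where l [measurable]: "l \<in> borel_measurable lborel" and kl: "AE x in lborel. k x = l x"
    using completion_ex_borel_measurable_real[of k lborel] k by (auto dest: borel_measurable_integrable)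
  have kl': "AE x in lebesgue. k x = l x"
    using kl by (rule AE_completion)
  have lint': "integrable lebesgue l"
  proof (rule integrable_cong_AE_imp[OF k])
    show "l \<in> borel_measurable lebesgue" using l by (rule measurable_completion)
    show "AE x in lebesgue. k x = l x" using kl' by eventually_elim simp
  qed
  then have lint: "integrable lborel l"
    using l by (simp add: integrable_completion)
  have zero: "(LINT x|lborel. indicator {a<..} x * l x) = 0" for a
  proof -
    have "(LINT x|lborel. indicator {a<..} x * l x) = (LINT x|lebesgue. indicator {a<..} x * l x)"
      by (subst integral_completion) auto
    also have "\<dots> = (LINT x|lebesgue. indicator {a<..} x * k x)"
    proof (rule integral_cong_AE)
      show "(\<lambda>x. indicator {a<..} x * l x) \<in> borel_measurable lebesgue"
        by (rule measurable_completion) simp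
      show "(\<lambda>x. indicator {a<..} x * k x) \<in> borel_measurable lebesgue"
        using borel_measurable_integrable[OF k] by (intro borel_measurable_times borel_measurable_indicator) auto
      show "AE x in lebesgue. indicator {a<..} x * l x = indicator {a<..} x * k x"
        using kl' by eventually_elim simp
    qed
    also have "\<dots> = 0"
    proof -
      have "(h has_integral 0) {max a 0..1}"
      proof (cases "max a 0 \<le> 1")
        case True
        have i: "h integrable_on {0..1}"
          using integrable_on_lebesgue_on[OF h] by simp
        have "integral {0..max a 0} h + integral {max a 0..1} h = integral {0..1} h"
          using True i by (intro Henstock_Kurzweil_Integration.integral_combine) auto
        then have "integral {max a 0..1} h = 0"
          using 0 True by auto
        moreover have "h integrable_on {max a 0..1}"
          using i by (rule integrable_on_subinterval) auto
        ultimately show ?thesis by (auto simp: has_integral_integral)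
      qed auto
      then have "((\<lambda>x. if x \<in> {max a 0..1} then h x else 0) has_integral 0) UNIV"
        by (subst has_integral_restrict_UNIV)
      then have "((\<lambda>x. indicator {a<..} x * k x) has_integral 0) UNIV"
        by (rule has_integral_spike[of "{a}", rotated 2]) (auto simp: k_def indicator_def)
      moreover have "((\<lambda>x. indicator {a<..} x * k x) has_integral (LINT x|lebesgue. indicator {a<..} x * k x)) UNIV"
        using integrable_mult_indicator[OF _ k, of "{a<..}"] by (intro has_integral_integral_lebesgue) auto
      ultimately show ?thesis
        by (rule has_integral_unique[rotated])
    qed
    finally show ?thesis .
  qed
  have l_ind: "integrable lborel (\<lambda>x. indicator {a<..} x * l x)" for a
    using integrable_mult_indicator[OF _ lint, of "{a<..}"] by simp
  have eq: "(\<integral>\<^sup>+x. ennreal (l x) * indicator {a<..} x \<partial>lborel) = (\<integral>\<^sup>+x. ennreal (indicator {a<..} x * l x) \<partial>lborel)"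
     "(\<integral>\<^sup>+x. ennreal (- l x) * indicator {a<..} x \<partial>lborel) = (\<integral>\<^sup>+x. ennreal (- (indicator {a<..} x * l x)) \<partial>lborel)" for a
    by (intro nn_integral_cong; simp add: indicator_def)+
  have fin: "(\<integral>\<^sup>+x. ennreal (indicator {a<..} x * l x) \<partial>lborel) \<noteq> \<infinity>"
    "(\<integral>\<^sup>+x. ennreal (- (indicator {a<..} x * l x)) \<partial>lborel) \<noteq> \<infinity>" for a
    using l_ind[of a] by (auto simp: real_integrable_def)
  have pos: "(\<integral>\<^sup>+x. ennreal (l x) * indicator {a<..} x \<partial>lborel) = (\<integral>\<^sup>+x. ennreal (- l x) * indicator {a<..} x \<partial>lborel)" for a
  proof -
    have "p = q" if "enn2real p = enn2real q" "p \<noteq> \<infinity>" "q \<noteq> \<infinity>" for p q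
      using that by (metis ennreal_enn2real infinity_ennreal_def less_top)
    then show ?thesis
      using zero[of a] fin[of a] unfolding eq real_lebesgue_integral_def[OF l_ind] by simp
  qed
  have "density lborel (\<lambda>x. ennreal (l x)) = density lborel (\<lambda>x. ennreal (- l x))"
  proof (rule measure_eqI_lessThan)
    fix x
    show "emeasure (density lborel (\<lambda>x. ennreal (l x))) {x<..} < \<infinity>"
      using fin(1)[of x] by (simp add: emeasure_density eq top.not_eq_extremum)
    show "emeasure (density lborel (\<lambda>x. ennreal (l x))) {x<..} = emeasure (density lborel (\<lambda>x. ennreal (- l x))) {x<..}"
      using pos by (simp add: emeasure_density)
  qed auto
  then have "AE x in lborel. ennreal (l x) = ennreal (- l x)"
    by (intro sigma_finite_measure.density_unique[OF sigma_finite_lborel]) auto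
  then have "AE x in lborel. l x = 0"
  proof eventually_elim
    fix x assume *: "ennreal (l x) = ennreal (- l x)"
    show "l x = 0"
    proof (cases "l x \<ge> 0")
      case True
      then have "ennreal (l x) = 0" using * by (simp add: ennreal_neg)
      then show ?thesis using True by (simp add: ennreal_eq_0_iff)
    next
      case False
      then have "ennreal (- l x) = 0" using * by (simp add: ennreal_neg)
      then show ?thesis using False by (simp add: ennreal_eq_0_iff)
    qed
  qed
  from AE_completion[OF this] kl' have "AE x in lebesgue. x \<in> {0..1} \<longrightarrow> h x = 0"
    by eventually_elim (auto simp: k_def)
  then show ?thesis
    by (subst AE_restrict_space_iff) simp_all
qed

lemma AE_zero_complex:
  fixes h :: "real \<Rightarrow> complex"
  assumes h: "sq_integrable h"
    and 0: "\<And>x. x \<in> {0..1} \<Longrightarrow> integral {0..x} h = 0"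
  shows "AE x in lebesgue_on {0..1}. h x = 0"
proof -
  note i = sq_integrable_integrable[OF h]
  have *: "(h has_integral 0) {0..x}" if "x \<in> {0..1}" for x
    using 0[OF that] sq_integrable_integrable_on[OF h, of 0 x] that
    by (auto simp: has_integral_integral)
  have "integral {0..x} (\<lambda>x. Re (h x)) = 0" "integral {0..x} (\<lambda>x. Im (h x)) = 0" if "x \<in> {0..1}" for x
    using has_integral_linear[OF *[OF that] bounded_linear_Re] 
      has_integral_linear[OF *[OF that] bounded_linear_Im]
    by (auto simp: o_def intro: integral_unique)
  then have "AE x in lebesgue_on {0..1}. Re (h x) = 0" "AE x in lebesgue_on {0..1}. Im (h x) = 0"
    using i by (auto intro!: AE_zero_real)
  then show ?thesis
    by eventually_elim (simp add: complex_eq_iff)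
qed

lemma has_weak_derivE:
  assumes "has_weak_deriv w z"
  obtains f where "continuous_on {0..1} f" "w = abs_l2 f"
    "\<And>x. x \<in> {0..1} \<Longrightarrow> f x = f 0 + integral {0..x} (rep_l2 z)"
  using assms continuous_indefinite[OF sq_integrable_rep_l2] unfolding has_weak_deriv_def
  by blast

lemma integral_rep_l2:
  assumes "sq_integrable f" "x \<in> {0..1}"
  shows "integral {0..x} (rep_l2 (abs_l2 f)) = integral {0..x} f"
proof (rule integral_spike)
  have "AE x in lebesgue. x \<in> {0..1} \<longrightarrow> rep_l2 (abs_l2 f) x = f x"
    using rep_abs_l2[OF assms(1)] by (subst (asm) AE_restrict_space_iff) auto
  then show "negligible {x. \<not> (x \<in> {0..1} \<longrightarrow> rep_l2 (abs_l2 f) x = f x)}"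
    unfolding negligible_iff_null_sets eventually_ae_filter
    by (auto intro: negligible_subset simp flip: negligible_iff_null_sets)
  show "f y = rep_l2 (abs_l2 f) y" if "y \<in> {0..x} - {x. \<not> (x \<in> {0..1} \<longrightarrow> rep_l2 (abs_l2 f) x = f x)}" for y
    using that assms(2) by auto
qed

lemma has_weak_deriv_unique:
  assumes "has_weak_deriv w z" "has_weak_deriv w z'"
  shows "z = z'"
proof -
  obtain f where f: "continuous_on {0..1} f" "w = abs_l2 f"
    "\<And>x. x \<in> {0..1} \<Longrightarrow> f x = f 0 + integral {0..x} (rep_l2 z)"
    using has_weak_derivE[OF assms(1)] by metis
  obtain g where g: "continuous_on {0..1} g" "w = abs_l2 g"
    "\<And>x. x \<in> {0..1} \<Longrightarrow> g x = g 0 + integral {0..x} (rep_l2 z')"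
    using has_weak_derivE[OF assms(2)] by metis
  have fg: "f x = g x" if "x \<in> {0..1}" for x
    using boundary_val_eq[OF f(1,2) that] boundary_val_eq[OF g(1,2) that] by simp
  have "integral {0..x} (\<lambda>x. rep_l2 z x - rep_l2 z' x) = 0" if "x \<in> {0..1}" for x
    using f(3)[OF that] g(3)[OF that] fg[OF that] fg[of 0] that
    by (subst integral_diff) (auto intro!: sq_integrable_integrable_on)
  moreover have "sq_integrable (\<lambda>x. rep_l2 z x - rep_l2 z' x)"
    using sq_integrable_add[OF _ sq_integrable_cmult[where c = "-1"], of "rep_l2 z" "rep_l2 z'"] by simp
  ultimately have "AE x in lebesgue_on {0..1}. rep_l2 z x = rep_l2 z' x"
    using AE_zero_complex[of "\<lambda>x. rep_l2 z x - rep_l2 z' x"] by simp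
  then have "abs_l2 (rep_l2 z) = abs_l2 (rep_l2 z')"
    by (intro abs_l2_eqI) auto
  then show ?thesis by simp
qed

lemma weak_deriv_eq: "has_weak_deriv w z \<Longrightarrow> weak_deriv w = z"
  unfolding weak_deriv_def using has_weak_deriv_unique by blast

lemma abs_l2_add: "sq_integrable f \<Longrightarrow> sq_integrable g \<Longrightarrow> abs_l2 (\<lambda>x. f x + g x) = abs_l2 f + abs_l2 g"
  by (simp add: plus_l2.abs_eq)

lemma abs_l2_scaleR: "sq_integrable f \<Longrightarrow> abs_l2 (\<lambda>x. r *\<^sub>R f x) = r *\<^sub>R abs_l2 f"
  by (simp add: scaleR_l2.abs_eq)

lemma has_weak_deriv_lincomb:
  assumes "has_weak_deriv w z" "has_weak_deriv w' z'"
  shows "has_weak_deriv (r *\<^sub>R w + s *\<^sub>R w') (r *\<^sub>R z + s *\<^sub>R z')"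
    and "x \<in> {0..1} \<Longrightarrow> boundary_val (r *\<^sub>R w + s *\<^sub>R w') x = r *\<^sub>R boundary_val w x + s *\<^sub>R boundary_val w' x"
proof -
  obtain f where f: "continuous_on {0..1} f" "w = abs_l2 f"
    "\<And>x. x \<in> {0..1} \<Longrightarrow> f x = f 0 + integral {0..x} (rep_l2 z)"
    using has_weak_derivE[OF assms(1)] by metis
  obtain g where g: "continuous_on {0..1} g" "w' = abs_l2 g"
    "\<And>x. x \<in> {0..1} \<Longrightarrow> g x = g 0 + integral {0..x} (rep_l2 z')"
    using has_weak_derivE[OF assms(2)] by metis
  have sR: "sq_integrable f \<Longrightarrow> sq_integrable (\<lambda>x. r *\<^sub>R f x)" for r f
    using sq_integrable_cmult[of f "of_real r"] by (simp add: scaleR_conv_of_real)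
  have eq: "abs_l2 (\<lambda>x. r *\<^sub>R f x + s *\<^sub>R g x) = r *\<^sub>R abs_l2 f + s *\<^sub>R abs_l2 g"
    if "sq_integrable f" "sq_integrable g" for f g
    using that by (simp add: abs_l2_add abs_l2_scaleR sR)
  have c: "continuous_on {0..1} (\<lambda>x. r *\<^sub>R f x + s *\<^sub>R g x)"
    using f g by (intro continuous_intros)
  have e: "r *\<^sub>R w + s *\<^sub>R w' = abs_l2 (\<lambda>x. r *\<^sub>R f x + s *\<^sub>R g x)"
    using f g by (simp add: eq sq_integrable_continuous)
  show "x \<in> {0..1} \<Longrightarrow> boundary_val (r *\<^sub>R w + s *\<^sub>R w') x = r *\<^sub>R boundary_val w x + s *\<^sub>R boundary_val w' x"
    using boundary_val_eq[OF c e] boundary_val_eq[OF f(1,2)] boundary_val_eq[OF g(1,2)] by simp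
  show "has_weak_deriv (r *\<^sub>R w + s *\<^sub>R w') (r *\<^sub>R z + s *\<^sub>R z')"
    unfolding has_weak_deriv_def
  proof (intro exI conjI ballI)
    show "r *\<^sub>R w + s *\<^sub>R w' = abs_l2 (\<lambda>x. r *\<^sub>R f x + s *\<^sub>R g x)" by (rule e)
    fix x :: real assume x: "x \<in> {0..1}"
    have "r *\<^sub>R z + s *\<^sub>R z' = abs_l2 (\<lambda>x. r *\<^sub>R rep_l2 z x + s *\<^sub>R rep_l2 z' x)"
      by (simp add: eq)
    then have "integral {0..x} (rep_l2 (r *\<^sub>R z + s *\<^sub>R z')) = integral {0..x} (\<lambda>x. r *\<^sub>R rep_l2 z x + s *\<^sub>R rep_l2 z' x)"
      using integral_rep_l2[OF sq_integrable_add[OF sR sR], of "rep_l2 z" "rep_l2 z'" x] x by simp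
    also have "\<dots> = r *\<^sub>R integral {0..x} (rep_l2 z) + s *\<^sub>R integral {0..x} (rep_l2 z')"
      using x by (subst integral_add) (auto intro!: sq_integrable_integrable_on sR)
    finally show "r *\<^sub>R f x + s *\<^sub>R g x = r *\<^sub>R f 0 + s *\<^sub>R g 0 + integral {0..x} (rep_l2 (r *\<^sub>R z + s *\<^sub>R z'))"
      using f(3)[OF x] g(3)[OF x] by (simp add: scaleR_add_right)
  qed
qed

definition HL2 :: "l2 set" where
  "HL2 = {w \<in> sobolev 2. boundary_val w 0 = 0 \<and> boundary_val (weak_deriv w) 0 = 0}"

lemma HL2_iff:
  "w \<in> HL2 \<longleftrightarrow> (\<exists>z y. has_weak_deriv w z \<and> has_weak_deriv z y \<and> boundary_val w 0 = 0 \<and> boundary_val z 0 = 0)"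
proof -
  have 2: "2 = Suc (Suc 0)" by simp
  show ?thesis
    unfolding HL2_def 2 sobolev.simps by (auto dest: weak_deriv_eq)
qed

lemma has_weak_deriv_0: "has_weak_deriv 0 0"
proof -
  have *: "(0::l2) = abs_l2 (\<lambda>_. 0)" by (simp add: zero_l2_def)
  show ?thesis
    unfolding has_weak_deriv_def
    by (intro exI[of _ "\<lambda>_. 0"]) (simp add: * integral_rep_l2 sq_integrable_zero)
qed

lemma boundary_val_0: "x \<in> {0..1} \<Longrightarrow> boundary_val 0 x = 0"
  by (rule boundary_val_eq[where f = "\<lambda>_. 0"]) (auto simp: zero_l2_def)

lemma HL2_0: "0 \<in> HL2"
  unfolding HL2_iff using has_weak_deriv_0 boundary_val_0 by (intro exI[of _ 0]) auto

lemma HL2_lincomb: "w \<in> HL2 \<Longrightarrow> w' \<in> HL2 \<Longrightarrow> r *\<^sub>R w + s *\<^sub>R w' \<in> HL2"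
  unfolding HL2_iff
proof (elim exE conjE)
  fix z y z' y'
  assume *: "has_weak_deriv w z" "has_weak_deriv z y" "has_weak_deriv w' z'" "has_weak_deriv z' y'"
    and 0: "boundary_val w 0 = 0" "boundary_val z 0 = 0" "boundary_val w' 0 = 0" "boundary_val z' 0 = 0"
  note 1 = has_weak_deriv_lincomb[OF *(1,3), where r = r and s = s]
    and 2 = has_weak_deriv_lincomb[OF *(2,4), where r = r and s = s]
  show "\<exists>z y. has_weak_deriv (r *\<^sub>R w + s *\<^sub>R w') z \<and> has_weak_deriv z y \<and>
      boundary_val (r *\<^sub>R w + s *\<^sub>R w') 0 = 0 \<and> boundary_val z 0 = 0"
    using 1(1) 2(1) 1(2)[of 0] 2(2)[of 0] 0
    by (intro exI[of _ "r *\<^sub>R z + s *\<^sub>R z'"] exI[of _ "r *\<^sub>R y + s *\<^sub>R y'"]) simp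
qed

lemma HL2_weak_deriv2:
  assumes "w \<in> HL2" "w' \<in> HL2"
  shows "weak_deriv (weak_deriv (r *\<^sub>R w + s *\<^sub>R w')) =
    r *\<^sub>R weak_deriv (weak_deriv w) + s *\<^sub>R weak_deriv (weak_deriv w')"
proof -
  obtain z y where 1: "has_weak_deriv w z" "has_weak_deriv z y" using assms(1) by (auto simp: HL2_iff)
  obtain z' y' where 2: "has_weak_deriv w' z'" "has_weak_deriv z' y'" using assms(2) by (auto simp: HL2_iff)
  show ?thesis
    unfolding 1[THEN weak_deriv_eq] 2[THEN weak_deriv_eq]
      weak_deriv_eq[OF has_weak_deriv_lincomb(1)[OF 1(1) 2(1)]]
      weak_deriv_eq[OF has_weak_deriv_lincomb(1)[OF 1(2) 2(2)]] ..
qed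

lemma has_weak_deriv_zero_imp:
  assumes "has_weak_deriv w 0" "boundary_val w 0 = 0"
  shows "w = 0"
proof -
  have z: "(0::l2) = abs_l2 (\<lambda>_. 0)" by (simp add: zero_l2_def)
  obtain f where f: "continuous_on {0..1} f" "w = abs_l2 f"
    "\<And>x. x \<in> {0..1} \<Longrightarrow> f x = f 0 + integral {0..x} (rep_l2 0)"
    using has_weak_derivE[OF assms(1)] by metis
  have "f 0 = 0" using boundary_val_eq[OF f(1,2), of 0] assms(2) by simp
  then have "f x = 0" if "x \<in> {0..1}" for x
    using f(3)[OF that] that by (simp add: z integral_rep_l2 sq_integrable_zero)
  then have "abs_l2 f = abs_l2 (\<lambda>_. 0)"
    using f(1) by (intro abs_l2_eqI AE_I2) (auto intro: sq_integrable_continuous sq_integrable_zero)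
  with f z show ?thesis by simp
qed

lemma HL2_eq_0:
  assumes "w \<in> HL2" "weak_deriv (weak_deriv w) = 0"
  shows "w = 0"
proof -
  obtain z y where *: "has_weak_deriv w z" "has_weak_deriv z y" "boundary_val w 0 = 0" "boundary_val z 0 = 0"
    using assms(1) by (auto simp: HL2_iff)
  with assms(2) have "y = 0" by (metis weak_deriv_eq)
  with * show ?thesis by (metis has_weak_deriv_zero_imp)
qed

typedef hl2 = HL2
  morphisms l2_of_hl2 hl2_of_l2
  using HL2_0 by blast

setup_lifting type_definition_hl2

definition deriv2 :: "hl2 \<Rightarrow> l2" where
  "deriv2 u = weak_deriv (weak_deriv (l2_of_hl2 u))"

instantiation hl2 :: real_vector
begin

lift_definition zero_hl2 :: hl2 is 0 by (rule HL2_0)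
lift_definition plus_hl2 :: "hl2 \<Rightarrow> hl2 \<Rightarrow> hl2" is "(+)"
  using HL2_lincomb[where r = 1 and s = 1] by simp
lift_definition uminus_hl2 :: "hl2 \<Rightarrow> hl2" is "uminus"
  using HL2_lincomb[OF _ HL2_0, where r = "-1" and s = 1] by simp
lift_definition minus_hl2 :: "hl2 \<Rightarrow> hl2 \<Rightarrow> hl2" is "(-)"
  using HL2_lincomb[where r = 1 and s = "-1"] by simp
lift_definition scaleR_hl2 :: "real \<Rightarrow> hl2 \<Rightarrow> hl2" is "scaleR"
  using HL2_lincomb[OF _ HL2_0, where s = 1] by simp

instance
proof
  fix u v w :: hl2 and a b :: real
  show "u + v + w = u + (v + w)" by transfer (rule add.assoc)
  show "u + v = v + u" by transfer (rule add.commute)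
  show "0 + u = u" by transfer simp
  show "- u + u = 0" by transfer simp
  show "u - v = u + - v" by transfer simp
  show "a *\<^sub>R (u + v) = a *\<^sub>R u + a *\<^sub>R v" by transfer (rule scaleR_add_right)
  show "(a + b) *\<^sub>R u = a *\<^sub>R u + b *\<^sub>R u" by transfer (rule scaleR_add_left)
  show "a *\<^sub>R b *\<^sub>R u = (a * b) *\<^sub>R u" by transfer simp
  show "1 *\<^sub>R u = u" by transfer simp
qed

end

lemma deriv2_add: "deriv2 (u + v) = deriv2 u + deriv2 v"
  using HL2_weak_deriv2[OF l2_of_hl2[of u] l2_of_hl2[of v], of 1 1]
  by (simp add: deriv2_def plus_hl2.rep_eq)

lemma deriv2_scaleR: "deriv2 (r *\<^sub>R u) = r *\<^sub>R deriv2 u"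
  using HL2_weak_deriv2[OF l2_of_hl2[of u] HL2_0, of r 0]
  by (simp add: deriv2_def scaleR_hl2.rep_eq)

lemma deriv2_eq_0_iff: "deriv2 u = 0 \<longleftrightarrow> u = 0"
proof
  assume "deriv2 u = 0"
  then have "l2_of_hl2 u = 0" using HL2_eq_0[OF l2_of_hl2[of u]] by (simp add: deriv2_def)
  then show "u = 0" by (simp flip: l2_of_hl2_inject add: zero_hl2.rep_eq)
qed (use deriv2_scaleR[of 0 0] in simp)

text \<open>A type class norm cannot depend on the physical parameters, so \<open>hl2\<close> carries the inner product
  \<open>Re \<integral> u'' \<cdot> cnj v''\<close>. Hence the norm of the product type \<open>hl2 \<times> l2 \<times> complex \<times> complex\<close> is the energy
  norm for \<open>EI = \<rho> = 1\<close>, \<open>m = J = 1\<close>. It is equivalent to the energy norm for the actual parameters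
  (\<open>energy_norm_equivalent\<close>), so that continuity, derivatives and integrals of \<open>state\<close>-valued
  functions may be taken in the type class sense.\<close>

instantiation hl2 :: real_inner
begin

definition inner_hl2 :: "hl2 \<Rightarrow> hl2 \<Rightarrow> real" where
  "inner_hl2 u v = inner (deriv2 u) (deriv2 v)"
definition norm_hl2 :: "hl2 \<Rightarrow> real" where "norm_hl2 u = sqrt (inner u u)"
definition sgn_hl2 :: "hl2 \<Rightarrow> hl2" where "sgn_hl2 u = u /\<^sub>R norm u"
definition dist_hl2 :: "hl2 \<Rightarrow> hl2 \<Rightarrow> real" where "dist_hl2 u v = norm (u - v)"
definition uniformity_hl2 :: "(hl2 \<times> hl2) filter" where
  "uniformity_hl2 = (INF e\<in>{0<..}. principal {(x, y). dist x y < e})"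
definition open_hl2 :: "hl2 set \<Rightarrow> bool" where
  "open_hl2 U \<longleftrightarrow> (\<forall>x\<in>U. eventually (\<lambda>(x', y). x' = x \<longrightarrow> y \<in> U) uniformity)"

instance
proof
  fix u v w :: hl2 and a :: real
  show "inner u v = inner v u" by (simp add: inner_hl2_def inner_commute)
  show "inner (u + v) w = inner u w + inner v w" by (simp add: inner_hl2_def deriv2_add inner_add_left)
  show "inner (a *\<^sub>R u) v = a * inner u v" by (simp add: inner_hl2_def deriv2_scaleR)
  show "0 \<le> inner u u" by (simp add: inner_hl2_def)
  show "inner u u = 0 \<longleftrightarrow> u = 0" by (simp add: inner_hl2_def deriv2_eq_0_iff)
  show "norm u = sqrt (inner u u)" by (rule norm_hl2_def)
  show "sgn u = u /\<^sub>R norm u" by (rule sgn_hl2_def)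
  show "dist u v = norm (u - v)" by (rule dist_hl2_def)
  show "(uniformity :: (hl2 \<times> hl2) filter) = (INF e\<in>{0<..}. principal {(x, y). dist x y < e})"
    by (rule uniformity_hl2_def)
  show "open U \<longleftrightarrow> (\<forall>x\<in>U. eventually (\<lambda>(x', y). x' = x \<longrightarrow> y \<in> U) uniformity)" for U :: "hl2 set"
    by (rule open_hl2_def)
qed

end

type_synonym state = "hl2 \<times> l2 \<times> complex \<times> complex"

definition energy_inner ::
    "(real \<Rightarrow> real) \<Rightarrow> (real \<Rightarrow> real) \<Rightarrow> real \<Rightarrow> real \<Rightarrow> state \<Rightarrow> state \<Rightarrow> complex" where
  "energy_inner EI \<rho> m J = (\<lambda>(u\<^sub>1, v\<^sub>1, l\<^sub>1, \<mu>\<^sub>1) (u\<^sub>2, v\<^sub>2, l\<^sub>2, \<mu>\<^sub>2).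
     (LINT x|lebesgue_on {0..1}. EI x * rep_l2 (deriv2 u\<^sub>1) x * cnj (rep_l2 (deriv2 u\<^sub>2) x)) +
     (LINT x|lebesgue_on {0..1}. \<rho> x * rep_l2 v\<^sub>1 x * cnj (rep_l2 v\<^sub>2 x)) +
     m * l\<^sub>1 * cnj l\<^sub>2 + J * \<mu>\<^sub>1 * cnj \<mu>\<^sub>2)"

definition energy_norm ::
    "(real \<Rightarrow> real) \<Rightarrow> (real \<Rightarrow> real) \<Rightarrow> real \<Rightarrow> real \<Rightarrow> state \<Rightarrow> real" where
  "energy_norm EI \<rho> m J x = sqrt (Re (energy_inner EI \<rho> m J x x))"

lemma norm_l2_sq: "(norm w)\<^sup>2 = (LINT x|lebesgue_on {0..1}. (norm (rep_l2 w x))\<^sup>2)"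
proof -
  have "(norm w)\<^sup>2 = inner (abs_l2 (rep_l2 w)) (abs_l2 (rep_l2 w))"
    by (simp add: power2_norm_eq_inner)
  also have "\<dots> = Re (LINT x|lebesgue_on {0..1}. rep_l2 w x * cnj (rep_l2 w x))"
    by (subst inner_l2.abs_eq) auto
  also have "\<dots> = (LINT x|lebesgue_on {0..1}. (norm (rep_l2 w x))\<^sup>2)"
    by (simp add: complex_norm_square[symmetric] del: of_real_power)
  finally show ?thesis .
qed

lemma weighted_norm_bounds:
  fixes g :: "real \<Rightarrow> real"
  assumes g: "continuous_on {0..1} g" "\<And>x. x \<in> {0..1} \<Longrightarrow> g x > 0"
  shows "\<exists>c>0. \<exists>C>0. \<forall>w. c * (norm w)\<^sup>2 \<le> Re (LINT x|lebesgue_on {0..1}. g x * rep_l2 w x * cnj (rep_l2 w x)) \<and>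
      Re (LINT x|lebesgue_on {0..1}. g x * rep_l2 w x * cnj (rep_l2 w x)) \<le> C * (norm w)\<^sup>2"
proof -
  obtain x0 where x0: "x0 \<in> {0..1}" "\<And>x. x \<in> {0..1} \<Longrightarrow> g x0 \<le> g x"
    using continuous_attains_inf[OF _ _ g(1)] by force
  obtain x1 where x1: "x1 \<in> {0..1}" "\<And>x. x \<in> {0..1} \<Longrightarrow> g x \<le> g x1"
    using continuous_attains_sup[OF _ _ g(1)] by force
  have gm: "g \<in> borel_measurable (lebesgue_on {0..1})"
    using g(1) by (intro continuous_imp_measurable_on_sets_lebesgue) auto
  have eq: "Re (LINT x|lebesgue_on {0..1}. g x * rep_l2 w x * cnj (rep_l2 w x)) =
      (LINT x|lebesgue_on {0..1}. g x * (norm (rep_l2 w x))\<^sup>2)" for w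
  proof -
    have "(LINT x|lebesgue_on {0..1}. g x * rep_l2 w x * cnj (rep_l2 w x)) =
       (LINT x|lebesgue_on {0..1}. complex_of_real (g x * (norm (rep_l2 w x))\<^sup>2))"
      unfolding of_real_mult complex_norm_square mult.assoc ..
    then show ?thesis by (simp del: of_real_mult of_real_power)
  qed
  have n: "integrable (lebesgue_on {0..1}) (\<lambda>x. (norm (rep_l2 w x))\<^sup>2)" for w
    using sq_integrable_rep_l2[of w] by (simp add: sq_integrable_def)
  have i: "integrable (lebesgue_on {0..1}) (\<lambda>x. g x * (norm (rep_l2 w x))\<^sup>2)" for w
  proof (rule Bochner_Integration.integrable_bound)
    show "integrable (lebesgue_on {0..1}) (\<lambda>x. g x1 * (norm (rep_l2 w x))\<^sup>2)"
      using n by simp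
    show "AE x in lebesgue_on {0..1}. norm (g x * (norm (rep_l2 w x))\<^sup>2) \<le> norm (g x1 * (norm (rep_l2 w x))\<^sup>2)"
    proof (rule AE_I2)
      fix x :: real assume "x \<in> space (lebesgue_on {0..1})"
      then have x: "x \<in> {0..1}" by simp
      have "\<bar>g x\<bar> \<le> \<bar>g x1\<bar>" using g(2)[OF x] x1(2)[OF x] by linarith
      then show "norm (g x * (norm (rep_l2 w x))\<^sup>2) \<le> norm (g x1 * (norm (rep_l2 w x))\<^sup>2)"
        by (simp add: abs_mult mult_right_mono)
    qed
    show "(\<lambda>x. g x * (norm (rep_l2 w x))\<^sup>2) \<in> borel_measurable (lebesgue_on {0..1})"
      using gm borel_measurable_integrable[OF n[of w]] by (rule borel_measurable_times)
  qed
  show ?thesis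
  proof (rule exI[of _ "g x0"], intro conjI exI[of _ "g x1"] allI)
    show "0 < g x0" "0 < g x1" using x0 x1 g(2) by auto
    fix w :: l2
    show "g x0 * (norm w)\<^sup>2 \<le> Re (LINT x|lebesgue_on {0..1}. g x * rep_l2 w x * cnj (rep_l2 w x))"
      unfolding eq norm_l2_sq integral_mult_right_zero[symmetric]
      using x0 i n by (intro integral_mono) (auto intro!: mult_right_mono)
    show "Re (LINT x|lebesgue_on {0..1}. g x * rep_l2 w x * cnj (rep_l2 w x)) \<le> g x1 * (norm w)\<^sup>2"
      unfolding eq norm_l2_sq integral_mult_right_zero[symmetric]
      using x1 i n by (intro integral_mono) (auto intro!: mult_right_mono)
  qed
qed

lemma energy_norm_equivalent:
  assumes "continuous_on {0..1} EI" "\<And>x. x \<in> {0..1} \<Longrightarrow> EI x > 0"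
    and "continuous_on {0..1} \<rho>" "\<And>x. x \<in> {0..1} \<Longrightarrow> \<rho> x > 0"
    and "m > 0" "J > 0"
  shows "\<exists>c>0. \<exists>C>0. \<forall>x. c * norm x \<le> energy_norm EI \<rho> m J x \<and>
      energy_norm EI \<rho> m J x \<le> C * norm x"
proof -
  obtain c1 C1 where 1: "0 < c1" "0 < C1"
    "\<And>w. c1 * (norm w)\<^sup>2 \<le> Re (LINT x|lebesgue_on {0..1}. EI x * rep_l2 w x * cnj (rep_l2 w x))"
    "\<And>w. Re (LINT x|lebesgue_on {0..1}. EI x * rep_l2 w x * cnj (rep_l2 w x)) \<le> C1 * (norm w)\<^sup>2"
    using weighted_norm_bounds[OF assms(1,2)] by blast
  obtain c2 C2 where 2: "0 < c2" "0 < C2"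
    "\<And>w. c2 * (norm w)\<^sup>2 \<le> Re (LINT x|lebesgue_on {0..1}. \<rho> x * rep_l2 w x * cnj (rep_l2 w x))"
    "\<And>w. Re (LINT x|lebesgue_on {0..1}. \<rho> x * rep_l2 w x * cnj (rep_l2 w x)) \<le> C2 * (norm w)\<^sup>2"
    using weighted_norm_bounds[OF assms(3,4)] by blast
  define c where "c = min (min c1 c2) (min m J)"
  define C where "C = max (max C1 C2) (max m J)"
  have c: "0 < c" "c \<le> c1" "c \<le> c2" "c \<le> m" "c \<le> J" using 1 2 assms(5,6) by (auto simp: c_def)
  have C: "0 < C" "C1 \<le> C" "C2 \<le> C" "m \<le> C" "J \<le> C" using 1 2 assms(5,6) by (auto simp: C_def)
  have bounds: "c * (norm x)\<^sup>2 \<le> Re (energy_inner EI \<rho> m J x x) \<and>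
      Re (energy_inner EI \<rho> m J x x) \<le> C * (norm x)\<^sup>2" for x
  proof -
    obtain u v k l where x: "x = (u, v, k, l)" by (cases x)
    have nx: "(norm x)\<^sup>2 = (norm (deriv2 u))\<^sup>2 + (norm v)\<^sup>2 + (norm k)\<^sup>2 + (norm l)\<^sup>2"
      by (simp add: x norm_Pair norm_hl2_def inner_hl2_def power2_norm_eq_inner)
    have e: "Re (m * k * cnj k) = m * (norm k)\<^sup>2" for m :: real and k :: complex
      unfolding cmod_power2 by (simp add: power2_eq_square algebra_simps)
    have ei: "Re (energy_inner EI \<rho> m J x x) =
       Re (LINT x|lebesgue_on {0..1}. EI x * rep_l2 (deriv2 u) x * cnj (rep_l2 (deriv2 u) x)) +
       Re (LINT x|lebesgue_on {0..1}. \<rho> x * rep_l2 v x * cnj (rep_l2 v x)) + m * (norm k)\<^sup>2 + J * (norm l)\<^sup>2"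
      unfolding x energy_inner_def prod.case plus_complex.sel by (simp only: e)
    have lo: "c * (norm (deriv2 u))\<^sup>2 \<le> c1 * (norm (deriv2 u))\<^sup>2" "c * (norm v)\<^sup>2 \<le> c2 * (norm v)\<^sup>2"
      "c * (norm k)\<^sup>2 \<le> m * (norm k)\<^sup>2" "c * (norm l)\<^sup>2 \<le> J * (norm l)\<^sup>2"
      using c by (auto intro!: mult_right_mono)
    have up: "C1 * (norm (deriv2 u))\<^sup>2 \<le> C * (norm (deriv2 u))\<^sup>2" "C2 * (norm v)\<^sup>2 \<le> C * (norm v)\<^sup>2"
      "m * (norm k)\<^sup>2 \<le> C * (norm k)\<^sup>2" "J * (norm l)\<^sup>2 \<le> C * (norm l)\<^sup>2"
      using C by (auto intro!: mult_right_mono)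
    show ?thesis
      unfolding ei nx distrib_left
      using lo up 1(3,4)[of "deriv2 u"] 2(3,4)[of v] by linarith
  qed
  show ?thesis
  proof (rule exI[of _ "sqrt c"], intro conjI exI[of _ "sqrt C"] allI)
    show "0 < sqrt c" "0 < sqrt C" using c C by auto
    fix x :: state
    show "sqrt c * norm x \<le> energy_norm EI \<rho> m J x"
      using bounds[of x] real_sqrt_le_mono[of "c * (norm x)\<^sup>2"] by (simp add: energy_norm_def real_sqrt_mult)
    show "energy_norm EI \<rho> m J x \<le> sqrt C * norm x"
      using bounds[of x] real_sqrt_le_mono[of _ "C * (norm x)\<^sup>2"] by (simp add: energy_norm_def real_sqrt_mult)
  qed
qed

definition state_cscale :: "complex \<Rightarrow> state \<Rightarrow> state" where
  "state_cscale c = (\<lambda>(u, v, l, \<mu>).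
     (hl2_of_l2 (l2_mult (\<lambda>_. c) (l2_of_hl2 u)), l2_mult (\<lambda>_. c) v, c * l, c * \<mu>))"

definition scole_dom :: "state set" where
  "scole_dom = {(u, v, l, \<mu>). l2_of_hl2 u \<in> sobolev 4 \<and> v \<in> HL2 \<and>
     boundary_val v 1 = l \<and> boundary_val (weak_deriv v) 1 = \<mu>}"

text \<open>Meaningful on \<open>scole_dom\<close> only: there \<open>v \<in> HL2\<close>, so that \<open>hl2_of_l2 v\<close> is \<open>v\<close> itself, viewed as an
  element of the first factor of the state space.\<close>

definition scole_op ::
    "(real \<Rightarrow> real) \<Rightarrow> (real \<Rightarrow> real) \<Rightarrow> real \<Rightarrow> real \<Rightarrow> state \<Rightarrow> state" where
  "scole_op EI \<rho> m J = (\<lambda>(u, v, l, \<mu>).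
     (hl2_of_l2 v,
      - l2_mult (\<lambda>x. of_real (inverse (\<rho> x))) (weak_deriv (weak_deriv (l2_mult (\<lambda>x. of_real (EI x)) (deriv2 u)))),
      inverse m * boundary_val (weak_deriv (l2_mult (\<lambda>x. of_real (EI x)) (deriv2 u))) 1,
      - inverse J * EI 1 * boundary_val (deriv2 u) 1))"

type_synonym control = "complex \<times> complex"

definition control_inner :: "real \<Rightarrow> real \<Rightarrow> control \<Rightarrow> control \<Rightarrow> complex" where
  "control_inner m J = (\<lambda>(l\<^sub>1, \<mu>\<^sub>1) (l\<^sub>2, \<mu>\<^sub>2). m * l\<^sub>1 * cnj l\<^sub>2 + J * \<mu>\<^sub>1 * cnj \<mu>\<^sub>2)"

definition control_norm :: "real \<Rightarrow> real \<Rightarrow> control \<Rightarrow> real" where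
  "control_norm m J w = sqrt (Re (control_inner m J w w))"

definition B_op :: "control \<Rightarrow> state" where
  "B_op = (\<lambda>(l, \<mu>). (0, 0, l, \<mu>))"

definition B_adj :: "state \<Rightarrow> control" where
  "B_adj = (\<lambda>(u, v, l, \<mu>). (l, \<mu>))"

lemma B_adj_adjoint:
  "control_inner m J (B_adj x) w = energy_inner EI \<rho> m J x (B_op w)"
proof -
  have d0: "deriv2 0 = 0" by (simp add: deriv2_eq_0_iff)
  have "AE x in lebesgue_on {0..1}. rep_l2 0 x = 0"
    using rep_abs_l2[OF sq_integrable_zero] by (simp add: zero_l2_def)
  then have "AE x in lebesgue_on {0..1}. g x * cnj (rep_l2 0 x) = 0" for g :: "real \<Rightarrow> complex"
    by eventually_elim simp
  then have "(LINT x|lebesgue_on {0..1}. g x * cnj (rep_l2 0 x)) = 0" for g :: "real \<Rightarrow> complex"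
    by (rule integral_eq_zero_AE)
  then show ?thesis
    by (simp add: control_inner_def energy_inner_def B_adj_def B_op_def d0 split: prod.splits)
qed

definition c0_semigroup :: "(real \<Rightarrow> state \<Rightarrow> state) \<Rightarrow> bool" where
  "c0_semigroup T \<longleftrightarrow>
     (\<forall>t\<ge>0. bounded_linear (T t) \<and> (\<forall>c x. T t (state_cscale c x) = state_cscale c (T t x))) \<and>
     (\<forall>x. T 0 x = x) \<and>
     (\<forall>s\<ge>0. \<forall>t\<ge>0. \<forall>x. T (s + t) x = T s (T t x)) \<and>
     (\<forall>x. ((\<lambda>t. T t x) \<longlongrightarrow> x) (at_right 0))"

text \<open>The operator \<open>A\<close> with domain \<open>D\<close> is the infinitesimal generator of \<open>T\<close>; this includes equality of
  the domains.\<close>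

definition is_generator :: "(real \<Rightarrow> state \<Rightarrow> state) \<Rightarrow> state set \<Rightarrow> (state \<Rightarrow> state) \<Rightarrow> bool" where
  "is_generator T D A \<longleftrightarrow>
     (\<forall>x y. ((\<lambda>h. (T h x - x) /\<^sub>R h) \<longlongrightarrow> y) (at_right 0) \<longleftrightarrow> x \<in> D \<and> y = A x)"

definition classical_solution ::
    "state set \<Rightarrow> (state \<Rightarrow> state) \<Rightarrow> (control \<Rightarrow> control) \<Rightarrow> (real \<Rightarrow> state) \<Rightarrow> bool" where
  "classical_solution D A \<phi> x \<longleftrightarrow>
     (\<exists>x'. continuous_on {0..} x' \<and>
       (\<forall>t\<ge>0. (x has_vector_derivative x' t) (at t within {0..}) \<and>
         x t \<in> D \<and> x' t = A (x t) - B_op (\<phi> (B_adj (x t)))))"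

definition mild_solution ::
    "(real \<Rightarrow> state \<Rightarrow> state) \<Rightarrow> (control \<Rightarrow> control) \<Rightarrow> (real \<Rightarrow> state) \<Rightarrow> bool" where
  "mild_solution T \<phi> x \<longleftrightarrow> continuous_on {0..} x \<and>
     (\<forall>t\<ge>0. \<exists>I. ((\<lambda>s. T (t - s) (B_op (\<phi> (B_adj (x s))))) has_integral I) {0..t} \<and>
        x t = T t (x 0) - I)"

text \<open>\<open>f \<in> C\<^sup>k([0,1])\<close>, with one-sided derivatives at the end points.\<close>

primrec C_k :: "nat \<Rightarrow> (real \<Rightarrow> real) \<Rightarrow> bool" where
  "C_k 0 f \<longleftrightarrow> continuous_on {0..1} f"
| "C_k (Suc k) f \<longleftrightarrow>
     (\<exists>f'. (\<forall>x\<in>{0..1}. (f has_real_derivative f' x) (at x within {0..1})) \<and> C_k k f')"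

definition deriv01 :: "(real \<Rightarrow> real) \<Rightarrow> real \<Rightarrow> real" where
  "deriv01 f x = vector_derivative f (at x within {0..1})"

end

theory Submission
  imports Defs
begin

text \<open>
  Let \<open>A\<close> be the skew-adjoint operator of the beam and \<open>R = A\<^sup>-\<^sup>1\<close>, which is explicit in terms of iterated
  integrals. Classical and mild solutions both satisfy \<open>(R x)' = x - R B d\<close> with \<open>d = \<phi> (B\<^sup>* x)\<close>, so it
  suffices to study \<open>y = R x\<close>, which is differentiable and one order smoother than \<open>x\<close>.

  One constructs a bounded quadratic form \<open>W\<close> with \<open>W x (R x) + W (R x) x \<le> - \<epsilon> |R x|\<^sup>2 + C |B\<^sup>* x|\<^sup>2\<close>.
  Its main part is the multiplier form \<open>Re \<integral> \<rho> v \<cdot> cnj (\<zeta> u')\<close> with \<open>\<zeta> = exp (N s)\<close>, for which the sign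
  conditions on \<open>\<zeta>\<close> hold as soon as \<open>N\<close> is large. The lower order terms that it leaves are controlled by
  finitely many observations \<open>B\<^sup>* R\<^sup>j x\<close>: the norms \<open>|R\<^sup>n y|\<close> are logarithmically convex as \<open>R\<close> is skew,
  whereas \<open>R\<^sup>2\<close> is, up to these observations, a Volterra operator from the end \<open>s = 1\<close>, whose powers decay
  faster than any geometric sequence. The observations with \<open>j \<ge> 1\<close> are absorbed by the forms
  \<open>B\<^sup>* R\<^sup>j x \<bullet> B\<^sup>* R\<^sup>j\<^sup>+\<^sup>1 x\<close>, since differentiation in time lowers \<open>j\<close> by one.

  Adding a large multiple of the energy \<open>E\<close> to \<open>W y y\<close> gives a Lyapunov function \<open>L\<close>, comparable to \<open>E\<close>,
  with \<open>L' \<le> - c |R x|\<^sup>2\<close>. Monotonicity of \<open>\<phi>\<close> makes \<open>|x (t + h) - x t|\<close> nonincreasing in \<open>t\<close>; as \<open>R\<close> is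
  skew, this controls \<open>E\<close> by \<open>|R x|\<close>. For classical solutions \<open>E \<le> K |R x|\<close>, so \<open>L' \<le> - k L\<^sup>2\<close> and
  \<open>E = O(1/t)\<close>; for mild solutions, a positive lower bound of \<open>E\<close> would make \<open>L\<close> negative.
\<close>

section \<open>Quadratic dissipation for skew operators\<close>

text \<open>The damping sees only the two tip velocities, so it cannot be compared with the full
  energy. The estimates are therefore made in the weaker norm |R x|, and this loss of one order is
  what turns decay into an algebraic rate. The lower order terms that a multiplier leaves are
  commonly removed by compactness and unique continuation; here one quantitative fact replaces both.
  If |R y| > \<delta> |y|, skewness forces |R^n y| \<ge> \<delta>^n |y| for all n, while the
  Volterra structure bounds |R^(2k+2) y| by K \<theta>^k |y| plus observations, for every \<theta> >
  0 and with K independent of k. For \<theta> < \<delta>^2 and large k both can hold only if the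
  observations dominate y. A mild solution need not be differentiable or enter the domain of A, but
  R x is differentiable. Hence W is evaluated at R x: when (R x)' = x, its derivative is W x (R x) +
  W (R x) x, an expression that makes sense for all x. The feedback adds terms bounded by a multiple
  of |R x| |Bs x|, which Young's inequality absorbs.\<close>

lemma bounded_bilinear_add:
  assumes "bounded_bilinear f" "bounded_bilinear g"
  shows "bounded_bilinear (\<lambda>x y. f x y + g x y)"
proof -
  interpret f: bounded_bilinear f by fact
  interpret g: bounded_bilinear g by fact
  obtain K L where K: "\<And>x y. norm (f x y) \<le> norm x * norm y * K" and L: "\<And>x y. norm (g x y) \<le> norm x * norm y * L"
    using f.bounded g.bounded by auto
  show ?thesis
  proof
    show "\<exists>K. \<forall>x y. norm (f x y + g x y) \<le> norm x * norm y * K"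
      by (intro exI[of _ "K + L"] allI) (use K L in \<open>simp add: distrib_left norm_triangle_mono\<close>)
  qed (simp_all add: f.add_left f.add_right g.add_left g.add_right
      f.scaleR_left f.scaleR_right g.scaleR_left g.scaleR_right scaleR_add_right)
qed

lemma bounded_bilinear_cmult:
  fixes f :: "'a::real_normed_vector \<Rightarrow> 'b::real_normed_vector \<Rightarrow> real"
  assumes "bounded_bilinear f"
  shows "bounded_bilinear (\<lambda>x y. c * f x y)"
proof -
  interpret f: bounded_bilinear f by fact
  obtain K where K: "\<And>x y. norm (f x y) \<le> norm x * norm y * K"
    using f.bounded by auto
  show ?thesis
  proof
    show "\<exists>K. \<forall>x y. norm (c * f x y) \<le> norm x * norm y * K"
    proof (intro exI[of _ "\<bar>c\<bar> * K"] allI)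
      fix x y
      show "norm (c * f x y) \<le> norm x * norm y * (\<bar>c\<bar> * K)"
        using mult_left_mono[OF K[of x y], of "\<bar>c\<bar>"] by (simp add: abs_mult mult_ac)
    qed
  qed (simp_all add: f.add_left f.add_right f.scaleR_left f.scaleR_right algebra_simps)
qed

text \<open>The form \<open>e\<close> is kept apart from the type class norm because the energy
  depends on the coefficients of the beam; boundedness and \<open>e_coercive\<close> make the two
  norms equivalent. \<open>Bs\<close> stands for the adjoint of the control operator.\<close>

locale skew_system =
  fixes e :: "'a::real_normed_vector \<Rightarrow> 'a \<Rightarrow> real" and R :: "'a \<Rightarrow> 'a" and Bs :: "'a \<Rightarrow> 'b::euclidean_space"
  assumes e: "bounded_bilinear e" and e_sym: "e x y = e y x"
    and e_coercive: "\<exists>c>0. \<forall>x. c * (norm x)\<^sup>2 \<le> e x x"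
    and R: "bounded_linear R" and Bs: "bounded_linear Bs"
    and skew: "e (R x) z = - e x (R z)"
begin

sublocale e: bounded_bilinear e by (rule e)
sublocale R: bounded_linear R by (rule R)
sublocale Bs: bounded_linear Bs by (rule Bs)

definition en :: "'a \<Rightarrow> real" where "en x = sqrt (e x x)"

lemma e_nonneg: "0 \<le> e x x"
  using e_coercive by (metis order_trans less_imp_le mult_nonneg_nonneg zero_le_power2)

lemma e_self: "e x x = (en x)\<^sup>2" by (simp add: en_def e_nonneg)

lemma en_nonneg: "0 \<le> en x" by (simp add: en_def e_nonneg)

lemma en_bounds: "\<exists>c1>0. \<exists>c2>0. \<forall>x. c1 * norm x \<le> en x \<and> en x \<le> c2 * norm x"
proof -
  obtain c where c: "c > 0" "\<And>x. c * (norm x)\<^sup>2 \<le> e x x" using e_coercive by auto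
  obtain C where C: "C > 0" "\<And>x y. norm (e x y) \<le> norm x * norm y * C"
    using e.pos_bounded by auto
  have "sqrt c * norm x \<le> en x" for x
    using real_sqrt_le_mono[OF c(2)[of x]] by (simp add: en_def real_sqrt_mult)
  moreover have "en x \<le> sqrt C * norm x" for x
  proof -
    have "e x x \<le> C * (norm x)\<^sup>2" using C(2)[of x x] by (simp add: power2_eq_square mult_ac)
    then show ?thesis using real_sqrt_le_mono[of "e x x" "C * (norm x)\<^sup>2"] by (simp add: en_def real_sqrt_mult)
  qed
  ultimately show ?thesis using c(1) C(1) by (intro exI[of _ "sqrt c"] exI[of _ "sqrt C"] conjI allI) auto
qed

lemma e_Cauchy_Schwarz: "\<bar>e x y\<bar> \<le> en x * en y"
proof (cases "e y y = 0")
  case True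
  then have "norm y = 0" using e_coercive by (metis mult_le_0_iff not_less power2_less_eq_zero_iff norm_eq_zero zero_le_power2 antisym_conv order.strict_iff_not)
  then show ?thesis by (simp add: e.zero_right en_def)
next
  case False
  then have pos: "e y y > 0" using e_nonneg[of y] by simp
  have "0 \<le> e (e y y *\<^sub>R x - e x y *\<^sub>R y) (e y y *\<^sub>R x - e x y *\<^sub>R y)" by (rule e_nonneg)
  also have "\<dots> = e y y * (e x x * e y y - (e x y)\<^sup>2)"
    by (simp add: e.diff_left e.diff_right e.scaleR_left e.scaleR_right e_sym[of y x] algebra_simps power2_eq_square)
  finally have "(e x y)\<^sup>2 \<le> e x x * e y y" using pos by (simp add: zero_le_mult_iff)
  then have "sqrt ((e x y)\<^sup>2) \<le> sqrt (e x x * e y y)" by (rule real_sqrt_le_mono)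
  then show ?thesis by (simp add: en_def real_sqrt_mult)
qed

lemma e_R_self: "e (R x) x = 0"
  using skew[of x x] by (simp add: e_sym)

text \<open>The norms \<open>en (R\<^sup>n y)\<close> are logarithmically convex in \<open>n\<close>.\<close>

lemma en_power_lower:
  assumes "0 \<le> \<delta>" "\<delta> * en y \<le> en (R y)"
  shows "\<delta> ^ n * en y \<le> en ((R ^^ n) y)"
proof -
  \<comment> \<open>Skewness turns \<open>e (R z) (R z)\<close> into \<open>- e z (R (R z))\<close>,
    to which Cauchy-Schwarz applies. Hence the ratios of successive norms are nondecreasing.\<close>
  have conv: "(en (R z))\<^sup>2 \<le> en z * en (R (R z))" for z
    using e_Cauchy_Schwarz[of z "R (R z)"] skew[of z "R z"] by (simp flip: e_self)
  have step: "\<delta> * en ((R ^^ n) y) \<le> en ((R ^^ Suc n) y)" for n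
  proof (induction n)
    case (Suc n)
    define p q r where "p = en ((R ^^ n) y)" and "q = en ((R ^^ Suc n) y)" and "r = en ((R ^^ Suc (Suc n)) y)"
    have pq: "\<delta> * p \<le> q" and c: "q\<^sup>2 \<le> p * r" and nn: "0 \<le> p" "0 \<le> q" "0 \<le> r"
      using Suc conv[of "(R ^^ n) y"] by (simp_all add: p_def q_def r_def en_nonneg)
    have "\<delta> * q \<le> r"
    proof (cases "q = 0")
      case False
      then have "p > 0" using c nn by (metis mult_zero_left order_le_less power2_less_eq_zero_iff zero_less_power2 not_le)
      have "p * (\<delta> * q) \<le> q * q" using mult_right_mono[OF pq nn(2)] by (simp add: mult_ac)
      also have "\<dots> \<le> p * r" using c by (simp add: power2_eq_square)
      finally show ?thesis using \<open>p > 0\<close> by simp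
    qed (use nn in simp)
    then show ?case by (simp add: q_def r_def)
  qed (use assms in simp)
  show ?thesis
  proof (induction n)
    case (Suc n)
    have "\<delta> ^ Suc n * en y = \<delta> * (\<delta> ^ n * en y)" by simp
    also have "\<dots> \<le> \<delta> * en ((R ^^ n) y)" using Suc assms(1) by (rule mult_left_mono)
    also have "\<dots> \<le> en ((R ^^ Suc n) y)" by (rule step)
    finally show ?case .
  qed simp
qed

text \<open>For the beam, \<open>obs 0\<close> consists of the tip velocities and
  \<open>obs (Suc n)\<close> of the value and the slope at the tip of the displacement of R^n
  x.\<close>

definition obs :: "nat \<Rightarrow> 'a \<Rightarrow> 'b" where "obs j x = Bs ((R ^^ j) x)"

lemma obs_R: "obs j (R x) = obs (Suc j) x"
  by (simp add: obs_def funpow_swap1)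

lemma bounded_linear_R_power: "bounded_linear (R ^^ n)"
proof (induction n)
  case 0
  then show ?case by (simp add: bounded_linear_ident id_def)
next
  case (Suc n)
  then show ?case using bounded_linear_compose[OF R Suc] by (simp add: o_def)
qed

lemma bounded_linear_obs: "bounded_linear (obs j)"
  unfolding obs_def by (rule bounded_linear_compose[OF Bs bounded_linear_R_power])

text \<open>Either \<open>R\<close> shrinks y by the factor \<eta> and nothing is left to show, or
  the lower bound for the powers of \<open>R\<close> contradicts \<open>decay\<close> unless the
  observations control y. Hence the order of quantifiers in \<open>decay\<close>: K is fixed before
  k, whereas C may depend on k. The name refers to the part of y on which the inverse
  \<open>R\<close> of the generator is not small.\<close>

lemma low_frequency_bound:
  assumes decay: "\<And>\<theta>. \<theta> > 0 \<Longrightarrow> \<exists>K. \<forall>k. \<exists>C. \<forall>y.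
      norm ((R ^^ (2 * k + 2)) y) \<le> K * \<theta> ^ k * norm y + C * (\<Sum>j\<le>2 * k + 3. norm (obs j y))"
    and "\<delta> > 0"
  shows "\<exists>n C. \<forall>y. norm (R y) \<le> \<delta> * norm y + C * (\<Sum>j\<le>n. norm (obs j y))"
proof -
  obtain c1 c2 where c: "c1 > 0" "c2 > 0" "\<And>x. c1 * norm x \<le> en x" "\<And>x. en x \<le> c2 * norm x"
    using en_bounds by auto
  \<comment> \<open>The factor c1 / c2 passes from the norm to \<open>en\<close>, for which
    logarithmic convexity holds.\<close>
  define \<eta> where "\<eta> = \<delta> * c1 / c2"
  have \<eta>: "\<eta> > 0" using c \<open>\<delta> > 0\<close> by (simp add: \<eta>_def)
  obtain K where K: "\<And>k. \<exists>C. \<forall>y. norm ((R ^^ (2 * k + 2)) y)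
      \<le> K * (\<eta>\<^sup>2 / 2) ^ k * norm y + C * (\<Sum>j\<le>2 * k + 3. norm (obs j y))"
    using decay[of "\<eta>\<^sup>2 / 2"] \<eta> by auto
  \<comment> \<open>With \<theta> = \<eta>^2 / 2 the upper bound divided by the lower one is of
    order 2^(-k); for this k the term with K takes at most half of the left-hand side.\<close>
  obtain k where k: "2 * \<bar>K\<bar> * c2 / (c1 * \<eta>\<^sup>2) < 2 ^ k"
    using real_arch_pow[of 2 "2 * \<bar>K\<bar> * c2 / (c1 * \<eta>\<^sup>2)"] by auto
  obtain C where C: "\<And>y. norm ((R ^^ (2 * k + 2)) y)
      \<le> K * (\<eta>\<^sup>2 / 2) ^ k * norm y + C * (\<Sum>j\<le>2 * k + 3. norm (obs j y))"
    using K[of k] by auto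
  obtain KR where KR: "KR > 0" "\<And>x. norm (R x) \<le> norm x * KR" using R.pos_bounded by auto
  define M where "M = KR * (2 * c2 * \<bar>C\<bar> / (c1 * \<eta> ^ (2 * k + 2)))"
  have "norm (R y) \<le> \<delta> * norm y + M * (\<Sum>j\<le>2 * k + 3. norm (obs j y))" for y
  proof (cases "en (R y) \<le> \<eta> * en y")
    case True
    have "c1 * norm (R y) \<le> \<eta> * (c2 * norm y)"
      using c(3)[of "R y"] True mult_left_mono[OF c(4)[of y], of \<eta>] \<eta> by linarith
    also have "\<dots> = c1 * (\<delta> * norm y)" using c(2) by (simp add: \<eta>_def)
    finally have "norm (R y) \<le> \<delta> * norm y" using c(1) by simp
    moreover have "0 \<le> M" using KR c \<eta> by (simp add: M_def)
    ultimately show ?thesis by (smt (verit) mult_nonneg_nonneg norm_ge_zero sum_nonneg)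
  next
    case False
    define S where "S = (\<Sum>j\<le>2 * k + 3. norm (obs j y))"
    have S: "0 \<le> S" by (simp add: S_def sum_nonneg)
    have "\<eta> ^ (2 * k + 2) * (c1 * norm y) \<le> \<eta> ^ (2 * k + 2) * en y"
      using c(3)[of y] \<eta> by (intro mult_left_mono) auto
    also have "\<dots> \<le> en ((R ^^ (2 * k + 2)) y)"
      using False \<eta> by (intro en_power_lower) auto
    also have "\<dots> \<le> c2 * norm ((R ^^ (2 * k + 2)) y)" by (rule c(4))
    also have "\<dots> \<le> c2 * (K * (\<eta>\<^sup>2 / 2) ^ k * norm y + C * S)"
      using C[of y] c(2) unfolding S_def by (intro mult_left_mono) auto
    also have "\<dots> \<le> \<eta> ^ (2 * k + 2) * c1 * norm y / 2 + c2 * \<bar>C\<bar> * S"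
    proof -
      have "2 * \<bar>K\<bar> * c2 \<le> 2 ^ k * (c1 * \<eta>\<^sup>2)"
        using k c \<eta> by (simp add: divide_less_eq split: if_splits)
      then have "2 * (c2 * \<bar>K\<bar>) / 2 ^ k \<le> c1 * \<eta>\<^sup>2" by (simp add: divide_le_eq mult_ac)
      then have le: "(2 * (c2 * \<bar>K\<bar>) / 2 ^ k) * (\<eta> ^ (2 * k) / 2) \<le> c1 * \<eta>\<^sup>2 * (\<eta> ^ (2 * k) / 2)"
        using \<eta> by (intro mult_right_mono) auto
      have "c2 * K * (\<eta>\<^sup>2 / 2) ^ k \<le> c2 * \<bar>K\<bar> * (\<eta>\<^sup>2 / 2) ^ k"
        using c \<eta> by (intro mult_right_mono mult_left_mono) auto
      also have "\<dots> = (2 * (c2 * \<bar>K\<bar>) / 2 ^ k) * (\<eta> ^ (2 * k) / 2)"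
        by (simp add: power_divide power_mult)
      also note le
      also have "c1 * \<eta>\<^sup>2 * (\<eta> ^ (2 * k) / 2) = \<eta> ^ (2 * k + 2) * c1 / 2"
        by (simp add: power_add power2_eq_square mult_ac)
      finally have "c2 * K * (\<eta>\<^sup>2 / 2) ^ k \<le> \<eta> ^ (2 * k + 2) * c1 / 2" .
      then have "c2 * K * (\<eta>\<^sup>2 / 2) ^ k * norm y \<le> \<eta> ^ (2 * k + 2) * c1 / 2 * norm y"
        by (rule mult_right_mono) simp
      moreover have "c2 * C * S \<le> c2 * \<bar>C\<bar> * S" using c S by (intro mult_right_mono mult_left_mono) auto
      ultimately show ?thesis by (simp add: algebra_simps)
    qed
    finally have "c1 * \<eta> ^ (2 * k + 2) * norm y \<le> 2 * c2 * \<bar>C\<bar> * S" by (simp add: algebra_simps)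
    then have "norm y \<le> 2 * c2 * \<bar>C\<bar> / (c1 * \<eta> ^ (2 * k + 2)) * S"
      using c \<eta> by (simp add: pos_le_divide_eq mult_ac)
    then have "KR * norm y \<le> M * S" 
    proof -
      assume "norm y \<le> 2 * c2 * \<bar>C\<bar> / (c1 * \<eta> ^ (2 * k + 2)) * S"
      from mult_left_mono[OF this, of KR] KR(1) show ?thesis by (simp add: M_def)
    qed
    then have "norm (R y) \<le> M * S" using KR(2)[of y] by (simp add: mult.commute)
    then show ?thesis using \<open>\<delta> > 0\<close> unfolding S_def by (smt (verit) mult_nonneg_nonneg norm_ge_zero)
  qed
  then show ?thesis by blast
qed

lemma bounded_bilinear_zero: "bounded_bilinear (\<lambda>x y. 0 :: real)"
  by (rule bounded_bilinear.intro) (auto intro: exI[of _ 0])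

text \<open>For the form \<open>obs n x \<bullet> obs (Suc n) y\<close>, the expression W x (R x) +
  W (R x) x equals |obs (Suc n) x|^2 plus the product of \<open>obs n x\<close> and
  \<open>obs (Suc (Suc n)) x\<close>. The latter factor is bounded by |R x|, since one
  \<open>R\<close> can be split off; the former is left to the induction hypothesis.\<close>

lemma obs_dissipation:
  assumes "\<delta> > 0"
  shows "\<exists>W C. bounded_bilinear W \<and>
    (\<forall>x. (norm (obs n x))\<^sup>2 \<le> W x (R x) + W (R x) x + \<delta> * (norm (R x))\<^sup>2 + C * (norm (obs 0 x))\<^sup>2)"
  using assms
proof (induction n arbitrary: \<delta>)
  case 0
  show ?case
    using 0 by (intro exI[of _ "\<lambda>x y. 0"] exI[of _ 1]) (auto simp: bounded_bilinear_zero)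
next
  case (Suc n)
  interpret o1: bounded_linear "obs (Suc n)" by (rule bounded_linear_obs)
  obtain K where K: "K > 0" "\<And>x. norm (obs (Suc n) x) \<le> norm x * K" using o1.pos_bounded by auto
  \<comment> \<open>The weight in Young's inequality: a K^2 = \<delta> / 2 pays for
    \<open>obs (Suc (Suc n)) x\<close>, and the tolerance 2 a \<delta> of the induction hypothesis
    becomes the other \<delta> / 2 after division by 4 a.\<close>
  define a where "a = \<delta> / (2 * K\<^sup>2)"
  have a: "a > 0" using Suc.prems K(1) by (simp add: a_def)
  obtain W C where W: "bounded_bilinear W"
    "\<And>x. (norm (obs n x))\<^sup>2 \<le> W x (R x) + W (R x) x + (2 * a * \<delta>) * (norm (R x))\<^sup>2 + C * (norm (obs 0 x))\<^sup>2"
    using Suc.IH[of "2 * a * \<delta>"] a Suc.prems by auto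
  interpret W: bounded_bilinear W by (rule W(1))
  define W' where "W' = (\<lambda>x y. obs n x \<bullet> obs (Suc n) y + 1 / (4 * a) * W x y)"
  have "bounded_bilinear W'"
    unfolding W'_def
    by (intro bounded_bilinear_add bounded_bilinear_cmult W(1)
        bounded_bilinear.comp[OF bounded_bilinear_inner bounded_linear_obs bounded_linear_obs])
  moreover have "(norm (obs (Suc n) x))\<^sup>2 \<le> W' x (R x) + W' (R x) x + \<delta> * (norm (R x))\<^sup>2 + C / (4 * a) * (norm (obs 0 x))\<^sup>2" for x
  proof -
    define p q where "p = obs n x" and "q = obs (Suc (Suc n)) x"
    have "norm q \<le> K * norm (R x)" using K(2)[of "R x"] by (simp add: q_def obs_R mult.commute)
    then have q: "(norm q)\<^sup>2 \<le> K\<^sup>2 * (norm (R x))\<^sup>2" by (metis norm_ge_zero power_mono power_mult_distrib)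
    have "- (p \<bullet> q) \<le> norm p * norm q" using Cauchy_Schwarz_ineq2[of p q] by simp
    also have "\<dots> \<le> a * (norm q)\<^sup>2 + (norm p)\<^sup>2 / (4 * a)"
    proof -
      have "0 \<le> (2 * a * norm q - norm p)\<^sup>2 / (4 * a)" using a by simp
      also have "\<dots> = a * (norm q)\<^sup>2 + (norm p)\<^sup>2 / (4 * a) - norm p * norm q"
        using a by (simp add: power2_eq_square field_simps)
      finally show ?thesis by simp
    qed
    also have "\<dots> \<le> a * (K\<^sup>2 * (norm (R x))\<^sup>2) + (W x (R x) + W (R x) x + (2 * a * \<delta>) * (norm (R x))\<^sup>2 + C * (norm (obs 0 x))\<^sup>2) / (4 * a)"
      using q W(2)[of x] a by (intro add_mono mult_left_mono divide_right_mono) (auto simp: p_def)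
    also have "\<dots> = (W x (R x) + W (R x) x) / (4 * a) + \<delta> * (norm (R x))\<^sup>2 + C / (4 * a) * (norm (obs 0 x))\<^sup>2"
    proof -
      have "a * K\<^sup>2 = \<delta> / 2" using K(1) by (simp add: a_def)
      then have "a * (K\<^sup>2 * (norm (R x))\<^sup>2) = \<delta> / 2 * (norm (R x))\<^sup>2" by (simp add: mult.assoc[symmetric])
      then show ?thesis using a by (simp add: field_simps)
    qed
    finally have "- (p \<bullet> q) \<le> \<dots>" .
    moreover have "W' x (R x) + W' (R x) x = p \<bullet> q + (norm (obs (Suc n) x))\<^sup>2 + (W x (R x) + W (R x) x) / (4 * a)"
      by (simp add: W'_def obs_R p_def q_def power2_norm_eq_inner add_divide_distrib)
    ultimately show ?thesis by simp
  qed
  ultimately show ?case by blast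
qed

lemma obs_sum_dissipation:
  assumes "\<delta> > 0"
  shows "\<exists>W C. bounded_bilinear W \<and>
    (\<forall>x. (\<Sum>j\<le>n. (norm (obs j x))\<^sup>2) \<le> W x (R x) + W (R x) x + \<delta> * (norm (R x))\<^sup>2 + C * (norm (obs 0 x))\<^sup>2)"
  using assms
proof (induction n arbitrary: \<delta>)
  case 0
  then show ?case using obs_dissipation[of \<delta> 0] by simp
next
  case (Suc n)
  obtain W C where W: "bounded_bilinear W"
    "\<And>x. (\<Sum>j\<le>n. (norm (obs j x))\<^sup>2) \<le> W x (R x) + W (R x) x + \<delta> / 2 * (norm (R x))\<^sup>2 + C * (norm (obs 0 x))\<^sup>2"
    using Suc.IH[of "\<delta> / 2"] Suc.prems by auto
  obtain W' C' where W': "bounded_bilinear W'"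
    "\<And>x. (norm (obs (Suc n) x))\<^sup>2 \<le> W' x (R x) + W' (R x) x + \<delta> / 2 * (norm (R x))\<^sup>2 + C' * (norm (obs 0 x))\<^sup>2"
    using obs_dissipation[of "\<delta> / 2" "Suc n"] Suc.prems by auto
  show ?case
  proof (intro exI[of _ "\<lambda>x y. W x y + W' x y"] exI[of _ "C + C'"] conjI allI)
    show "bounded_bilinear (\<lambda>x y. W x y + W' x y)" by (rule bounded_bilinear_add[OF W(1) W'(1)])
    show "(\<Sum>j\<le>Suc n. (norm (obs j x))\<^sup>2) \<le> W x (R x) + W' x (R x) + (W (R x) x + W' (R x) x)
        + \<delta> * (norm (R x))\<^sup>2 + (C + C') * (norm (obs 0 x))\<^sup>2" for x
      using W(2)[of x] W'(2)[of x] by (simp add: algebra_simps)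
  qed
qed

text \<open>The term |R (R x)|^2 in \<open>key\<close> is one order weaker than |R x|^2;
  \<open>low\<close>, applied to R x, trades it for a small multiple of |R x|^2 and further
  observations. Subtracting P times the form of \<open>obs_sum_dissipation\<close> then leaves only
  \<open>Bs x\<close>.\<close>

lemma dissipation_form:
  assumes V: "bounded_bilinear V" and "\<epsilon> > 0"
    and key: "\<And>x. V x (R x) + V (R x) x \<le> - \<epsilon> * (norm (R x))\<^sup>2 + C * ((\<Sum>j\<le>2. (norm (obs j x))\<^sup>2) + (norm (R (R x)))\<^sup>2)"
    and low: "\<And>\<delta>. \<delta> > 0 \<Longrightarrow> \<exists>n C. \<forall>y. norm (R y) \<le> \<delta> * norm y + C * (\<Sum>j\<le>n. norm (obs j y))"
  shows "\<exists>W \<epsilon> C. bounded_bilinear W \<and> \<epsilon> > 0 \<and>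
    (\<forall>x. W x (R x) + W (R x) x \<le> - \<epsilon> * (norm (R x))\<^sup>2 + C * (norm (Bs x))\<^sup>2)"
proof -
  define A where "A = \<bar>C\<bar> + 1"
  have A: "A > 0" "C \<le> A" by (auto simp: A_def)
  \<comment> \<open>Chosen so that the contribution 2 A \<delta>^2 of \<open>low\<close> equals
    \<epsilon> / 2; the tolerance \<epsilon> / (4 P) used below, multiplied by P, takes another
    \<epsilon> / 4.\<close>
  define \<delta> where "\<delta> = sqrt (\<epsilon> / (4 * A))"
  have \<delta>: "\<delta> > 0" "\<delta>\<^sup>2 = \<epsilon> / (4 * A)" using A \<open>\<epsilon> > 0\<close> by (auto simp: \<delta>_def)
  obtain n D where D: "\<And>y. norm (R y) \<le> \<delta> * norm y + D * (\<Sum>j\<le>n. norm (obs j y))"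
    using low[OF \<delta>(1)] by auto
  define P where "P = A * (1 + 2 * D\<^sup>2 * real (Suc n))"
  have P: "P > 0" using A by (simp add: P_def add_pos_nonneg)
  define S where "S = (\<lambda>x. \<Sum>j\<le>n + 2. (norm (obs j x))\<^sup>2)"
  have V1: "V x (R x) + V (R x) x \<le> - (\<epsilon> / 2) * (norm (R x))\<^sup>2 + P * S x" for x
  proof -
    define s where "s = (\<Sum>j\<le>n. norm (obs (Suc j) x))"
    have "s\<^sup>2 \<le> real (Suc n) * (\<Sum>j\<le>n. (norm (obs (Suc j) x))\<^sup>2)"
      using sum_squared_le_sum_of_squares[of "\<lambda>j. norm (obs (Suc j) x)" "{..n}"] by (simp add: s_def mult_ac)
    also have "(\<Sum>j\<le>n. (norm (obs (Suc j) x))\<^sup>2) = (\<Sum>j\<in>{1..Suc n}. (norm (obs j x))\<^sup>2)"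
      by (rule sum.reindex_bij_witness[of _ "\<lambda>j. j - 1" Suc]) auto
    also have "\<dots> \<le> S x" unfolding S_def by (rule sum_mono2) auto
    finally have s: "s\<^sup>2 \<le> real (Suc n) * S x" by simp
    have "norm (R (R x)) \<le> \<delta> * norm (R x) + D * s" using D[of "R x"] by (simp add: obs_R s_def)
    then have "(norm (R (R x)))\<^sup>2 \<le> (\<delta> * norm (R x) + D * s)\<^sup>2" by (intro power_mono) auto
    also have "\<dots> \<le> 2 * (\<delta> * norm (R x))\<^sup>2 + 2 * (D * s)\<^sup>2"
      using sum_squares_bound[of "\<delta> * norm (R x)" "D * s"] by (simp add: power2_sum)
    also have "\<dots> \<le> 2 * \<delta>\<^sup>2 * (norm (R x))\<^sup>2 + 2 * D\<^sup>2 * (real (Suc n) * S x)"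
      unfolding power_mult_distrib mult.assoc using s by (intro add_mono mult_left_mono) auto
    finally have r: "(norm (R (R x)))\<^sup>2 \<le> \<dots>" .
    have s2: "(\<Sum>j\<le>2. (norm (obs j x))\<^sup>2) \<le> S x" unfolding S_def by (rule sum_mono2) auto
    have "C * ((\<Sum>j\<le>2. (norm (obs j x))\<^sup>2) + (norm (R (R x)))\<^sup>2) \<le> A * ((\<Sum>j\<le>2. (norm (obs j x))\<^sup>2) + (norm (R (R x)))\<^sup>2)"
      using A by (intro mult_right_mono add_nonneg_nonneg sum_nonneg) auto
    also have "\<dots> \<le> A * (S x + (2 * \<delta>\<^sup>2 * (norm (R x))\<^sup>2 + 2 * D\<^sup>2 * (real (Suc n) * S x)))"
      using A r s2 by (intro mult_left_mono add_mono) auto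
    also have "\<dots> = \<epsilon> / 2 * (norm (R x))\<^sup>2 + P * S x"
      using A by (simp add: \<delta>(2) P_def field_simps)
    finally show ?thesis using key[of x] by (simp add: algebra_simps)
  qed
  obtain W C' where W: "bounded_bilinear W"
    "\<And>x. S x \<le> W x (R x) + W (R x) x + \<epsilon> / (4 * P) * (norm (R x))\<^sup>2 + C' * (norm (obs 0 x))\<^sup>2"
    using obs_sum_dissipation[of "\<epsilon> / (4 * P)" "n + 2"] P \<open>\<epsilon> > 0\<close> unfolding S_def by auto
  define W' where "W' = (\<lambda>x y. V x y + (- P) * W x y)"
  have "bounded_bilinear W'"
    unfolding W'_def
    by (intro bounded_bilinear_add V bounded_bilinear_cmult W(1))
  moreover have "W' x (R x) + W' (R x) x \<le> - (\<epsilon> / 4) * (norm (R x))\<^sup>2 + P * C' * (norm (Bs x))\<^sup>2" for x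
  proof -
    have "P * S x \<le> P * (W x (R x) + W (R x) x + \<epsilon> / (4 * P) * (norm (R x))\<^sup>2 + C' * (norm (obs 0 x))\<^sup>2)"
      using W(2)[of x] P by (intro mult_left_mono) auto
    also have "\<dots> = P * (W x (R x) + W (R x) x) + \<epsilon> / 4 * (norm (R x))\<^sup>2 + P * C' * (norm (Bs x))\<^sup>2"
      using P by (simp add: algebra_simps obs_def)
    finally show ?thesis using V1[of x] by (simp add: W'_def algebra_simps)
  qed
  ultimately show ?thesis using \<open>\<epsilon> > 0\<close> by (intro exI[of _ W'] exI[of _ "\<epsilon> / 4"] exI[of _ "P * C'"]) auto
qed

end

section \<open>Mild solutions\<close>

text \<open>A mean value inequality for right derivatives, which are what a semigroup supplies. With
  a slope K slightly above k, the last time at which the bound with slope K holds cannot precede t: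
  the right derivative there extends the bound a little further.\<close>

lemma right_derivative_norm_bound:
  fixes z :: "real \<Rightarrow> 'a::real_normed_vector"
  assumes "s \<le> t" and cont: "continuous_on {s..t} z"
    and deriv: "\<And>\<tau>. s \<le> \<tau> \<Longrightarrow> \<tau> < t \<Longrightarrow>
      \<exists>v. ((\<lambda>h. (z (\<tau> + h) - z \<tau>) /\<^sub>R h) \<longlongrightarrow> v) (at_right 0) \<and> norm v \<le> k"
  shows "norm (z t - z s) \<le> k * (t - s)"
proof (rule field_le_epsilon)
  fix e :: real assume "e > 0"
  \<comment> \<open>Over an interval of length t - s the excess over k contributes less than e; the
    1 avoids division by zero.\<close>
  define K where "K = k + e / (t - s + 1)"
  have K: "K > k" using \<open>e > 0\<close> \<open>s \<le> t\<close> by (simp add: K_def)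
  define g where "g = (\<lambda>\<tau>. norm (z \<tau> - z s) - K * (\<tau> - s))"
  have "g t \<le> 0"
  proof (rule ccontr)
    assume gt: "\<not> g t \<le> 0"
    define S where "S = {s..t} \<inter> g -` {..0}"
    have gc: "continuous_on {s..t} g"
      unfolding g_def using cont by (intro continuous_intros)
    have "closed S"
      unfolding S_def by (intro continuous_closed_preimage gc) auto
    then have "compact S"
      by (auto simp: S_def compact_eq_bounded_closed intro: bounded_subset[of "{s..t}"])
    moreover have "s \<in> S" using \<open>s \<le> t\<close> by (simp add: S_def g_def)
    ultimately obtain m where m: "m \<in> S" "\<And>\<tau>. \<tau> \<in> S \<Longrightarrow> \<tau> \<le> m"
      using compact_attains_sup[of S] by blast
    then have mt: "s \<le> m" "m < t" and gm: "g m \<le> 0"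
      using gt by (auto simp: S_def order_less_le)
    obtain v where v: "((\<lambda>h. (z (m + h) - z m) /\<^sub>R h) \<longlongrightarrow> v) (at_right 0)" "norm v \<le> k"
      using deriv[OF mt] by auto
    have "((\<lambda>h. norm ((z (m + h) - z m) /\<^sub>R h)) \<longlongrightarrow> norm v) (at_right 0)"
      using v(1) by (rule tendsto_norm)
    then have "\<forall>\<^sub>F h in at_right 0. norm ((z (m + h) - z m) /\<^sub>R h) < K"
      by (rule order_tendstoD(2)) (use v(2) K in simp)
    moreover have "\<forall>\<^sub>F h in at_right 0. 0 < h \<and> h < t - m"
      using mt by (auto simp: eventually_at_right[of 0 1] intro!: exI[of _ "t - m"])
    ultimately have "\<forall>\<^sub>F h in at_right 0. norm ((z (m + h) - z m) /\<^sub>R h) < K \<and> 0 < h \<and> h < t - m"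
      by eventually_elim auto
    then obtain h where h: "norm ((z (m + h) - z m) /\<^sub>R h) < K" "0 < h" "h < t - m"
      using eventually_happens'[OF trivial_limit_at_right_real] by blast
    have "norm (z (m + h) - z m) \<le> K * h"
    proof -
      have "norm ((z (m + h) - z m) /\<^sub>R h) = norm (z (m + h) - z m) / h"
        using h(2) unfolding norm_scaleR by (simp add: field_simps)
      with h(1) have "norm (z (m + h) - z m) / h < K" by simp
      then show ?thesis using h(2) by (simp add: pos_divide_less_eq)
    qed
    moreover have "norm (z (m + h) - z s) \<le> norm (z (m + h) - z m) + norm (z m - z s)"
      using norm_triangle_ineq[of "z (m + h) - z m" "z m - z s"] by simp
    ultimately have "g (m + h) \<le> g m" by (simp add: g_def algebra_simps)
    then have "m + h \<in> S" using gm mt h by (simp add: S_def)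
    with m(2) h(2) show False by force
  qed
  then have "norm (z t - z s) \<le> k * (t - s) + e * ((t - s) / (t - s + 1))"
    by (simp add: g_def K_def algebra_simps)
  also have "e * ((t - s) / (t - s + 1)) \<le> e * 1"
    using \<open>e > 0\<close> \<open>s \<le> t\<close> by (intro mult_left_mono) auto
  finally show "norm (z t - z s) \<le> k * (t - s) + e" by simp
qed

text \<open>The function z s - s f(t) has right derivative f s - f t, which is small near t; the
  mean value inequality on either side of t then gives the full derivative.\<close>

lemma has_vector_derivative_right_derivative:
  fixes z f :: "real \<Rightarrow> 'a::real_normed_vector"
  assumes z: "continuous_on {0..} z" and f: "continuous_on {0..} f"
    and deriv: "\<And>t. t \<ge> 0 \<Longrightarrow> ((\<lambda>h. (z (t + h) - z t) /\<^sub>R h) \<longlongrightarrow> f t) (at_right 0)"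
    and "t \<ge> 0"
  shows "(z has_vector_derivative f t) (at t within {0..})"
  unfolding has_vector_derivative_def has_derivative_within_alt
proof (intro conjI allI impI)
  show "bounded_linear (\<lambda>h. h *\<^sub>R f t)" by (rule bounded_linear_scaleR_left)
  fix e :: real assume "e > 0"
  then obtain d where d: "d > 0" "\<And>s. s \<ge> 0 \<Longrightarrow> dist s t < d \<Longrightarrow> dist (f s) (f t) < e"
    using f \<open>t \<ge> 0\<close> unfolding continuous_on_iff by (metis atLeast_iff)
  define w where "w = (\<lambda>s. z s - s *\<^sub>R f t)"
  have *: "norm (w b - w a) \<le> e * (b - a)" if ab: "0 \<le> a" "a \<le> b" "\<And>\<tau>. a \<le> \<tau> \<Longrightarrow> \<tau> < b \<Longrightarrow> dist \<tau> t < d" for a b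
  proof (rule right_derivative_norm_bound[OF ab(2)])
    show "continuous_on {a..b} w"
      unfolding w_def using ab(1) by (intro continuous_intros continuous_on_subset[OF z]) auto
    fix \<tau> assume \<tau>: "a \<le> \<tau>" "\<tau> < b"
    have "((\<lambda>h. (z (\<tau> + h) - z \<tau>) /\<^sub>R h - f t) \<longlongrightarrow> f \<tau> - f t) (at_right 0)"
      using deriv[of \<tau>] \<tau> ab(1) by (intro tendsto_intros) auto
    moreover have "\<forall>\<^sub>F h in at_right 0. (z (\<tau> + h) - z \<tau>) /\<^sub>R h - f t = (w (\<tau> + h) - w \<tau>) /\<^sub>R h"
      unfolding eventually_at_filter by (simp add: w_def algebra_simps)
    ultimately have "((\<lambda>h. (w (\<tau> + h) - w \<tau>) /\<^sub>R h) \<longlongrightarrow> f \<tau> - f t) (at_right 0)"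
      using tendsto_cong by force
    moreover have "norm (f \<tau> - f t) \<le> e"
      using d(2)[of \<tau>] ab \<tau> by (simp add: dist_norm less_imp_le)
    ultimately show "\<exists>v. ((\<lambda>h. (w (\<tau> + h) - w \<tau>) /\<^sub>R h) \<longlongrightarrow> v) (at_right 0) \<and> norm v \<le> e" by blast
  qed
  show "\<exists>d>0. \<forall>y\<in>{0..}. norm (y - t) < d \<longrightarrow> norm (z y - z t - (y - t) *\<^sub>R f t) \<le> e * norm (y - t)"
  proof (intro exI[of _ d] conjI ballI impI d(1))
    fix y :: real assume y: "y \<in> {0..}" "norm (y - t) < d"
    have eq: "norm (w y - w t) = norm (z y - z t - (y - t) *\<^sub>R f t)"
      by (simp add: w_def algebra_simps)
    show "norm (z y - z t - (y - t) *\<^sub>R f t) \<le> e * norm (y - t)"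
    proof (cases "t \<le> y")
      case True
      then show ?thesis using *[of t y] y \<open>t \<ge> 0\<close> unfolding eq[symmetric] by (auto simp: dist_real_def)
    next
      case False
      then show ?thesis using *[of y t] y \<open>t \<ge> 0\<close> unfolding eq[symmetric] norm_minus_commute[of "w y"]
        by (auto simp: dist_real_def)
    qed
  qed
qed

text \<open>The difference quotient of R x splits into (T h (R x) - R x) / h, which tends to x by
  \<open>gen\<close>, and (R x(t+h) - T h (R x(t))) / h, which is minus the mean of T (t + h - s) (R
  (B (b s))) over [t, t + h]. As completeness is not assumed, this mean is not formed as a vector:
  the integrals are paired with a fixed vector before they are restricted to a subinterval.\<close>

lemma mild_semigroup_derivative:
  fixes T :: "real \<Rightarrow> 'a::real_inner \<Rightarrow> 'a" and R :: "'a \<Rightarrow> 'a" and b :: "real \<Rightarrow> 'b::euclidean_space"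
    and B :: "'b \<Rightarrow> 'a"
  assumes T: "\<And>t. t \<ge> 0 \<Longrightarrow> bounded_linear (T t)"
    and T0: "\<And>x. T 0 x = x"
    and T_add: "\<And>s t x. s \<ge> 0 \<Longrightarrow> t \<ge> 0 \<Longrightarrow> T (s + t) x = T s (T t x)"
    and T_cont: "\<And>x. ((\<lambda>t. T t x) \<longlongrightarrow> x) (at_right 0)"
    and R: "bounded_linear R" and B: "bounded_linear B"
    and RT: "\<And>t x. t \<ge> 0 \<Longrightarrow> R (T t x) = T t (R x)"
    and gen: "\<And>x. ((\<lambda>h. (T h (R x) - R x) /\<^sub>R h) \<longlongrightarrow> x) (at_right 0)"
    and x: "continuous_on {0..} x" and b: "continuous_on {0..} b"
    and mild: "\<And>t. t \<ge> 0 \<Longrightarrow> \<exists>I. ((\<lambda>s. T (t - s) (B (b s))) has_integral I) {0..t} \<and> x t = T t (x 0) - I"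
    and "t \<ge> 0"
  shows "((\<lambda>t. R (x t)) has_vector_derivative x t - R (B (b t))) (at t within {0..})"
proof (rule has_vector_derivative_right_derivative[OF _ _ _ \<open>t \<ge> 0\<close>])
  interpret R: bounded_linear R by (rule R)
  interpret B: bounded_linear B by (rule B)
  interpret RB: bounded_linear "\<lambda>d. R (B d)" by (rule bounded_linear_compose[OF R B])
  show "continuous_on {0..} (\<lambda>t. R (x t))" using x by (rule R.continuous_on)
  show "continuous_on {0..} (\<lambda>t. x t - R (B (b t)))"
    using x RB.continuous_on[OF b] by (intro continuous_intros)
  fix t :: real assume t: "t \<ge> 0"
  define y where "y = (\<lambda>t. R (x t))"
  have key: "((\<lambda>h. (y (t + h) - T h (y t)) /\<^sub>R h) \<longlongrightarrow> - R (B (b t))) (at_right 0)"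
  proof (rule tendstoI)
    fix e :: real assume "e > 0"
    obtain Kb where Kb: "\<And>s. s \<in> {t..t+1} \<Longrightarrow> norm (b s) \<le> Kb" "Kb > 0"
    proof -
      have "compact (b ` {t..t+1})"
        using t by (intro compact_continuous_image continuous_on_subset[OF b]) auto
      from compact_imp_bounded[OF this] show thesis
        using that unfolding bounded_pos by (metis imageI)
    qed
    \<comment> \<open>\<open>b\<close> has values in a finite-dimensional space, so strong
      continuity is needed only at the finitely many vectors \<open>R (B i)\<close>, and no bound on
      \<open>T\<close> that is uniform in time enters.\<close>
    define F where "F = (\<lambda>r. \<Sum>i\<in>Basis. norm (T r (R (B i)) - R (B i)))"
    have "(F \<longlongrightarrow> (\<Sum>i\<in>(Basis::'b set). norm (R (B i) - R (B i)))) (at_right 0)"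
      unfolding F_def by (intro tendsto_intros T_cont)
    then have "(F \<longlongrightarrow> 0) (at_right 0)" by simp
    then have "\<forall>\<^sub>F r in at_right 0. F r < e / 4 / Kb"
      using \<open>e > 0\<close> Kb(2) by (intro order_tendstoD(2)) auto
    then obtain d1 where d1: "d1 > 0" "\<And>r. 0 < r \<Longrightarrow> r < d1 \<Longrightarrow> F r < e / 4 / Kb"
      unfolding eventually_at_right[OF zero_less_one] by auto
    have "F 0 = 0" by (simp add: F_def T0)
    then have d1': "F r \<le> e / 4 / Kb" if "0 \<le> r" "r < d1" for r
      using d1(2)[of r] that \<open>e > 0\<close> Kb(2) by (cases "r = 0") auto
    have "continuous_on {0..} (\<lambda>s. R (B (b s)))" using RB.continuous_on[OF b] .
    then obtain d2 where d2: "d2 > 0" "\<And>s. s \<ge> 0 \<Longrightarrow> dist s t < d2 \<Longrightarrow> dist (R (B (b s))) (R (B (b t))) < e / 4"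
      using t \<open>e > 0\<close> unfolding continuous_on_iff by (metis atLeast_iff divide_pos_pos zero_less_numeral)
    define d where "d = min 1 (min d1 d2)"
    have near: "norm (T r (R (B (b s))) - R (B (b t))) \<le> e / 2"
      if "0 \<le> r" "r < d" "t \<le> s" "s < t + d" for r s
    proof -
      interpret Tr: bounded_linear "T r" using T that(1) .
      have "T r (R (B (b s))) - R (B (b s)) = (\<Sum>i\<in>Basis. (b s \<bullet> i) *\<^sub>R (T r (R (B i)) - R (B i)))"
      proof -
        have "b s = (\<Sum>i\<in>Basis. (b s \<bullet> i) *\<^sub>R i)" by (simp add: euclidean_representation)
        then have "T r (R (B (b s))) - R (B (b s)) = T r (R (B (\<Sum>i\<in>Basis. (b s \<bullet> i) *\<^sub>R i))) - R (B (\<Sum>i\<in>Basis. (b s \<bullet> i) *\<^sub>R i))"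
          by simp
        then show ?thesis
          by (simp only: RB.sum Tr.sum RB.scaleR Tr.scaleR sum_subtractf scaleR_diff_right)
      qed
      also have "norm \<dots> \<le> (\<Sum>i\<in>Basis. Kb * norm (T r (R (B i)) - R (B i)))"
      proof (rule order.trans[OF norm_sum sum_mono])
        fix i :: 'b assume i: "i \<in> Basis"
        have "\<bar>b s \<bullet> i\<bar> \<le> norm (b s)" using i by (rule Basis_le_norm)
        also have "\<dots> \<le> Kb" using Kb(1)[of s] that by (simp add: d_def)
        finally show "norm ((b s \<bullet> i) *\<^sub>R (T r (R (B i)) - R (B i))) \<le> Kb * norm (T r (R (B i)) - R (B i))"
          by (simp add: mult_right_mono)
      qed
      also have "\<dots> = Kb * F r" by (simp add: F_def sum_distrib_left)
      also have "\<dots> \<le> e / 4" using d1'[of r] that Kb(2) by (simp add: d_def field_simps)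
      finally have "norm (T r (R (B (b s))) - R (B (b s))) \<le> e / 4" .
      moreover have "norm (R (B (b s)) - R (B (b t))) \<le> e / 4"
        using d2(2)[of s] that t by (simp add: d_def dist_norm less_imp_le)
      ultimately show ?thesis
        using norm_triangle_ineq[of "T r (R (B (b s))) - R (B (b s))" "R (B (b s)) - R (B (b t))"] by simp
    qed
    have "dist ((y (t + h) - T h (y t)) /\<^sub>R h) (- R (B (b t))) < e" if h: "0 < h" "h < d" for h
    proof -
      interpret Th: bounded_linear "T h" using T h(1) by simp
      obtain I1 where I1: "((\<lambda>s. T (t - s) (B (b s))) has_integral I1) {0..t}" "x t = T t (x 0) - I1"
        using mild[OF t] by auto
      obtain I2 where I2: "((\<lambda>s. T (t + h - s) (B (b s))) has_integral I2) {0..t+h}" "x (t + h) = T (t + h) (x 0) - I2"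
        using mild[of "t + h"] t h by auto
      define D where "D = R I2 - T h (R I1)"
      have D: "y (t + h) - T h (y t) = - D"
      proof -
        have "x (t + h) = T h (T t (x 0)) - I2"
          using I2(2) T_add[of h t "x 0"] t h by (simp add: add.commute)
        then show ?thesis
          using h RT[of h I1] RT[of h "T t (x 0)"] by (simp add: y_def I1(2) D_def R.diff Th.diff)
      qed
      \<comment> \<open>The test vector is the error itself: pairing with it yields |\<nu>|^2 on the
        left and a multiple of |\<nu>| on the right.\<close>
      define \<nu> where "\<nu> = D - h *\<^sub>R R (B (b t))"
      define g where "g = (\<lambda>s. T (t + h - s) (R (B (b s))) \<bullet> \<nu>)"
      have "((\<lambda>s. R (T (t + h - s) (B (b s))) \<bullet> \<nu>) has_integral R I2 \<bullet> \<nu>) {0..t+h}"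
        using has_integral_linear[OF I2(1) bounded_linear_compose[OF bounded_linear_inner_left R]]
        by (simp add: o_def)
      then have g2: "(g has_integral R I2 \<bullet> \<nu>) {0..t+h}"
        by (rule has_integral_eq[rotated]) (simp add: g_def RT)
      have "((\<lambda>s. T h (R (T (t - s) (B (b s)))) \<bullet> \<nu>) has_integral T h (R I1) \<bullet> \<nu>) {0..t}"
        using has_integral_linear[OF I1(1) bounded_linear_compose[OF bounded_linear_inner_left
          bounded_linear_compose[OF Th.bounded_linear R]]]
        by (simp add: o_def)
      then have g1: "(g has_integral T h (R I1) \<bullet> \<nu>) {0..t}"
      proof (rule has_integral_eq[rotated])
        fix s assume s: "s \<in> {0..t}"
        have "T (t + h - s) z = T h (T (t - s) z)" for z
          using T_add[of h "t - s" z] s h by (simp add: algebra_simps)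
        then show "T h (R (T (t - s) (B (b s)))) \<bullet> \<nu> = g s"
          using s by (simp add: g_def RT)
      qed
      have gi: "g integrable_on {t..t+h}"
      proof (rule integrable_on_subinterval)
        show "g integrable_on {0..t+h}" using g2 by (rule has_integral_integrable)
      qed (use t h in auto)
      have "integral {0..t} g + integral {t..t+h} g = integral {0..t+h} g"
        using t h g2 by (intro Henstock_Kurzweil_Integration.integral_combine) auto
      then have "integral {t..t+h} g = D \<bullet> \<nu>"
        using g1 g2 by (simp add: integral_unique D_def inner_diff_left)
      then have gt: "(g has_integral D \<bullet> \<nu>) {t..t+h}"
        using gi by (simp add: has_integral_integral)
      have "((\<lambda>s. g s - R (B (b t)) \<bullet> \<nu>) has_integral (D \<bullet> \<nu> - h * (R (B (b t)) \<bullet> \<nu>))) {t..t+h}"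
        using has_integral_diff[OF gt has_integral_const_real[of "R (B (b t)) \<bullet> \<nu>" t "t+h"]] h by simp
      moreover have "norm (g s - R (B (b t)) \<bullet> \<nu>) \<le> e / 2 * norm \<nu>" if s: "s \<in> {t..t+h}" for s
      proof -
        have "norm (g s - R (B (b t)) \<bullet> \<nu>) = norm ((T (t + h - s) (R (B (b s))) - R (B (b t))) \<bullet> \<nu>)"
          by (simp add: g_def inner_diff_left)
        also have "\<dots> \<le> norm (T (t + h - s) (R (B (b s))) - R (B (b t))) * norm \<nu>"
          by (metis Cauchy_Schwarz_ineq2 real_norm_def)
        also have "\<dots> \<le> e / 2 * norm \<nu>"
          using s h by (intro mult_right_mono near) auto
        finally show ?thesis .
      qed
      ultimately have "norm (D \<bullet> \<nu> - h * (R (B (b t)) \<bullet> \<nu>)) \<le> e / 2 * norm \<nu> * h"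
        using has_integral_bound[of "e / 2 * norm \<nu>" "\<lambda>s. g s - R (B (b t)) \<bullet> \<nu>" _ t "t + h"] h \<open>e > 0\<close>
        by (simp add: content_real)
      moreover have "D \<bullet> \<nu> - h * (R (B (b t)) \<bullet> \<nu>) = norm \<nu> * norm \<nu>"
        by (simp add: \<nu>_def norm_eq_square algebra_simps inner_diff_left inner_diff_right
            power2_norm_eq_inner[unfolded power2_eq_square])
      ultimately have "norm \<nu> * norm \<nu> \<le> (e / 2 * h) * norm \<nu>" using h by (simp add: algebra_simps)
      then have nn: "norm \<nu> \<le> e / 2 * h"
        using \<open>e > 0\<close> h by (cases "\<nu> = 0") auto
      have "dist ((y (t + h) - T h (y t)) /\<^sub>R h) (- R (B (b t))) = norm (- \<nu> /\<^sub>R h)"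
        using h unfolding D dist_norm \<nu>_def by (simp add: scaleR_diff_right norm_minus_commute)
      also have "\<dots> = norm \<nu> / h" using h by (simp add: divide_inverse)
      also have "\<dots> \<le> e / 2" using nn h by (simp add: field_simps)
      also have "\<dots> < e" using \<open>e > 0\<close> by simp
      finally show ?thesis .
    qed
    moreover have "d > 0" using d1(1) d2(1) by (simp add: d_def)
    ultimately show "\<forall>\<^sub>F h in at_right 0. dist ((y (t + h) - T h (y t)) /\<^sub>R h) (- R (B (b t))) < e"
      unfolding eventually_at_right[OF zero_less_one] by auto
  qed
  have "((\<lambda>h. (y (t + h) - T h (y t)) /\<^sub>R h + (T h (y t) - y t) /\<^sub>R h) \<longlongrightarrow> - R (B (b t)) + x t) (at_right 0)"
    using key gen[of "x t"] unfolding y_def by (intro tendsto_add) auto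
  moreover have "(\<lambda>h. (y (t + h) - T h (y t)) /\<^sub>R h + (T h (y t) - y t) /\<^sub>R h) = (\<lambda>h. (R (x (t + h)) - R (x t)) /\<^sub>R h)"
    by (rule ext) (simp add: y_def flip: scaleR_add_right)
  ultimately show "((\<lambda>h. (R (x (t + h)) - R (x t)) /\<^sub>R h) \<longlongrightarrow> x t - R (B (b t))) (at_right 0)"
    by simp
qed

section \<open>Energy decay of the feedback loop\<close>

lemma has_vector_derivative_shift_atLeast:
  fixes G :: "real \<Rightarrow> 'a::real_normed_vector"
  assumes G: "\<And>t. t \<ge> 0 \<Longrightarrow> (G has_vector_derivative g t) (at t within {0..})"
    and "t \<ge> 0" "h \<ge> 0"
  shows "((\<lambda>s. G (s + h)) has_vector_derivative g (t + h)) (at t within {0..})"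
proof -
  have "(G has_vector_derivative g (t + h)) (at (t + h) within (\<lambda>s. s + h) ` {0..})"
    using G[of "t + h"] assms(2,3) by (rule_tac has_vector_derivative_within_subset) auto
  moreover have "((\<lambda>s. s + h) has_vector_derivative 1) (at t within {0..})"
    by (auto intro!: derivative_eq_intros simp: has_vector_derivative_def)
  ultimately show ?thesis
    using vector_diff_chain_within[of "\<lambda>s. s + h" 1 t "{0..}" G "g (t + h)"] by (simp add: o_def)
qed

lemma has_vector_derivative_right_quotient:
  fixes z :: "real \<Rightarrow> 'a::real_normed_vector"
  assumes "(z has_vector_derivative v) (at t within {0..})" "t \<ge> 0"
  shows "((\<lambda>h. (z (t + h) - z t) /\<^sub>R h) \<longlongrightarrow> v) (at_right 0)"
proof -
  have "((\<lambda>y. (z y - z t) /\<^sub>R (y - t)) \<longlongrightarrow> v) (at t within {0..})"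
  proof -
    have "((\<lambda>y. (z y - z t - (y - t) *\<^sub>R v) /\<^sub>R norm (y - t)) \<longlongrightarrow> 0) (at t within {0..})"
      using assms(1) unfolding has_vector_derivative_def has_derivative_at_within by simp
    then have "((\<lambda>y. norm ((z y - z t - (y - t) *\<^sub>R v) /\<^sub>R norm (y - t))) \<longlongrightarrow> 0) (at t within {0..})"
      by (rule tendsto_norm_zero)
    moreover have "\<forall>\<^sub>F y in at t within {0..}. norm ((z y - z t - (y - t) *\<^sub>R v) /\<^sub>R norm (y - t)) = norm ((z y - z t) /\<^sub>R (y - t) - v)"
      unfolding eventually_at_filter
    proof (intro always_eventually allI impI)
      fix y assume "y \<noteq> t"
      then have "(z y - z t) /\<^sub>R (y - t) - v = (z y - z t - (y - t) *\<^sub>R v) /\<^sub>R (y - t)"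
        by (simp add: scaleR_diff_right)
      then show "norm ((z y - z t - (y - t) *\<^sub>R v) /\<^sub>R norm (y - t)) = norm ((z y - z t) /\<^sub>R (y - t) - v)"
        by simp
    qed
    ultimately have "((\<lambda>y. norm ((z y - z t) /\<^sub>R (y - t) - v)) \<longlongrightarrow> 0) (at t within {0..})"
      by (simp add: tendsto_cong)
    then show ?thesis by (simp add: Lim_null[of _ v] tendsto_norm_zero_iff)
  qed
  then have "((\<lambda>y. (z y - z t) /\<^sub>R (y - t)) \<longlongrightarrow> v) (at_right t)"
    by (rule tendsto_within_subset) (use assms(2) in auto)
  then show ?thesis
    unfolding at_right_to_0[of t] filterlim_filtermap by (simp add: add.commute)
qed

lemma vector_derivative_norm_bound:
  fixes z f :: "real \<Rightarrow> 'a::real_normed_vector"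
  assumes z: "\<And>t. t \<ge> 0 \<Longrightarrow> (z has_vector_derivative f t) (at t within {0..})"
    and "0 \<le> s" "s \<le> t" and "\<And>\<tau>. s \<le> \<tau> \<Longrightarrow> \<tau> < t \<Longrightarrow> norm (f \<tau>) \<le> k"
  shows "norm (z t - z s) \<le> k * (t - s)"
proof (rule right_derivative_norm_bound[OF \<open>s \<le> t\<close>])
  have "continuous_on {0..} z"
    using z by (auto simp: continuous_on_eq_continuous_within intro: has_vector_derivative_continuous)
  then show "continuous_on {s..t} z" by (rule continuous_on_subset) (use \<open>0 \<le> s\<close> in auto)
  show "\<exists>v. ((\<lambda>h. (z (\<tau> + h) - z \<tau>) /\<^sub>R h) \<longlongrightarrow> v) (at_right 0) \<and> norm v \<le> k" if "s \<le> \<tau>" "\<tau> < t" for \<tau>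
    using has_vector_derivative_right_quotient[OF z[of \<tau>]] assms that by (intro exI[of _ "f \<tau>"]) auto
qed

lemma indefinite_integral_derivative:
  fixes f :: "real \<Rightarrow> 'a::banach"
  assumes f: "continuous_on {0..} f" and "t \<ge> 0"
  shows "((\<lambda>t. integral {0..t} f) has_vector_derivative f t) (at t within {0..})"
proof -
  have "((\<lambda>u. integral {0..u} f) has_vector_derivative f t) (at t within {0..t+1})"
    by (rule integral_has_vector_derivative[OF continuous_on_subset[OF f]]) (use \<open>t \<ge> 0\<close> in auto)
  moreover have "at t within {0..t+1} = at t within {0..}"
    by (rule at_within_nhd[of t "{..<t+1}"]) auto
  ultimately show ?thesis by simp
qed

locale closed_loop = skew_system e R Bs
  for e :: "'a::real_normed_vector \<Rightarrow> 'a \<Rightarrow> real" and R :: "'a \<Rightarrow> 'a" and Bs :: "'a \<Rightarrow> 'b::euclidean_space" +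
  fixes B :: "'b \<Rightarrow> 'a"
  assumes B: "bounded_linear B"
begin

sublocale B: bounded_linear B by (rule B)

text \<open>As \<open>R\<close> is the inverse of the generator \<open>A\<close>, this is \<open>x' = A x - B d\<close> after one integration in time; it
  makes sense for mild solutions.\<close>

definition solves :: "(real \<Rightarrow> 'a) \<Rightarrow> (real \<Rightarrow> 'b) \<Rightarrow> bool" where
  "solves x d \<longleftrightarrow> continuous_on {0..} x \<and> continuous_on {0..} d \<and>
     (\<forall>t\<ge>0. ((\<lambda>t. R (x t)) has_vector_derivative x t - R (B (d t))) (at t within {0..}))"

text \<open>\<open>X t\<close> is the mean of \<open>x\<close> over \<open>[t, t + h]\<close>, a vector-valued integral that exists because it can be
  written in terms of \<open>R x\<close>, although completeness of the state space is not assumed. It lies in the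
  range of \<open>R\<close>, and \<open>\<Xi> t\<close> is the generator applied to \<open>X t\<close>.\<close>

lemma solves_average:
  assumes "solves x d" "h > 0"
  obtains X \<Xi> dh where "\<And>t. X t = R (\<Xi> t)"
    "\<And>t. t \<ge> 0 \<Longrightarrow> (X has_vector_derivative \<Xi> t - B (dh t)) (at t within {0..})"
    "\<And>t. \<Xi> t = (x (t + h) - x t) /\<^sub>R h + B (dh t)"
    "continuous_on {0..} dh"
    "\<And>t k w. t \<ge> 0 \<Longrightarrow> (\<And>s. t \<le> s \<Longrightarrow> s \<le> t + h \<Longrightarrow> norm (x s - w) \<le> k) \<Longrightarrow> norm (X t - w) \<le> k"
    "\<And>t k w. t \<ge> 0 \<Longrightarrow> (\<And>s. t \<le> s \<Longrightarrow> s \<le> t + h \<Longrightarrow> norm (d s - w) \<le> k) \<Longrightarrow> norm (dh t - w) \<le> k"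
proof -
  define D where "D = (\<lambda>t. integral {0..t} d)"
  \<comment> \<open>The second term cancels the forcing, so that G' = x and difference quotients of
    G are means of x.\<close>
  define G where "G = (\<lambda>t. R (x t) + R (B (D t)))"
  have xc: "continuous_on {0..} x" and dc: "continuous_on {0..} d"
    and y: "\<And>t. t \<ge> 0 \<Longrightarrow> ((\<lambda>t. R (x t)) has_vector_derivative x t - R (B (d t))) (at t within {0..})"
    using assms(1) by (auto simp: solves_def)
  have D: "(D has_vector_derivative d t) (at t within {0..})" if "t \<ge> 0" for t
    unfolding D_def by (rule indefinite_integral_derivative[OF dc that])
  have G: "(G has_vector_derivative x t) (at t within {0..})" if "t \<ge> 0" for t
  proof -
    have "((\<lambda>t. R (B (D t))) has_vector_derivative R (B (d t))) (at t within {0..})"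
      by (intro bounded_linear.has_vector_derivative[OF R] bounded_linear.has_vector_derivative[OF B] D that)
    from has_vector_derivative_add[OF y[OF that] this] show ?thesis by (simp add: G_def)
  qed
  define X where "X = (\<lambda>t. (G (t + h) - G t) /\<^sub>R h)"
  define dh where "dh = (\<lambda>t. (D (t + h) - D t) /\<^sub>R h)"
  define \<Xi> where "\<Xi> = (\<lambda>t. (x (t + h) - x t) /\<^sub>R h + B (dh t))"
  \<comment> \<open>Means stay in every closed ball that contains the values. The type is generic
    because this is applied to both G and D.\<close>
  have avg: "norm ((H (t + h) - H t) /\<^sub>R h - w) \<le> k"
    if H: "\<And>t. t \<ge> 0 \<Longrightarrow> (H has_vector_derivative f t) (at t within {0..})"
      and "t \<ge> 0" and k: "\<And>s. t \<le> s \<Longrightarrow> s \<le> t + h \<Longrightarrow> norm (f s - w) \<le> k"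
    for H f :: "real \<Rightarrow> 'c::real_normed_vector" and t k w
  proof -
    have "((\<lambda>s. H s - s *\<^sub>R w) has_vector_derivative f s - w) (at s within {0..})" if "s \<ge> 0" for s
      by (intro has_vector_derivative_diff H that) (auto intro!: derivative_eq_intros simp: has_vector_derivative_def)
    from vector_derivative_norm_bound[OF this, of t "t + h" k]
    have "norm (H (t + h) - (t + h) *\<^sub>R w - (H t - t *\<^sub>R w)) \<le> k * h"
      using that \<open>h > 0\<close> by auto
    moreover have "H (t + h) - (t + h) *\<^sub>R w - (H t - t *\<^sub>R w) = h *\<^sub>R ((H (t + h) - H t) /\<^sub>R h - w)"
      using \<open>h > 0\<close> by (simp add: scaleR_diff_right scaleR_left_distrib)
    ultimately have "h * norm ((H (t + h) - H t) /\<^sub>R h - w) \<le> k * h"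
      using \<open>h > 0\<close> by simp
    then show ?thesis using \<open>h > 0\<close> by (simp add: mult.commute)
  qed
  show thesis
  proof (rule that[of X \<Xi> dh])
    show "X t = R (\<Xi> t)" for t
      by (simp add: X_def \<Xi>_def dh_def G_def R.add R.diff R.scaleR B.diff B.scaleR scaleR_add_right scaleR_diff_right)
    show "\<Xi> t = (x (t + h) - x t) /\<^sub>R h + B (dh t)" for t by (simp add: \<Xi>_def)
    show "(X has_vector_derivative \<Xi> t - B (dh t)) (at t within {0..})" if "t \<ge> 0" for t
    proof -
      have "((\<lambda>s. G (s + h) - G s) has_vector_derivative x (t + h) - x t) (at t within {0..})"
        using that \<open>h > 0\<close> by (intro has_vector_derivative_diff has_vector_derivative_shift_atLeast G) auto
      from bounded_linear.has_vector_derivative[OF bounded_linear_scaleR_right[of "inverse h"] this]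
      show ?thesis by (simp add: X_def \<Xi>_def)
    qed
    have "continuous_on {0..} D"
      using D by (auto simp: continuous_on_eq_continuous_within intro: has_vector_derivative_continuous)
    moreover from this have "continuous_on {0..} (\<lambda>t. D (t + h))"
      by (rule continuous_on_compose2) (use \<open>h > 0\<close> in \<open>auto intro!: continuous_intros\<close>)
    ultimately show "continuous_on {0..} dh"
      unfolding dh_def by (intro continuous_intros)
    show "norm (X t - w) \<le> k" if "t \<ge> 0" "\<And>s. t \<le> s \<Longrightarrow> s \<le> t + h \<Longrightarrow> norm (x s - w) \<le> k" for t k w
      unfolding X_def by (rule avg[OF G that])
    show "norm (dh t - w) \<le> k" if "t \<ge> 0" "\<And>s. t \<le> s \<Longrightarrow> s \<le> t + h \<Longrightarrow> norm (d s - w) \<le> k" for t k w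
      unfolding dh_def by (rule avg[OF D that])
  qed
qed

text \<open>Formally e x x has derivative 2 e (A x) x - 2 e x (B d), and the first term vanishes by
  skewness. This is legitimate for the means of x over [t, t + h]; with h = 1/(n + 1) the limit is
  taken under the integral by dominated convergence.\<close>

lemma energy_identity:
  assumes s: "solves x d" and "t \<ge> 0"
  shows "e (x t) (x t) - e (x 0) (x 0) = - 2 * integral {0..t} (\<lambda>s. e (x s) (B (d s)))"
proof -
  have xc: "continuous_on {0..} x" and dc: "continuous_on {0..} d"
    using s by (auto simp: solves_def)
  define H where "H = (\<lambda>n. inverse (real (Suc n)))"
  have H: "0 < H n" "H n \<le> 1" for n by (auto simp: H_def field_simps)
  have "\<exists>X \<Xi> dh. (\<forall>t. X t = R (\<Xi> t)) \<and>
    (\<forall>t\<ge>0. (X has_vector_derivative \<Xi> t - B (dh t)) (at t within {0..})) \<and> continuous_on {0..} dh \<and>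
    (\<forall>t\<ge>0. \<forall>k w. (\<forall>s. t \<le> s \<longrightarrow> s \<le> t + H n \<longrightarrow> norm (x s - w) \<le> k) \<longrightarrow> norm (X t - w) \<le> k) \<and>
    (\<forall>t\<ge>0. \<forall>k w. (\<forall>s. t \<le> s \<longrightarrow> s \<le> t + H n \<longrightarrow> norm (d s - w) \<le> k) \<longrightarrow> norm (dh t - w) \<le> k)" for n
    by (rule solves_average[OF s H(1)[of n]]) metis
  then obtain X \<Xi> dh where X: "\<And>n t. X n t = R (\<Xi> n t)"
    "\<And>n t. t \<ge> 0 \<Longrightarrow> (X n has_vector_derivative \<Xi> n t - B (dh n t)) (at t within {0..})"
    "\<And>n. continuous_on {0..} (dh n)"
    "\<And>n t k w. t \<ge> 0 \<Longrightarrow> (\<And>s. t \<le> s \<Longrightarrow> s \<le> t + H n \<Longrightarrow> norm (x s - w) \<le> k) \<Longrightarrow> norm (X n t - w) \<le> k"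
    "\<And>n t k w. t \<ge> 0 \<Longrightarrow> (\<And>s. t \<le> s \<Longrightarrow> s \<le> t + H n \<Longrightarrow> norm (d s - w) \<le> k) \<Longrightarrow> norm (dh n t - w) \<le> k"
    by metis
  have lim: "(\<lambda>n. F n s) \<longlonglongrightarrow> f s"
    if F: "\<And>n t k w. t \<ge> 0 \<Longrightarrow> (\<And>s. t \<le> s \<Longrightarrow> s \<le> t + H n \<Longrightarrow> norm (f s - w) \<le> k) \<Longrightarrow> norm (F n t - w) \<le> k"
      and f: "continuous_on {0..} f" and "s \<ge> 0"
    for F :: "nat \<Rightarrow> real \<Rightarrow> 'c::real_normed_vector" and f s
  proof (rule LIMSEQ_I)
    fix r :: real assume "r > 0"
    then obtain \<delta> where \<delta>: "\<delta> > 0" "\<And>t. t \<ge> 0 \<Longrightarrow> dist t s < \<delta> \<Longrightarrow> dist (f t) (f s) < r / 2"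
      using f \<open>s \<ge> 0\<close> unfolding continuous_on_iff by (metis atLeast_iff half_gt_zero)
    obtain N where N: "H N < \<delta>" using reals_Archimedean[OF \<delta>(1)] by (auto simp: H_def)
    have "norm (F n s - f s) < r" if "n \<ge> N" for n
    proof -
      have "H n \<le> H N" using that by (simp add: H_def le_imp_inverse_le)
      then have "norm (F n s - f s) \<le> r / 2"
        using \<delta>(2) \<open>s \<ge> 0\<close> N by (intro F) (auto simp: dist_norm intro!: less_imp_le)
      then show ?thesis using \<open>r > 0\<close> by simp
    qed
    then show "\<exists>N. \<forall>n\<ge>N. norm (F n s - f s) < r" by blast
  qed
  have Xlim: "(\<lambda>n. X n s) \<longlonglongrightarrow> x s" and dlim: "(\<lambda>n. dh n s) \<longlonglongrightarrow> d s" if "s \<ge> 0" for s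
    using lim[of x X, OF X(4) xc that] lim[of d dh, OF X(5) dc that] by auto
  have bdd: "\<exists>K. \<forall>s\<in>{0..t+1}. norm (f s) \<le> K" if "continuous_on {0..} f" for f :: "real \<Rightarrow> 'c::real_normed_vector"
  proof -
    have "compact (f ` {0..t+1})" by (intro compact_continuous_image continuous_on_subset[OF that]) auto
    from compact_imp_bounded[OF this] show ?thesis unfolding bounded_iff by auto
  qed
  obtain Kx where Kx: "\<And>s. s \<in> {0..t+1} \<Longrightarrow> norm (x s) \<le> Kx" using bdd[OF xc] by blast
  obtain Kd where Kd: "\<And>s. s \<in> {0..t+1} \<Longrightarrow> norm (d s) \<le> Kd" using bdd[OF dc] by blast
  have XK: "norm (X n s) \<le> Kx" and dK: "norm (dh n s) \<le> Kd" if "s \<in> {0..t}" for n s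
    using X(4)[of s n 0 Kx] X(5)[of s n 0 Kd] Kx Kd that H(2)[of n] by auto
  obtain Ke where Ke: "Ke > 0" "\<And>x y. norm (e x y) \<le> norm x * norm y * Ke" using e.pos_bounded by auto
  obtain KB where KB: "KB > 0" "\<And>x. norm (B x) \<le> norm x * KB" using B.pos_bounded by auto
  define g where "g = (\<lambda>n s. e (X n s) (B (dh n s)))"
  have hi: "((\<lambda>s. - 2 * g n s) has_integral e (X n t) (X n t) - e (X n 0) (X n 0)) {0..t}" for n
  proof (rule fundamental_theorem_of_calculus[OF \<open>t \<ge> 0\<close>])
    fix s assume s: "s \<in> {0..t}"
    have "((\<lambda>s. e (X n s) (X n s)) has_vector_derivative
       e (X n s) (\<Xi> n s - B (dh n s)) + e (\<Xi> n s - B (dh n s)) (X n s)) (at s within {0..})"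
      using s by (intro e.has_vector_derivative X) auto
    \<comment> \<open>As X = R \<Xi>, the part without \<open>B\<close> is twice e (R \<Xi>) \<Xi>,
      which is 0.\<close>
    moreover have "e (X n s) (\<Xi> n s - B (dh n s)) + e (\<Xi> n s - B (dh n s)) (X n s) = - 2 * g n s"
      by (simp add: g_def e.diff_left e.diff_right e_sym[of "B _"] e_sym[of "\<Xi> n s"] X(1) e_R_self)
    ultimately show "((\<lambda>s. e (X n s) (X n s)) has_vector_derivative - 2 * g n s) (at s within {0..t})"
      using s by (auto intro: has_vector_derivative_within_subset)
  qed
  have "(\<lambda>n. integral {0..t} (\<lambda>s. - 2 * g n s)) \<longlonglongrightarrow> integral {0..t} (\<lambda>s. - 2 * e (x s) (B (d s)))"
  proof (rule dominated_convergence(2))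
    show "(\<lambda>s. - 2 * g n s) integrable_on {0..t}" for n using hi by (rule has_integral_integrable)
    show "(\<lambda>s. 2 * (Kx * (Kd * KB) * Ke)) integrable_on {0..t}" by (rule integrable_const_ivl)
    show "norm (- 2 * g n s) \<le> 2 * (Kx * (Kd * KB) * Ke)" if "s \<in> {0..t}" for n s
    proof -
      have "norm (B (dh n s)) \<le> Kd * KB"
        using KB(2)[of "dh n s"] mult_right_mono[OF dK[OF that, of n], of KB] KB(1) by linarith
      then have "norm (X n s) * norm (B (dh n s)) * Ke \<le> Kx * (Kd * KB) * Ke"
        using XK[OF that, of n] Ke(1) order_trans[OF norm_ge_zero XK[OF that, of n]]
        by (intro mult_mono mult_right_mono) auto
      then show ?thesis using Ke(2)[of "X n s" "B (dh n s)"] by (simp add: g_def)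
    qed
    show "(\<lambda>n. - 2 * g n s) \<longlonglongrightarrow> - 2 * e (x s) (B (d s))" if "s \<in> {0..t}" for s
      unfolding g_def using that Xlim dlim by (intro tendsto_intros e.tendsto B.tendsto) auto
  qed
  moreover have "integral {0..t} (\<lambda>s. - 2 * g n s) = e (X n t) (X n t) - e (X n 0) (X n 0)" for n
    using hi by (rule integral_unique)
  moreover have "(\<lambda>n. e (X n t) (X n t) - e (X n 0) (X n 0)) \<longlonglongrightarrow> e (x t) (x t) - e (x 0) (x 0)"
    using \<open>t \<ge> 0\<close> by (intro tendsto_intros e.tendsto Xlim) auto
  ultimately have "e (x t) (x t) - e (x 0) (x 0) = integral {0..t} (\<lambda>s. - 2 * e (x s) (B (d s)))"
    using LIMSEQ_unique by force
  then show ?thesis by simp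
qed

lemma energy_derivative:
  assumes s: "solves x d" and "t \<ge> 0"
  shows "((\<lambda>t. e (x t) (x t)) has_real_derivative - 2 * e (x t) (B (d t))) (at t within {0..})"
proof -
  have c: "continuous_on {0..} (\<lambda>s. e (x s) (B (d s)))"
    using s by (auto simp: solves_def intro!: e.continuous_on B.continuous_on)
  have "((\<lambda>t. e (x 0) (x 0) + - 2 * integral {0..t} (\<lambda>s. e (x s) (B (d s)))) has_real_derivative - 2 * e (x t) (B (d t))) (at t within {0..})"
    using indefinite_integral_derivative[OF c \<open>t \<ge> 0\<close>]
    by (auto intro!: derivative_eq_intros simp: has_real_derivative_iff_has_vector_derivative[symmetric])
  then show ?thesis
  proof (rule has_field_derivative_transform_within[OF _ zero_less_one])
    show "t \<in> {0..}" using \<open>t \<ge> 0\<close> by simp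
    fix t' :: real assume "t' \<in> {0..}"
    then show "e (x 0) (x 0) + - 2 * integral {0..t'} (\<lambda>s. e (x s) (B (d s))) = e (x t') (x t')"
      using energy_identity[OF s, of t'] by simp
  qed
qed

lemma energy_antimono:
  assumes s: "solves x d" and diss: "\<And>t. t \<ge> 0 \<Longrightarrow> 0 \<le> e (x t) (B (d t))" and "0 \<le> s" "s \<le> t"
  shows "e (x t) (x t) \<le> e (x s) (x s)"
proof (rule DERIV_nonpos_imp_decreasing_open[OF \<open>s \<le> t\<close>, of "\<lambda>t. e (x t) (x t)"])
  show "continuous_on {s..t} (\<lambda>t. e (x t) (x t))"
    using s \<open>0 \<le> s\<close> by (auto simp: solves_def intro!: e.continuous_on elim: continuous_on_subset)
  fix r assume r: "s < r" "r < t"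
  have "((\<lambda>t. e (x t) (x t)) has_real_derivative - 2 * e (x r) (B (d r))) (at r within {0<..})"
    using energy_derivative[OF assms(1), of r] r \<open>0 \<le> s\<close> by (auto intro: DERIV_subset)
  then show "\<exists>y. ((\<lambda>t. e (x t) (x t)) has_real_derivative y) (at r) \<and> y \<le> 0"
    using r \<open>0 \<le> s\<close> diss[of r] by (intro exI[of _ "- 2 * e (x r) (B (d r))"]) (auto simp: at_within_open[of _ "{0<..}"])
qed

text \<open>The equation is autonomous and linear in the pair (x, d). With d = \<phi> (Bs x),
  monotonicity of \<phi> thereby becomes an energy inequality for the difference of x and its
  translate.\<close>

lemma solves_shift_diff:
  assumes s: "solves x d" and "h \<ge> 0"
  shows "solves (\<lambda>t. x (t + h) - x t) (\<lambda>t. d (t + h) - d t)"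
proof -
  have xc: "continuous_on {0..} x" and dc: "continuous_on {0..} d"
    and y: "\<And>t. t \<ge> 0 \<Longrightarrow> ((\<lambda>t. R (x t)) has_vector_derivative x t - R (B (d t))) (at t within {0..})"
    using s by (auto simp: solves_def)
  have sc: "continuous_on {0..} (\<lambda>t. f (t + h))" if "continuous_on {0..} f" for f :: "real \<Rightarrow> 'c::real_normed_vector"
    by (rule continuous_on_compose2[OF that]) (use \<open>h \<ge> 0\<close> in \<open>auto intro!: continuous_intros\<close>)
  have "((\<lambda>t. R (x (t + h)) - R (x t)) has_vector_derivative
      (x (t + h) - R (B (d (t + h)))) - (x t - R (B (d t)))) (at t within {0..})" if "t \<ge> 0" for t
    by (intro has_vector_derivative_diff has_vector_derivative_shift_atLeast[where G = "\<lambda>t. R (x t)"] y that \<open>h \<ge> 0\<close>)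
  then show ?thesis
    using sc[OF xc] sc[OF dc] xc dc unfolding solves_def
    by (auto intro!: continuous_on_diff simp: R.diff B.diff algebra_simps)
qed

end

section \<open>Nonlinear feedback: Lyapunov function, interpolation and decay\<close>

text \<open>The bounds in \<open>\<phi>_coercive\<close> are required on balls only: the energy does
  not increase, so each trajectory stays in one ball and meets fixed constants.\<close>

locale dissipative_loop = closed_loop e R Bs B
  for e :: "'a::real_normed_vector \<Rightarrow> 'a \<Rightarrow> real" and R :: "'a \<Rightarrow> 'a" and Bs :: "'a \<Rightarrow> 'b::euclidean_space"
    and B :: "'b \<Rightarrow> 'a" +
  fixes \<phi> :: "'b \<Rightarrow> 'b" and W :: "'a \<Rightarrow> 'a \<Rightarrow> real" and \<epsilon> C :: real
  assumes W: "bounded_bilinear W" and \<epsilon>: "\<epsilon> > 0"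
    and W_dissipative: "W x (R x) + W (R x) x \<le> - \<epsilon> * (norm (R x))\<^sup>2 + C * (norm (Bs x))\<^sup>2"
    and \<phi>_continuous: "continuous_on UNIV \<phi>"
    and \<phi>_monotone: "0 \<le> e (x - z) (B (\<phi> (Bs x) - \<phi> (Bs z)))"
    and \<phi>_coercive: "\<exists>\<kappa>>0. \<exists>L. \<forall>x. norm x \<le> r \<longrightarrow>
      norm (\<phi> (Bs x)) \<le> L * norm (Bs x) \<and> \<kappa> * (norm (Bs x))\<^sup>2 \<le> e x (B (\<phi> (Bs x)))"
begin

sublocale W: bounded_bilinear W by (rule W)

context
  fixes x :: "real \<Rightarrow> 'a"
  assumes x: "solves x (\<lambda>t. \<phi> (Bs (x t)))"
begin

lemma energy_decreasing:
  assumes "0 \<le> s" "s \<le> t"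
  shows "e (x t) (x t) \<le> e (x s) (x s)"
proof (rule energy_antimono[OF x _ assms])
  fix t
  show "0 \<le> e (x t) (B (\<phi> (Bs (x t))))"
    using \<phi>_coercive[of "norm (x t)"] by (smt (verit) mult_nonneg_nonneg zero_le_power2)
qed

lemma trajectory_bounded: "\<exists>r. \<forall>t\<ge>0. norm (x t) \<le> r"
proof -
  obtain c where c: "c > 0" "\<And>x. c * (norm x)\<^sup>2 \<le> e x x" using e_coercive by auto
  have "norm (x t) \<le> sqrt (e (x 0) (x 0) / c)" if "t \<ge> 0" for t
  proof (rule real_le_rsqrt)
    show "(norm (x t))\<^sup>2 \<le> e (x 0) (x 0) / c"
      using c(2)[of "x t"] energy_decreasing[of 0 t] that c(1) by (simp add: pos_le_divide_eq mult.commute)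
  qed
  then show ?thesis by blast
qed

lemma increments_bounded: "\<exists>K>0. \<forall>t\<ge>0. \<forall>h\<ge>0. norm (x (t + h) - x t) \<le> K * norm (x h - x 0)"
proof -
  obtain c1 c2 where c: "c1 > 0" "c2 > 0" "\<And>x. c1 * norm x \<le> en x" "\<And>x. en x \<le> c2 * norm x"
    using en_bounds by auto
  have "norm (x (t + h) - x t) \<le> c2 / c1 * norm (x h - x 0)" if "t \<ge> 0" "h \<ge> 0" for t h
  proof -
    have "e (x (t + h) - x t) (x (t + h) - x t) \<le> e (x (0 + h) - x 0) (x (0 + h) - x 0)"
      by (rule energy_antimono[OF solves_shift_diff[OF x that(2)] \<phi>_monotone order_refl that(1)])
    then have "en (x (t + h) - x t) \<le> en (x h - x 0)"
      unfolding en_def by simp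
    then have "c1 * norm (x (t + h) - x t) \<le> c2 * norm (x h - x 0)"
      using c(3)[of "x (t + h) - x t"] c(4)[of "x h - x 0"] by linarith
    then show ?thesis using c(1) by (simp add: pos_le_divide_eq mult.commute)
  qed
  then show ?thesis using c by (intro exI[of _ "c2 / c1"]) auto
qed

lemma lyapunov_function:
  obtains L L' c K where "c > 0" "K > 0"
    "\<And>t. t \<ge> 0 \<Longrightarrow> (L has_real_derivative L' t) (at t within {0..})"
    "\<And>t. t \<ge> 0 \<Longrightarrow> L' t \<le> - c * (norm (R (x t)))\<^sup>2"
    "\<And>t. t \<ge> 0 \<Longrightarrow> e (x t) (x t) \<le> L t"
    "\<And>t. t \<ge> 0 \<Longrightarrow> L t \<le> K * e (x t) (x t)"
proof -
  obtain r where r: "\<And>t. t \<ge> 0 \<Longrightarrow> norm (x t) \<le> r" using trajectory_bounded by auto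
  obtain \<kappa> l where \<kappa>: "\<kappa> > 0" and l: "\<And>x. norm x \<le> r \<Longrightarrow> norm (\<phi> (Bs x)) \<le> l * norm (Bs x)"
    and \<kappa>': "\<And>x. norm x \<le> r \<Longrightarrow> \<kappa> * (norm (Bs x))\<^sup>2 \<le> e x (B (\<phi> (Bs x)))"
    using \<phi>_coercive[of r] by auto
  obtain ce where ce: "ce > 0" "\<And>x. ce * (norm x)\<^sup>2 \<le> e x x" using e_coercive by auto
  obtain KW where KW: "KW > 0" "\<And>x y. norm (W x y) \<le> norm x * norm y * KW" using W.pos_bounded by auto
  obtain KR where KR: "KR > 0" "\<And>x. norm (R x) \<le> norm x * KR" using R.pos_bounded by auto
  obtain KB where KB: "KB > 0" "\<And>x. norm (R (B x)) \<le> norm x * KB"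
    using bounded_linear.pos_bounded[OF bounded_linear_compose[OF R B]] by auto
  \<comment> \<open>M bounds the perturbation W (R z) (R z) relative to the energy of z.\<close>
  define M where "M = KW * KR\<^sup>2 / ce"
  have M: "M > 0" using KW KR ce by (simp add: M_def)
  have WM: "\<bar>W (R z) (R z)\<bar> \<le> M * e z z" for z
  proof -
    have "\<bar>W (R z) (R z)\<bar> \<le> KW * (norm (R z))\<^sup>2" using KW(2)[of "R z" "R z"] by (simp add: power2_eq_square mult_ac)
    also have "(norm (R z))\<^sup>2 \<le> (norm z * KR)\<^sup>2" using KR(2)[of z] by (intro power_mono) auto
    also have "KW * (norm z * KR)\<^sup>2 = M * (ce * (norm z)\<^sup>2)" using ce by (simp add: M_def power_mult_distrib)
    also have "\<dots> \<le> M * e z z" using M ce(2)[of z] by (intro mult_left_mono) auto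
    finally show ?thesis using KW(1) by simp
  qed
  \<comment> \<open>P collects what is multiplied by |Bs x|^2: the constant C and the cross terms of
    W with R (B d), where |d| \<le> l |Bs x|. In N, the part M + 1 makes L at least the energy, and
    P / (2 \<kappa>) lets the damping 2 \<kappa> N |Bs x|^2 outweigh P |Bs x|^2.\<close>
  define P where "P = \<bar>C\<bar> + 2 * (KW * KB * l)\<^sup>2 / \<epsilon>"
  define N where "N = M + 1 + P / (2 * \<kappa>)"
  have P: "P \<ge> 0" using \<epsilon> by (simp add: P_def)
  then have N: "N \<ge> M + 1" "2 * \<kappa> * N \<ge> P" using \<kappa> M by (simp_all add: N_def distrib_left)
  define d where "d = (\<lambda>t. \<phi> (Bs (x t)))"
  define L where "L = (\<lambda>t. N * e (x t) (x t) + W (R (x t)) (R (x t)))"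
  define L' where "L' = (\<lambda>t. N * (- 2 * e (x t) (B (d t)))
     + (W (R (x t)) (x t - R (B (d t))) + W (x t - R (B (d t))) (R (x t))))"
  show thesis
  proof (rule that[of "\<epsilon> / 2" "N + M" L L'])
    fix t :: real assume t: "t \<ge> 0"
    have y: "((\<lambda>t. R (x t)) has_vector_derivative x t - R (B (d t))) (at t within {0..})"
      using x t by (simp add: solves_def d_def)
    show "(L has_real_derivative L' t) (at t within {0..})"
      unfolding L_def L'_def
      using W.has_vector_derivative[OF y y] energy_derivative[OF x t]
      by (intro DERIV_add DERIV_cmult) (auto simp: d_def has_real_derivative_iff_has_vector_derivative)
    define w n where "w = norm (Bs (x t))" and "n = norm (R (x t))"
    have "norm (d t) \<le> l * w" using l[OF r[OF t]] by (simp add: d_def w_def)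
    then have nd: "norm (R (B (d t))) \<le> KB * (l * w)"
      using order_trans[OF KB(2) mult_right_mono[of "norm (d t)" "l * w" KB]] KB(1) by (simp add: mult.commute)
    \<comment> \<open>Half of the dissipation \<epsilon> |R x|^2 is spent on the cross
      terms.\<close>
    have q: "- W (R (x t)) (R (B (d t))) - W (R (B (d t))) (R (x t)) \<le> \<epsilon> / 2 * n\<^sup>2 + 2 * (KW * KB * l)\<^sup>2 / \<epsilon> * w\<^sup>2"
    proof -
      have "- W (R (x t)) (R (B (d t))) - W (R (B (d t))) (R (x t)) \<le> 2 * (n * norm (R (B (d t))) * KW)"
        using KW(2)[of "R (x t)" "R (B (d t))"] KW(2)[of "R (B (d t))" "R (x t)"] by (simp add: n_def mult_ac)
      also have "\<dots> \<le> 2 * (n * (KB * (l * w)) * KW)"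
        using nd KW(1) by (intro mult_left_mono mult_right_mono) (auto simp: n_def)
      also have "\<dots> = 2 * n * (KW * KB * l * w)" by simp
      also have "\<dots> \<le> \<epsilon> / 2 * n\<^sup>2 + 2 / \<epsilon> * (KW * KB * l * w)\<^sup>2"
      proof -
        have "2 * n * p \<le> \<epsilon> / 2 * n\<^sup>2 + 2 / \<epsilon> * p\<^sup>2" for p
        proof -
          have "0 \<le> (\<epsilon> * n - 2 * p)\<^sup>2 / (2 * \<epsilon>)" using \<epsilon> by simp
          also have "\<dots> = \<epsilon> / 2 * n\<^sup>2 + 2 / \<epsilon> * p\<^sup>2 - 2 * n * p"
            using \<epsilon> by (simp add: power2_eq_square field_simps)
          finally show ?thesis by simp
        qed
        then show ?thesis .
      qed
      finally show ?thesis by (simp add: power_mult_distrib)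
    qed
    have "N * (- 2 * e (x t) (B (d t))) \<le> N * (- 2 * (\<kappa> * w\<^sup>2))"
    proof (rule mult_left_mono)
      show "- 2 * e (x t) (B (d t)) \<le> - 2 * (\<kappa> * w\<^sup>2)"
        using \<kappa>'[OF r[OF t]] by (simp add: d_def w_def)
    qed (use N M in auto)
    also have "\<dots> = - (2 * \<kappa> * N) * w\<^sup>2" by simp
    also have "\<dots> \<le> - P * w\<^sup>2" using N(2) by (intro mult_right_mono) auto
    finally have "L' t \<le> - P * w\<^sup>2 + (W (x t) (R (x t)) + W (R (x t)) (x t))
        + (- W (R (x t)) (R (B (d t))) - W (R (B (d t))) (R (x t)))"
      by (simp add: L'_def W.diff_left W.diff_right)
    also have "\<dots> \<le> - P * w\<^sup>2 + (- \<epsilon> * n\<^sup>2 + \<bar>C\<bar> * w\<^sup>2) + (\<epsilon> / 2 * n\<^sup>2 + 2 * (KW * KB * l)\<^sup>2 / \<epsilon> * w\<^sup>2)"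
    proof -
      have "C * w\<^sup>2 \<le> \<bar>C\<bar> * w\<^sup>2" by (intro mult_right_mono) auto
      then show ?thesis using W_dissipative[of "x t"] q unfolding n_def w_def by linarith
    qed
    also have "\<dots> = - (\<epsilon> / 2) * n\<^sup>2" by (simp add: P_def algebra_simps)
    finally show "L' t \<le> - (\<epsilon> / 2) * (norm (R (x t)))\<^sup>2" by (simp add: n_def)
    have "(M + 1) * e (x t) (x t) \<le> N * e (x t) (x t)" using N(1) e_nonneg by (rule mult_right_mono)
    then show "e (x t) (x t) \<le> L t" using WM[of "x t"] by (simp add: L_def algebra_simps)
    show "L t \<le> (N + M) * e (x t) (x t)" using WM[of "x t"] by (simp add: L_def algebra_simps)
  qed (use \<epsilon> N M in auto)
qed

text \<open>As \<open>x\<close> is close to \<open>R \<xi>\<close> with \<open>\<xi>\<close> bounded in terms of the increments of \<open>x\<close> and as \<open>R\<close> is skew,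
  the energy is controlled by the weaker norm \<open>norm (R x)\<close>.\<close>

lemma energy_interpolation:
  obtains K where "K > 0" "\<And>t h m. t \<ge> 0 \<Longrightarrow> h > 0 \<Longrightarrow> (\<And>s. 0 \<le> s \<Longrightarrow> s \<le> h \<Longrightarrow> norm (x s - x 0) \<le> m) \<Longrightarrow>
     e (x t) (x t) \<le> K * m + K * (m / h + 1) * norm (R (x t))"
proof -
  obtain r where r: "\<And>t. t \<ge> 0 \<Longrightarrow> norm (x t) \<le> r" using trajectory_bounded by auto
  obtain l where l: "\<And>x. norm x \<le> r \<Longrightarrow> norm (\<phi> (Bs x)) \<le> l * norm (Bs x)"
    using \<phi>_coercive[of r] by auto
  obtain Ki where Ki: "Ki > 0" "\<And>t h. t \<ge> 0 \<Longrightarrow> h \<ge> 0 \<Longrightarrow> norm (x (t + h) - x t) \<le> Ki * norm (x h - x 0)"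
    using increments_bounded by auto
  obtain Ke where Ke: "Ke > 0" "\<And>x y. norm (e x y) \<le> norm x * norm y * Ke" using e.pos_bounded by auto
  obtain KB where KB: "KB > 0" "\<And>x. norm (B x) \<le> norm x * KB" using B.pos_bounded by auto
  obtain Kb where Kb: "Kb > 0" "\<And>x. norm (Bs x) \<le> norm x * Kb" using Bs.pos_bounded by auto
  define d where "d = (\<lambda>t. \<phi> (Bs (x t)))"
  define Kd where "Kd = \<bar>l\<bar> * (r * Kb)"
  have r0: "0 \<le> r" using r[of 0] norm_ge_zero[of "x 0"] by linarith
  have Kd: "norm (d t) \<le> Kd" if "t \<ge> 0" for t
  proof -
    have "norm (d t) \<le> l * norm (Bs (x t))" using l r that by (simp add: d_def)
    also have "\<dots> \<le> \<bar>l\<bar> * norm (Bs (x t))" by (intro mult_right_mono) auto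
    also have "\<dots> \<le> Kd"
      unfolding Kd_def
      by (intro mult_left_mono order_trans[OF Kb(2)] mult_right_mono r that) (use Kb(1) in auto)
    finally show ?thesis .
  qed
  have Kd0: "0 \<le> Kd" using r0 Kb by (simp add: Kd_def)
  define K where "K = Ke * (Ki + Kd * KB + 1) * (r + 1)"
  have K: "K > 0" "Ki * r * Ke \<le> K" "Ki * Ke \<le> K" "Kd * KB * Ke \<le> K"
    using Ke Ki Kd0 KB r0 by (auto simp: K_def algebra_simps intro!: add_nonneg_nonneg mult_nonneg_nonneg add_pos_nonneg)
  show thesis
  proof (rule that[OF K(1)])
    fix t h m :: real
    assume t: "t \<ge> 0" and h: "h > 0" and m: "\<And>s. 0 \<le> s \<Longrightarrow> s \<le> h \<Longrightarrow> norm (x s - x 0) \<le> m"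
    have m0: "0 \<le> m" using m[of 0] h by simp
    obtain X \<Xi> dh where X: "\<And>t. X t = R (\<Xi> t)" "\<And>t. \<Xi> t = (x (t + h) - x t) /\<^sub>R h + B (dh t)"
      "\<And>t k w. t \<ge> 0 \<Longrightarrow> (\<And>s. t \<le> s \<Longrightarrow> s \<le> t + h \<Longrightarrow> norm (x s - w) \<le> k) \<Longrightarrow> norm (X t - w) \<le> k"
      "\<And>t k w. t \<ge> 0 \<Longrightarrow> (\<And>s. t \<le> s \<Longrightarrow> s \<le> t + h \<Longrightarrow> norm (d s - w) \<le> k) \<Longrightarrow> norm (dh t - w) \<le> k"
      using solves_average[OF x h] unfolding d_def by metis
    have inc: "norm (x (t + s) - x t) \<le> Ki * m" if "0 \<le> s" "s \<le> h" for s
      using Ki(2)[of t s] mult_left_mono[OF m[OF that], of Ki] Ki(1) t that by linarith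
    have "norm (x s - x t) \<le> Ki * m" if "t \<le> s" "s \<le> t + h" for s
      using inc[of "s - t"] that by simp
    then have Xx: "norm (x t - X t) \<le> Ki * m"
      using X(3)[of t "x t"] t by (simp add: norm_minus_commute)
    have "norm (dh t) \<le> Kd" using X(4)[of t 0 Kd] Kd t by simp
    then have "norm (B (dh t)) \<le> Kd * KB"
      using KB(2)[of "dh t"] mult_right_mono[of "norm (dh t)" Kd KB] KB(1) by linarith
    moreover have "norm ((x (t + h) - x t) /\<^sub>R h) \<le> Ki * m / h"
      using inc[of h] h by (simp add: divide_inverse mult.commute mult_left_mono)
    ultimately have \<Xi>: "norm (\<Xi> t) \<le> Ki * m / h + Kd * KB"
      unfolding X(2) by (intro norm_triangle_mono)
    \<comment> \<open>As X = R \<Xi>, skewness moves \<open>R\<close> from \<Xi> to x, which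
      replaces |x| by |R x| at the price of |\<Xi>|.\<close>
    have "e (x t) (x t) = e (x t - X t) (x t) - e (\<Xi> t) (R (x t))"
      using skew[of "\<Xi> t" "x t"] by (simp add: e.diff_left X(1))
    also have "\<dots> \<le> norm (x t - X t) * norm (x t) * Ke + norm (\<Xi> t) * norm (R (x t)) * Ke"
      using Ke(2)[of "x t - X t" "x t"] Ke(2)[of "\<Xi> t" "R (x t)"] by (simp add: abs_le_iff)
    also have "\<dots> \<le> (Ki * m) * r * Ke + (Ki * m / h + Kd * KB) * norm (R (x t)) * Ke"
      using Xx \<Xi> r[OF t] Ke(1) Ki(1) m0 by (intro add_mono mult_mono mult_right_mono) auto
    also have "\<dots> = (Ki * r * Ke) * m + ((Ki * Ke) * (m / h) + Kd * KB * Ke) * norm (R (x t))"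
      by (simp add: algebra_simps)
    also have "\<dots> \<le> K * m + (K * (m / h) + K) * norm (R (x t))"
      using K m0 h by (intro add_mono mult_right_mono) auto
    finally show "e (x t) (x t) \<le> K * m + K * (m / h + 1) * norm (R (x t))"
      by (simp add: algebra_simps)
  qed
qed

text \<open>The energy is nonincreasing, so if it does not tend to 0 it stays above some \<eta> > 0.
  The interpolation then keeps |R x| away from 0, and the Lyapunov function decreases at least
  linearly.\<close>

theorem energy_tendsto_zero: "((\<lambda>t. e (x t) (x t)) \<longlongrightarrow> 0) at_top"
proof (rule ccontr)
  assume not: "\<not> ?thesis"
  have "\<exists>\<eta>>0. \<forall>t\<ge>0. \<eta> \<le> e (x t) (x t)"
  proof (rule ccontr)
    assume *: "\<not> (\<exists>\<eta>>0. \<forall>t\<ge>0. \<eta> \<le> e (x t) (x t))"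
    have "((\<lambda>t. e (x t) (x t)) \<longlongrightarrow> 0) at_top"
    proof (rule tendstoI)
      fix \<eta> :: real assume "\<eta> > 0"
      with * obtain t0 where t0: "t0 \<ge> 0" "e (x t0) (x t0) < \<eta>" by (meson not_le)
      show "\<forall>\<^sub>F t in at_top. dist (e (x t) (x t)) 0 < \<eta>"
        using eventually_ge_at_top[of t0]
      proof eventually_elim
        case (elim t)
        then show ?case using energy_decreasing[OF t0(1) elim] t0(2) e_nonneg[of "x t"] by simp
      qed
    qed
    with not show False by simp
  qed
  then obtain \<eta> where \<eta>: "\<eta> > 0" "\<And>t. t \<ge> 0 \<Longrightarrow> \<eta> \<le> e (x t) (x t)" by auto
  obtain K where K: "K > 0" "\<And>t h m. t \<ge> 0 \<Longrightarrow> h > 0 \<Longrightarrow> (\<And>s. 0 \<le> s \<Longrightarrow> s \<le> h \<Longrightarrow> norm (x s - x 0) \<le> m) \<Longrightarrow>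
     e (x t) (x t) \<le> K * m + K * (m / h + 1) * norm (R (x t))"
    by (rule energy_interpolation) blast
  have "continuous_on {0..} x" using x by (simp add: solves_def)
  \<comment> \<open>Continuity at time 0 is enough: increments there of at most \<eta> / (2 K) let
    the first term of the interpolation take only half of \<eta>, at every later time.\<close>
  then obtain h where h: "h > 0" "\<And>s. 0 \<le> s \<Longrightarrow> dist s 0 < h \<Longrightarrow> dist (x s) (x 0) < \<eta> / (2 * K)"
    using \<eta>(1) K(1) unfolding continuous_on_iff by (metis atLeast_iff order_refl divide_pos_pos mult_pos_pos zero_less_numeral)
  \<comment> \<open>Here h / 2 replaces h, because continuity bounds the increments for s < h while
    the interpolation asks for a closed interval.\<close>
  define D where "D = K * (\<eta> / (2 * K) / (h / 2) + 1)"
  have D: "D > 0" using K(1) h(1) \<eta>(1) by (simp add: D_def add_pos_pos)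
  define q where "q = \<eta> / (2 * D)"
  have q: "q > 0" using \<eta>(1) D by (simp add: q_def)
  have lower: "q \<le> norm (R (x t))" if "t \<ge> 0" for t
  proof -
    have "e (x t) (x t) \<le> K * (\<eta> / (2 * K)) + D * norm (R (x t))"
      unfolding D_def using h that by (intro K(2)) (auto simp: dist_norm intro!: less_imp_le)
    then have "\<eta> / 2 \<le> D * norm (R (x t))" using \<eta>(2)[OF that] K(1) by simp
    then show ?thesis using D by (simp add: q_def field_simps)
  qed
  obtain L L' c M where L: "c > 0" "M > 0"
    "\<And>t. t \<ge> 0 \<Longrightarrow> (L has_real_derivative L' t) (at t within {0..})"
    "\<And>t. t \<ge> 0 \<Longrightarrow> L' t \<le> - c * (norm (R (x t)))\<^sup>2"
    "\<And>t. t \<ge> 0 \<Longrightarrow> e (x t) (x t) \<le> L t"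
    "\<And>t. t \<ge> 0 \<Longrightarrow> L t \<le> M * e (x t) (x t)"
    by (rule lyapunov_function) blast
  have dec: "L t \<le> L 0 - c * q\<^sup>2 * t" if "t \<ge> 0" for t
  proof -
    have "L t + c * q\<^sup>2 * t \<le> L 0 + c * q\<^sup>2 * 0"
    proof (rule DERIV_nonpos_imp_decreasing_open[OF that, of "\<lambda>t. L t + c * q\<^sup>2 * t"])
      show "continuous_on {0..t} (\<lambda>t. L t + c * q\<^sup>2 * t)"
        using L(3) by (intro continuous_intros)
          (auto simp: continuous_on_eq_continuous_within intro!: continuous_within_subset[OF DERIV_continuous[OF L(3)]])
      fix s :: real assume s: "0 < s" "s < t"
      have "(L has_real_derivative L' s) (at s within {0<..})"
        using L(3)[of s] s by (auto intro: DERIV_subset)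
      then have "(L has_real_derivative L' s) (at s)"
        using s by (simp add: at_within_open[of _ "{0<..}"])
      moreover have "q\<^sup>2 \<le> (norm (R (x s)))\<^sup>2" using lower[of s] s q by (intro power_mono) auto
      then have "L' s + c * q\<^sup>2 \<le> 0" 
      proof -
        assume "q\<^sup>2 \<le> (norm (R (x s)))\<^sup>2"
        then have "c * q\<^sup>2 \<le> c * (norm (R (x s)))\<^sup>2" using L(1) by (intro mult_left_mono) auto
        then show ?thesis using L(4)[of s] s by simp
      qed
      ultimately show "\<exists>y. ((\<lambda>t. L t + c * q\<^sup>2 * t) has_real_derivative y) (at s) \<and> y \<le> 0"
        by (intro exI[of _ "L' s + c * q\<^sup>2"]) (auto intro!: derivative_eq_intros)
    qed
    then show ?thesis by simp
  qed
  \<comment> \<open>The time at which the linear upper bound of L reaches 0, whereas L \<ge> \<eta>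
    there.\<close>
  define t where "t = L 0 / (c * q\<^sup>2)"
  have "0 \<le> L 0" using L(5)[of 0] e_nonneg[of "x 0"] by simp
  then have t: "t \<ge> 0" using L(1) by (simp add: t_def)
  have "L 0 - c * q\<^sup>2 * t = 0" using L(1) q by (simp add: t_def)
  then show False using dec[OF t] L(5)[OF t] \<eta>(2)[OF t] \<eta>(1) by simp
qed

text \<open>With increments of at most k h on [0, h], the quotient m / h in the interpolation stays
  bounded as h tends to 0 while the term K m disappears; so the energy is at most D |R x|. Then L'
  \<le> - \<kappa> L^2, that is, 1 / L grows at least at rate \<kappa>.\<close>

theorem energy_rate:
  assumes "h0 > 0" and inc: "\<And>h. 0 \<le> h \<Longrightarrow> h \<le> h0 \<Longrightarrow> norm (x h - x 0) \<le> k * h"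
  shows "\<exists>A. \<forall>t>0. e (x t) (x t) \<le> A / t"
proof -
  obtain K where K: "K > 0" "\<And>t h m. t \<ge> 0 \<Longrightarrow> h > 0 \<Longrightarrow> (\<And>s. 0 \<le> s \<Longrightarrow> s \<le> h \<Longrightarrow> norm (x s - x 0) \<le> m) \<Longrightarrow>
     e (x t) (x t) \<le> K * m + K * (m / h + 1) * norm (R (x t))"
    by (rule energy_interpolation) blast
  have k0: "0 \<le> k" using inc[of h0] \<open>h0 > 0\<close> norm_ge_zero[of "x h0 - x 0"]
    by (metis less_imp_le order_refl order_trans zero_le_mult_iff not_less)
  define D where "D = K * (k + 1)"
  have D: "D > 0" using K(1) k0 by (simp add: D_def)
  have interp: "e (x t) (x t) \<le> D * norm (R (x t))" if "t \<ge> 0" for t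
  proof (rule tendsto_lowerbound)
    show "((\<lambda>h. K * (k * h) + D * norm (R (x t))) \<longlongrightarrow> D * norm (R (x t))) (at_right 0)"
      by (auto intro!: tendsto_eq_intros)
    show "\<forall>\<^sub>F h in at_right 0. e (x t) (x t) \<le> K * (k * h) + D * norm (R (x t))"
      using eventually_at_right_real[OF \<open>h0 > 0\<close>]
    proof eventually_elim
      case (elim h)
      then have h: "0 < h" "h < h0" by auto
      have "e (x t) (x t) \<le> K * (k * h) + K * (k * h / h + 1) * norm (R (x t))"
      proof (rule K(2)[OF that h(1)])
        fix s assume s: "0 \<le> s" "s \<le> h"
        have "norm (x s - x 0) \<le> k * s" using inc s h by simp
        also have "\<dots> \<le> k * h" using s k0 by (intro mult_left_mono) auto
        finally show "norm (x s - x 0) \<le> k * h" .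
      qed
      then show "e (x t) (x t) \<le> K * (k * h) + D * norm (R (x t))" using h by (simp add: D_def)
    qed
  qed simp
  obtain L L' c M where L: "c > 0" "M > 0"
    "\<And>t. t \<ge> 0 \<Longrightarrow> (L has_real_derivative L' t) (at t within {0..})"
    "\<And>t. t \<ge> 0 \<Longrightarrow> L' t \<le> - c * (norm (R (x t)))\<^sup>2"
    "\<And>t. t \<ge> 0 \<Longrightarrow> e (x t) (x t) \<le> L t"
    "\<And>t. t \<ge> 0 \<Longrightarrow> L t \<le> M * e (x t) (x t)"
    by (rule lyapunov_function) blast
  have L0: "0 \<le> L t" if "t \<ge> 0" for t using L(5)[OF that] e_nonneg[of "x t"] by simp
  define \<kappa> where "\<kappa> = c / (M * D)\<^sup>2"
  have \<kappa>: "\<kappa> > 0" using L(1,2) D by (simp add: \<kappa>_def)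
  have L': "L' t \<le> - \<kappa> * (L t)\<^sup>2" if "t \<ge> 0" for t
  proof -
    have "L t \<le> M * (D * norm (R (x t)))"
      using L(6)[OF that] mult_left_mono[OF interp[OF that], of M] L(2) by linarith
    then have "(L t)\<^sup>2 \<le> (M * D * norm (R (x t)))\<^sup>2" using L0[OF that] by (intro power_mono) (auto simp: mult.assoc)
    then have "(L t)\<^sup>2 / (M * D)\<^sup>2 \<le> (norm (R (x t)))\<^sup>2"
      using L(2) D by (simp add: power_mult_distrib divide_le_eq mult_ac)
    then have "c * ((L t)\<^sup>2 / (M * D)\<^sup>2) \<le> c * (norm (R (x t)))\<^sup>2" using L(1) by (intro mult_left_mono) auto
    then show ?thesis using L(4)[OF that] by (simp add: \<kappa>_def)
  qed
  have dL: "(L has_real_derivative L' s) (at s)" if "s > 0" for s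
  proof -
    have "(L has_real_derivative L' s) (at s within {0<..})"
      using L(3)[of s] that by (auto intro: DERIV_subset)
    then show ?thesis using that by (simp add: at_within_open[of _ "{0<..}"])
  qed
  have cL: "continuous_on {s..t} L" if "0 \<le> s" for s t
    using that by (auto simp: continuous_on_eq_continuous_within intro!: continuous_within_subset[OF DERIV_continuous[OF L(3)]])
  have "L t \<le> (1 / \<kappa>) / t" if t: "t > 0" for t
  proof (cases "L t = 0")
    case True
    then show ?thesis using t \<kappa> by simp
  next
    case False
    then have Lt: "L t > 0" using L0[of t] t by simp
    \<comment> \<open>L is nonincreasing, so L t > 0 makes 1 / L meaningful on all of
      [0, t].\<close>
    have pos: "L s > 0" if s: "0 \<le> s" "s \<le> t" for s
    proof -
      have "L t \<le> L s"
      proof (rule DERIV_nonpos_imp_decreasing_open[OF s(2) _ cL[OF s(1)]])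
        fix r assume r: "s < r" "r < t"
        have "L' r \<le> 0" using L'[of r] r s \<kappa> by (smt (verit) mult_nonneg_nonneg minus_mult_left zero_le_power2)
        then show "\<exists>y. (L has_real_derivative y) (at r) \<and> y \<le> 0" using dL[of r] r s by auto
      qed
      with Lt show ?thesis by simp
    qed
    have "\<kappa> * t - inverse (L t) \<le> \<kappa> * 0 - inverse (L 0)"
    proof (rule DERIV_nonpos_imp_decreasing_open[of 0 t "\<lambda>s. \<kappa> * s - inverse (L s)"])
      show "0 \<le> t" using t by simp
      show "continuous_on {0..t} (\<lambda>s. \<kappa> * s - inverse (L s))"
        using pos by (intro continuous_intros cL) (auto simp: less_imp_neq[symmetric])
      fix s assume s: "0 < s" "s < t"
      have p: "L s > 0" using pos s by simp
      have "((\<lambda>s. \<kappa> * s - inverse (L s)) has_real_derivative \<kappa> + L' s / (L s)\<^sup>2) (at s)"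
        using dL[OF s(1)] p by (auto intro!: derivative_eq_intros simp: field_simps power2_eq_square)
      moreover have "\<kappa> + L' s / (L s)\<^sup>2 \<le> 0"
        using L'[of s] s p by (simp add: divide_le_eq field_simps)
      ultimately show "\<exists>y. ((\<lambda>s. \<kappa> * s - inverse (L s)) has_real_derivative y) (at s) \<and> y \<le> 0" by blast
    qed
    moreover have "0 < inverse (L 0)" using pos[of 0] t by simp
    ultimately have "\<kappa> * t \<le> inverse (L t)" by linarith
    then show ?thesis using Lt t \<kappa> by (simp add: field_simps)
  qed
  then show ?thesis using L(5) by (intro exI[of _ "1 / \<kappa>"]) (meson less_imp_le order_trans)
qed

end

end

section \<open>Absolutely continuous functions\<close>

lemma continuous_on_unit_interval_bounded:
  fixes f :: "real \<Rightarrow> 'a::real_normed_vector"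
  assumes "continuous_on {0..1} f"
  obtains K where "\<And>s. s \<in> {0..1} \<Longrightarrow> norm (f s) \<le> K"
proof -
  have "bounded (f ` {0..1})" by (intro compact_imp_bounded compact_continuous_image assms) auto
  then show thesis using that unfolding bounded_iff by blast
qed

text \<open>Fubini on the square [0, x]^2, cut along the diagonal: \<open>h1\<close> lives on the
  triangle r \<le> s and \<open>h2\<close> on s < r. The factors are merely integrable, so the
  fundamental theorem for continuous integrands does not apply.\<close>

lemma integral_product_by_parts:
  fixes f g :: "real \<Rightarrow> complex"
  assumes f: "integrable (lebesgue_on {0..x}) f" and g: "integrable (lebesgue_on {0..x}) g"
  shows "integral {0..x} f * integral {0..x} g =
    integral {0..x} (\<lambda>s. f s * integral {0..s} g + integral {0..s} f * g s)"
    and "integrable (lebesgue_on {0..x}) (\<lambda>s. f s * integral {0..s} g + integral {0..s} f * g s)"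
proof -
  define M where "M = lebesgue_on {0..x}"
  interpret M: finite_measure M
    unfolding M_def by (rule finite_measure_lebesgue_on) simp
  interpret P: pair_sigma_finite M M
    by (simp add: pair_sigma_finite_def M.sigma_finite_measure_axioms)
  have fM: "integrable M f" and gM: "integrable M g" using f g by (simp_all add: M_def)
  note [measurable] = borel_measurable_integrable[OF fM] borel_measurable_integrable[OF gM]
  have idm [measurable]: "(\<lambda>s. s) \<in> borel_measurable M"
    unfolding M_def by (intro measurable_restrict_space1 measurable_completion) simp
  have [measurable]: "Measurable.pred (M \<Otimes>\<^sub>M M) (\<lambda>p. snd p \<le> fst p)"
    by measurable
  have space: "space M = {0..x}" by (simp add: M_def)
  define h1 where "h1 = (\<lambda>(s, r). f s * (indicat_real {..s} r *\<^sub>R g r))"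
  define h2 where "h2 = (\<lambda>(s, r). (indicat_real {..<r} s *\<^sub>R f s) * g r)"
  define h where "h = (\<lambda>(s, r). f s * g r)"
  have hint: "integrable (M \<Otimes>\<^sub>M M) h"
    unfolding h_def
  proof (rule P.Fubini_integrable)
    show "integrable M (\<lambda>s. LINT r|M. norm (case (s, r) of (s, r) \<Rightarrow> f s * g r))"
      using fM gM by (simp add: norm_mult)
    show "AE s in M. integrable M (\<lambda>r. case (s, r) of (s, r) \<Rightarrow> f s * g r)"
      using gM by simp
  qed measurable
  have h1m: "h1 \<in> borel_measurable (M \<Otimes>\<^sub>M M)"
  proof -
    have "(\<lambda>p. if snd p \<le> fst p then f (fst p) * g (snd p) else 0) \<in> borel_measurable (M \<Otimes>\<^sub>M M)" by measurable
    also have "(\<lambda>p. if snd p \<le> fst p then f (fst p) * g (snd p) else 0) = h1"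
      by (auto simp: h1_def fun_eq_iff indicator_def)
    finally show ?thesis .
  qed
  have h2m: "h2 \<in> borel_measurable (M \<Otimes>\<^sub>M M)"
  proof -
    have "(\<lambda>p. if snd p \<le> fst p then 0 else f (fst p) * g (snd p)) \<in> borel_measurable (M \<Otimes>\<^sub>M M)" by measurable
    also have "(\<lambda>p. if snd p \<le> fst p then 0 else f (fst p) * g (snd p)) = h2"
      by (auto simp: h2_def fun_eq_iff indicator_def)
    finally show ?thesis .
  qed
  have h1: "integrable (M \<Otimes>\<^sub>M M) h1"
    by (rule Bochner_Integration.integrable_bound[OF hint h1m]) (auto simp: h1_def h_def norm_mult indicator_def)
  have h2: "integrable (M \<Otimes>\<^sub>M M) h2"
    by (rule Bochner_Integration.integrable_bound[OF hint h2m]) (auto simp: h2_def h_def norm_mult indicator_def)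
  \<comment> \<open>The half-line is closed for one triangle and open for the other, as the diagonal
    belongs to only one of them; the integrals agree because the sets differ in a point.\<close>
  have inner: "(LINT r|M. indicat_real S r *\<^sub>R k r) = integral {0..s} k"
    if k: "integrable M k" and s: "s \<in> {0..x}" and S: "S = {..s} \<or> S = {..<s}" for k :: "real \<Rightarrow> complex" and s S
  proof -
    have [measurable]: "S \<in> sets borel" using S by auto
    have "integrable M (\<lambda>r. indicat_real S r *\<^sub>R k r)"
    proof (rule Bochner_Integration.integrable_bound[OF k])
      show "(\<lambda>r. indicat_real S r *\<^sub>R k r) \<in> borel_measurable M"
        using borel_measurable_integrable[OF k] idm
        by (intro borel_measurable_scaleR borel_measurable_indicator') (auto simp: measurable_sets[OF idm])
    qed (auto simp: indicator_def)
    then have "(LINT r|M. indicat_real S r *\<^sub>R k r) = integral {0..x} (\<lambda>r. indicat_real S r *\<^sub>R k r)"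
      unfolding M_def by (intro lebesgue_integral_eq_integral) auto
    also have "\<dots> = integral {0..x} (\<lambda>r. if r \<in> {0..s} then k r else 0)"
      by (rule integral_spike[of "{s}"]) (use S in \<open>auto simp: indicator_def\<close>)
    also have "\<dots> = integral ({0..s} \<inter> {0..x}) k" by (rule Henstock_Kurzweil_Integration.integral_restrict_Int)
    also have "{0..s} \<inter> {0..x} = {0..s}" using s by auto
    finally show ?thesis .
  qed
  have e1: "(LINT r|M. h1 (s, r)) = f s * integral {0..s} g" if "s \<in> {0..x}" for s
    unfolding h1_def prod.case by (simp only: integral_mult_right_zero inner[OF gM that disjI1[OF refl]])
  have e2: "(LINT s|M. h2 (s, r)) = integral {0..r} f * g r" if "r \<in> {0..x}" for r
    unfolding h2_def prod.case by (simp only: integral_mult_left_zero inner[OF fM that disjI2[OF refl]])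
  have i1: "integrable M (\<lambda>s. f s * integral {0..s} g)"
  proof -
    have "integrable M (\<lambda>s. LINT r|M. h1 (s, r))" using P.integrable_fst'[OF h1] .
    then show ?thesis by (rule Bochner_Integration.integrable_cong[THEN iffD1, rotated -1]) (simp_all add: space e1)
  qed
  have i2: "integrable M (\<lambda>s. integral {0..s} f * g s)"
  proof -
    have "integrable M (\<lambda>r. LINT s|M. h2 (s, r))"
      using P.integrable_snd[of "\<lambda>s r. h2 (s, r)"] h2 by simp
    then show ?thesis by (rule Bochner_Integration.integrable_cong[THEN iffD1, rotated -1]) (simp_all add: space e2)
  qed
  from i1 i2 show int: "integrable (lebesgue_on {0..x}) (\<lambda>s. f s * integral {0..s} g + integral {0..s} f * g s)"
    unfolding M_def by (rule Bochner_Integration.integrable_add)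
  have "integral\<^sup>L M f * integral\<^sup>L M g = (LINT s|M. (LINT r|M. h (s, r)))"
    by (simp add: h_def)
  also have "\<dots> = (LINT p|(M \<Otimes>\<^sub>M M). h p)" using P.integral_fst'[OF hint] by simp
  also have "\<dots> = (LINT p|(M \<Otimes>\<^sub>M M). h1 p + h2 p)"
    by (rule Bochner_Integration.integral_cong) (auto simp: h_def h1_def h2_def indicator_def)
  also have "\<dots> = (LINT p|(M \<Otimes>\<^sub>M M). h1 p) + (LINT p|(M \<Otimes>\<^sub>M M). h2 p)"
    using h1 h2 by (rule Bochner_Integration.integral_add)
  also have "(LINT p|(M \<Otimes>\<^sub>M M). h1 p) = (LINT s|M. (LINT r|M. h1 (s, r)))"
    using P.integral_fst'[OF h1] by simp
  also have "\<dots> = (LINT s|M. f s * integral {0..s} g)"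
    by (rule Bochner_Integration.integral_cong) (auto simp: space e1)
  also have "(LINT p|(M \<Otimes>\<^sub>M M). h2 p) = (LINT r|M. (LINT s|M. h2 (s, r)))"
    using P.integral_snd[of "\<lambda>s r. h2 (s, r)"] h2 by simp
  also have "\<dots> = (LINT r|M. integral {0..r} f * g r)"
    by (rule Bochner_Integration.integral_cong) (auto simp: space e2)
  also have "(LINT s|M. f s * integral {0..s} g) + (LINT r|M. integral {0..r} f * g r) =
      (LINT s|M. f s * integral {0..s} g + integral {0..s} f * g s)"
    using i1 i2 by simp
  finally show "integral {0..x} f * integral {0..x} g =
    integral {0..x} (\<lambda>s. f s * integral {0..s} g + integral {0..s} f * g s)"
    using f g int unfolding M_def by (simp add: lebesgue_integral_eq_integral)
qed

text \<open>H^1 on the level of functions: f is the continuous representative and g some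
  representative of the weak derivative. Calculus is done with such pairs and then carried over to
  the classes in \<open>l2\<close>.\<close>

definition AC :: "(real \<Rightarrow> complex) \<Rightarrow> (real \<Rightarrow> complex) \<Rightarrow> bool" where
  "AC f g \<longleftrightarrow> sq_integrable g \<and> (\<forall>x\<in>{0..1}. f x = f 0 + integral {0..x} g)"

lemma AC_sq: "AC f g \<Longrightarrow> sq_integrable g"
  unfolding AC_def by blast

lemma AC_eq: "AC f g \<Longrightarrow> x \<in> {0..1} \<Longrightarrow> f x = f 0 + integral {0..x} g"
  unfolding AC_def by blast

lemma AC_continuous: "AC f g \<Longrightarrow> continuous_on {0..1} f"
  by (rule continuous_indefinite[of g f "f 0"]) (rule AC_sq, assumption, rule AC_eq)

lemma sq_integrable_cong:
  assumes "sq_integrable f" "\<And>x. x \<in> {0..1} \<Longrightarrow> f x = g x"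
  shows "sq_integrable g"
proof -
  have "f \<in> borel_measurable (lebesgue_on {0..1}) \<longleftrightarrow> g \<in> borel_measurable (lebesgue_on {0..1})"
    by (rule measurable_cong) (use assms(2) in auto)
  moreover have "integrable (lebesgue_on {0..1}) (\<lambda>x. (norm (f x))\<^sup>2) \<longleftrightarrow> integrable (lebesgue_on {0..1}) (\<lambda>x. (norm (g x))\<^sup>2)"
    by (rule Bochner_Integration.integrable_cong) (use assms(2) in auto)
  ultimately show ?thesis using assms(1) by (simp add: sq_integrable_def)
qed

lemma sq_integrable_mult_continuous:
  assumes "sq_integrable f" "continuous_on {0..1} g"
  shows "sq_integrable (\<lambda>x. g x * f x)"
proof -
  obtain B where "\<And>x. x \<in> {0..1} \<Longrightarrow> norm (g x) \<le> B"
    using continuous_on_unit_interval_bounded[OF assms(2)] by blast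
  then show ?thesis
    using assms by (intro sq_integrable_mult_bounded[of f g B]) (auto intro: continuous_imp_measurable_on_sets_lebesgue)
qed

lemma AC_cong:
  assumes "AC f g" "\<And>x. x \<in> {0..1} \<Longrightarrow> f x = f' x" "\<And>x. x \<in> {0..1} \<Longrightarrow> g x = g' x"
  shows "AC f' g'"
  unfolding AC_def
proof (intro conjI ballI)
  show "sq_integrable g'" using AC_sq[OF assms(1)] assms(3) by (rule sq_integrable_cong)
  fix x :: real assume x: "x \<in> {0..1}"
  have "integral {0..x} g = integral {0..x} g'"
    by (rule Henstock_Kurzweil_Integration.integral_cong) (use assms(3) x in auto)
  then show "f' x = f' 0 + integral {0..x} g'" using AC_eq[OF assms(1) x] assms(2)[OF x] assms(2)[of 0] by simp
qed

lemma AC_add: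
  assumes "AC f g" "AC f' g'"
  shows "AC (\<lambda>x. f x + f' x) (\<lambda>x. g x + g' x)"
  unfolding AC_def
proof (intro conjI ballI)
  show "sq_integrable (\<lambda>x. g x + g' x)" using assms[THEN AC_sq] by (rule sq_integrable_add)
  fix x :: real assume x: "x \<in> {0..1}"
  have "integral {0..x} (\<lambda>x. g x + g' x) = integral {0..x} g + integral {0..x} g'"
    using x by (intro integral_add sq_integrable_integrable_on assms[THEN AC_sq]) auto
  then show "f x + f' x = f 0 + f' 0 + integral {0..x} (\<lambda>x. g x + g' x)"
    using AC_eq[OF assms(1) x] AC_eq[OF assms(2) x] by simp
qed

lemma AC_primitive: "sq_integrable g \<Longrightarrow> AC (\<lambda>x. c + integral {0..x} g) g"
  by (simp add: AC_def)

lemma integrable_sub: "sq_integrable f \<Longrightarrow> x \<in> {0..1} \<Longrightarrow> integrable (lebesgue_on {0..x}) f"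
  by (rule integrable_subinterval[OF sq_integrable_integrable]) auto

text \<open>Once both factors are written as initial value plus integral, the only term beyond
  linearity is the product of the two integrals, given by
  \<open>integral_product_by_parts\<close>.\<close>

lemma AC_mult:
  assumes f: "AC f g" and f': "AC f' g'"
  shows "AC (\<lambda>x. f x * f' x) (\<lambda>x. g x * f' x + f x * g' x)"
  unfolding AC_def
proof (intro conjI ballI)
  note sq = f[THEN AC_sq] f'[THEN AC_sq]
  note sq_integrable_mult_continuous[OF sq(1) AC_continuous[OF f']] sq_integrable_mult_continuous[OF sq(2) AC_continuous[OF f]]
  from sq_integrable_add[OF this] show "sq_integrable (\<lambda>x. g x * f' x + f x * g' x)"
    by (simp add: mult.commute)
  fix x :: real assume x: "x \<in> {0..1}"
  have ig: "g integrable_on {0..x}" "g' integrable_on {0..x}"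
    using x by (auto intro!: sq_integrable_integrable_on sq)
  note ip = integral_product_by_parts[OF integrable_sub[OF sq(1) x] integrable_sub[OF sq(2) x]]
  define k where "k = (\<lambda>s. g s * integral {0..s} g' + integral {0..s} g * g' s)"
  have k: "k integrable_on {0..x}"
    using ip(2) unfolding k_def by (rule integrable_on_lebesgue_on) auto
  have "integral {0..x} (\<lambda>s. g s * f' s + f s * g' s) = integral {0..x} (\<lambda>s. (f' 0 * g s + f 0 * g' s) + k s)"
  proof (rule Henstock_Kurzweil_Integration.integral_cong)
    fix s assume "s \<in> {0..x}"
    then have s: "s \<in> {0..1}" using x by auto
    show "g s * f' s + f s * g' s = f' 0 * g s + f 0 * g' s + k s"
      unfolding AC_eq[OF f s] AC_eq[OF f' s] k_def by (simp add: algebra_simps)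
  qed
  also have "\<dots> = f' 0 * integral {0..x} g + f 0 * integral {0..x} g' + integral {0..x} k"
    using ig k by (simp add: integral_add integrable_add integrable_on_mult_right)
  also have "integral {0..x} k = integral {0..x} g * integral {0..x} g'"
    using ip(1) by (simp add: k_def)
  finally show "f x * f' x = f 0 * f' 0 + integral {0..x} (\<lambda>s. g s * f' s + f s * g' s)"
    unfolding AC_eq[OF f x] AC_eq[OF f' x] by (simp add: algebra_simps)
qed

lemma sq_integrable_cnj:
  assumes "sq_integrable g"
  shows "sq_integrable (\<lambda>x. cnj (g x))"
proof -
  have "cnj \<in> borel_measurable borel"
    by (intro borel_measurable_continuous_onI continuous_intros)
  then show ?thesis
    using assms measurable_compose[of g "lebesgue_on {0..1}" borel cnj borel] by (simp add: sq_integrable_def)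
qed

lemma AC_cnj:
  assumes "AC f g"
  shows "AC (\<lambda>x. cnj (f x)) (\<lambda>x. cnj (g x))"
  unfolding AC_def
proof (intro conjI ballI)
  show "sq_integrable (\<lambda>x. cnj (g x))" by (rule sq_integrable_cnj[OF AC_sq[OF assms]])
  fix x :: real assume x: "x \<in> {0..1}"
  have "g integrable_on {0..x}" using x by (auto intro!: sq_integrable_integrable_on AC_sq[OF assms])
  then have "((\<lambda>x. cnj (g x)) has_integral cnj (integral {0..x} g)) {0..x}"
    using has_integral_linear[OF integrable_integral bounded_linear_cnj] by (simp add: o_def)
  then have "integral {0..x} (\<lambda>x. cnj (g x)) = cnj (integral {0..x} g)" by (rule integral_unique)
  then show "cnj (f x) = cnj (f 0) + integral {0..x} (\<lambda>x. cnj (g x))"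
    using AC_eq[OF assms x] by simp
qed

lemma AC_C1:
  assumes "\<And>x. x \<in> {0..1} \<Longrightarrow> (f has_real_derivative f' x) (at x within {0..1})" "continuous_on {0..1} f'"
  shows "AC (\<lambda>x. of_real (f x)) (\<lambda>x. of_real (f' x))"
  unfolding AC_def
proof (intro conjI ballI)
  have c: "continuous_on {0..1} (\<lambda>x. complex_of_real (f' x))" by (intro continuous_intros assms(2))
  then show "sq_integrable (\<lambda>x. complex_of_real (f' x))" by (rule sq_integrable_continuous)
  fix x :: real assume x: "x \<in> {0..1}"
  have "((\<lambda>x. complex_of_real (f' x)) has_integral of_real (f x) - of_real (f 0)) {0..x}"
  proof (rule fundamental_theorem_of_calculus)
    fix y assume y: "y \<in> {0..x}"
    then have "(f has_vector_derivative f' y) (at y within {0..x})"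
      using assms(1)[of y] x by (auto simp: has_real_derivative_iff_has_vector_derivative intro: has_vector_derivative_within_subset)
    from bounded_linear.has_vector_derivative[OF bounded_linear_of_real this]
    show "((\<lambda>x. complex_of_real (f x)) has_vector_derivative complex_of_real (f' y)) (at y within {0..x})" by simp
  qed (use x in auto)
  then show "complex_of_real (f x) = of_real (f 0) + integral {0..x} (\<lambda>x. of_real (f' x))"
    by (simp add: integral_unique)
qed

lemma AC_integral: "AC f g \<Longrightarrow> integral {0..1} g = f 1 - f 0"
  using AC_eq[of f g 1] by simp

lemma AC_has_weak_deriv:
  assumes "AC f g"
  shows "has_weak_deriv (abs_l2 f) (abs_l2 g)"
  unfolding has_weak_deriv_def
proof (intro exI[of _ f] conjI ballI refl)
  show "f x = f 0 + integral {0..x} (rep_l2 (abs_l2 g))" if "x \<in> {0..1}" for x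
    using AC_eq[OF assms that] unfolding integral_rep_l2[OF AC_sq[OF assms] that] .
qed

lemma has_weak_deriv_AC:
  assumes "has_weak_deriv w z"
  obtains f where "w = abs_l2 f" "AC f (rep_l2 z)"
  using assms sq_integrable_rep_l2 unfolding has_weak_deriv_def AC_def by blast

lemma inner_abs_l2:
  assumes "sq_integrable f" "sq_integrable g"
  shows "inner (abs_l2 f) (abs_l2 g) = Re (integral {0..1} (\<lambda>x. f x * cnj (g x)))"
proof -
  have "inner (abs_l2 f) (abs_l2 g) = Re (LINT x|lebesgue_on {0..1}. f x * cnj (g x))"
    using assms by (subst inner_l2.abs_eq) auto
  then show ?thesis
    using lebesgue_integral_eq_integral[OF integrable_mult_cnj[OF assms]] by simp
qed

lemma norm_abs_l2_sq:
  assumes "continuous_on {0..1} f"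
  shows "(norm (abs_l2 f))\<^sup>2 = integral {0..1} (\<lambda>x. (norm (f x))\<^sup>2)"
proof -
  have "(norm (abs_l2 f))\<^sup>2 = Re (integral {0..1} (\<lambda>x. f x * cnj (f x)))"
    using inner_abs_l2[of f f] sq_integrable_continuous[OF assms] by (simp add: power2_norm_eq_inner)
  also have "\<dots> = Re (integral {0..1} (\<lambda>x. of_real ((norm (f x))\<^sup>2)))"
    by (simp only: complex_norm_square)
  also have "\<dots> = integral {0..1} (\<lambda>x. (norm (f x))\<^sup>2)"
  proof -
    have "(\<lambda>x. (norm (f x))\<^sup>2) integrable_on {0..1}"
      by (intro integrable_continuous_real continuous_intros assms)
    then have "((\<lambda>x. complex_of_real ((norm (f x))\<^sup>2)) has_integral of_real (integral {0..1} (\<lambda>x. (norm (f x))\<^sup>2))) {0..1}"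
      using has_integral_linear[OF integrable_integral bounded_linear_of_real] by (simp add: o_def del: of_real_power)
    from integral_unique[OF this] show ?thesis by (simp only: Re_complex_of_real)
  qed
  finally show ?thesis .
qed

lemma norm_abs_l2_le:
  assumes "continuous_on {0..1} f" "\<And>x. x \<in> {0..1} \<Longrightarrow> norm (f x) \<le> K"
  shows "norm (abs_l2 f) \<le> K"
proof -
  have K: "0 \<le> K" using order_trans[OF norm_ge_zero assms(2)[of 0]] by simp
  have "integral {0..1} (\<lambda>x. (norm (f x))\<^sup>2) \<le> integral {0..1} (\<lambda>x::real. K\<^sup>2)"
    by (intro integral_le integrable_continuous_real continuous_intros assms(1)) (auto intro!: power_mono assms(2))
  then have "(norm (abs_l2 f))\<^sup>2 \<le> K\<^sup>2" using norm_abs_l2_sq[OF assms(1)] by simp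
  then show ?thesis using K by (rule power2_le_imp_le)
qed

text \<open>Cauchy-Schwarz in the form |w| \<le> t / 2 + |w|^2 / (2 t), integrated over [0, 1]. The
  optimal t is the norm of w; adding e keeps t positive.\<close>

lemma norm_integral_rep_l2_le:
  assumes x: "x \<in> {0..1}"
  shows "norm (integral {0..x} (rep_l2 w)) \<le> norm w"
proof (rule field_le_epsilon)
  fix e :: real assume e: "e > 0"
  define t where "t = norm w + e"
  have t: "t > 0" using e by (simp add: t_def add_nonneg_pos)
  have i2: "integrable (lebesgue_on {0..1}) (\<lambda>s. (norm (rep_l2 w s))\<^sup>2)"
    using sq_integrable_rep_l2[of w] by (simp add: sq_integrable_def)
  then have h2: "((\<lambda>s. (norm (rep_l2 w s))\<^sup>2) has_integral (norm w)\<^sup>2) {0..1}"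
    using has_integral_integral_lebesgue_on[OF i2] by (simp add: norm_l2_sq)
  then have "((\<lambda>s. t / 2 + inverse (2 * t) * (norm (rep_l2 w s))\<^sup>2) has_integral t / 2 + inverse (2 * t) * (norm w)\<^sup>2) {0..1}"
    using has_integral_const_real[of "t / 2" 0 1] by (intro has_integral_add has_integral_mult_right) auto
  note hi = this
  have "norm (integral {0..x} (rep_l2 w)) \<le> integral {0..x} (\<lambda>s. t / 2 + inverse (2 * t) * (norm (rep_l2 w s))\<^sup>2)"
  proof (rule integral_norm_bound_integral)
    show "rep_l2 w integrable_on {0..x}" using x by (intro sq_integrable_integrable_on) auto
    show "(\<lambda>s. t / 2 + inverse (2 * t) * (norm (rep_l2 w s))\<^sup>2) integrable_on {0..x}"
      by (rule integrable_on_subinterval[OF has_integral_integrable[OF hi]]) (use x in auto)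
    fix s
    have "0 \<le> (t - norm (rep_l2 w s))\<^sup>2 / (2 * t)" using t by simp
    also have "\<dots> = t / 2 + inverse (2 * t) * (norm (rep_l2 w s))\<^sup>2 - norm (rep_l2 w s)"
      using t by (simp add: power2_eq_square field_simps)
    finally show "norm (rep_l2 w s) \<le> t / 2 + inverse (2 * t) * (norm (rep_l2 w s))\<^sup>2" by simp
  qed
  also have "\<dots> \<le> integral {0..1} (\<lambda>s. t / 2 + inverse (2 * t) * (norm (rep_l2 w s))\<^sup>2)"
  proof (rule integral_subset_le)
    show "(\<lambda>s. t / 2 + inverse (2 * t) * (norm (rep_l2 w s))\<^sup>2) integrable_on {0..x}"
      by (rule integrable_on_subinterval[OF has_integral_integrable[OF hi]]) (use x in auto)
  qed (use x t hi in auto)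
  also have "\<dots> = t / 2 + inverse (2 * t) * (norm w)\<^sup>2" using hi by (rule integral_unique)
  also have "\<dots> \<le> t / 2 + inverse (2 * t) * t\<^sup>2"
    using t e by (intro add_left_mono mult_left_mono power_mono) (auto simp: t_def)
  also have "\<dots> = t" using t by (simp add: power2_eq_square field_simps)
  also have "t = norm w + e" by (simp add: t_def)
  finally show "norm (integral {0..x} (rep_l2 w)) \<le> norm w + e" .
qed

section \<open>Families of continuous functions depending linearly on a parameter\<close>

text \<open>A bounded real-linear map into C([0,1]) with the supremum norm, stated pointwise so that
  values outside [0, 1] do not matter. \<open>shear\<close>, \<open>moment\<close> and the
  components of \<open>R\<close> are assembled from such families, so that their boundedness needs
  no explicit constants.\<close>

definition linear_family :: "('a::real_normed_vector \<Rightarrow> real \<Rightarrow> complex) \<Rightarrow> bool" where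
  "linear_family F \<longleftrightarrow> (\<forall>x. continuous_on {0..1} (F x)) \<and> (\<forall>s\<in>{0..1}. linear (\<lambda>x. F x s)) \<and>
     (\<exists>K. \<forall>x. \<forall>s\<in>{0..1}. norm (F x s) \<le> norm x * K)"

lemma linear_family_continuous: "linear_family F \<Longrightarrow> continuous_on {0..1} (F x)"
  by (simp add: linear_family_def)

lemma linear_family_eval:
  assumes "linear_family F" "s \<in> {0..1}"
  shows "bounded_linear (\<lambda>x. F x s)"
  using assms unfolding linear_family_def bounded_linear_def bounded_linear_axioms_def by blast

lemma linear_family_bound:
  assumes "linear_family F"
  obtains K where "K > 0" "\<And>x s. s \<in> {0..1} \<Longrightarrow> norm (F x s) \<le> K * norm x"
proof -
  obtain K where K: "\<And>x s. s \<in> {0..1} \<Longrightarrow> norm (F x s) \<le> norm x * K"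
    using assms unfolding linear_family_def by blast
  have "norm (F x s) \<le> (\<bar>K\<bar> + 1) * norm x" if "s \<in> {0..1}" for x s
  proof -
    have "norm x * K \<le> norm x * (\<bar>K\<bar> + 1)" by (intro mult_left_mono) auto
    then show ?thesis using K[OF that, of x] by (simp add: mult.commute)
  qed
  then show thesis by (intro that[of "\<bar>K\<bar> + 1"]) auto
qed

lemma linear_familyI:
  assumes "\<And>x. continuous_on {0..1} (F x)" "\<And>s. s \<in> {0..1} \<Longrightarrow> linear (\<lambda>x. F x s)"
    "\<And>x s. s \<in> {0..1} \<Longrightarrow> norm (F x s) \<le> K * norm x"
  shows "linear_family F"
  unfolding linear_family_def using assms by (auto simp: mult.commute intro!: exI[of _ K])

lemma linear_family_const:
  assumes "bounded_linear f"
  shows "linear_family (\<lambda>x s. f x)"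
proof -
  interpret bounded_linear f by fact
  obtain K where "\<And>x. norm (f x) \<le> norm x * K" using bounded by auto
  then show ?thesis
    by (intro linear_familyI[of _ K]) (auto simp: mult.commute linear_axioms)
qed

lemma linear_family_add:
  assumes F: "linear_family F" and G: "linear_family G"
  shows "linear_family (\<lambda>x s. F x s + G x s)"
proof -
  obtain K where "K > 0" and K: "\<And>x s. s \<in> {0..1} \<Longrightarrow> norm (F x s) \<le> K * norm x" using linear_family_bound[OF F] by blast
  obtain L where "L > 0" and L: "\<And>x s. s \<in> {0..1} \<Longrightarrow> norm (G x s) \<le> L * norm x" using linear_family_bound[OF G] by blast
  show ?thesis
  proof (rule linear_familyI[of _ "K + L"])
    show "continuous_on {0..1} (\<lambda>s. F x s + G x s)" for x
      by (intro continuous_intros linear_family_continuous F G)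
    show "linear (\<lambda>x. F x s + G x s)" if "s \<in> {0..1}" for s
      using linear_family_eval[OF F that] linear_family_eval[OF G that]
      by (intro linear_compose_add bounded_linear.linear)
    show "norm (F x s + G x s) \<le> (K + L) * norm x" if "s \<in> {0..1}" for x s
      using K[OF that, of x] L[OF that, of x] norm_triangle_ineq[of "F x s" "G x s"] by (simp add: distrib_right)
  qed
qed

lemma linear_family_mult:
  assumes c: "continuous_on {0..1} c" and F: "linear_family F"
  shows "linear_family (\<lambda>x s. c s * F x s)"
proof -
  obtain B where B: "\<And>x. x \<in> {0..1} \<Longrightarrow> norm (c x) \<le> B"
    using continuous_on_unit_interval_bounded[OF c] by blast
  obtain K where K: "K > 0" "\<And>x s. s \<in> {0..1} \<Longrightarrow> norm (F x s) \<le> K * norm x" using linear_family_bound[OF F] by blast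
  show ?thesis
  proof (rule linear_familyI[of _ "B * K"])
    show "continuous_on {0..1} (\<lambda>s. c s * F x s)" for x
      by (intro continuous_intros linear_family_continuous F c)
    show "linear (\<lambda>x. c s * F x s)" if "s \<in> {0..1}" for s
      using linear_family_eval[OF F that]
      by (intro bounded_linear.linear bounded_linear_const_mult)
    show "norm (c s * F x s) \<le> B * K * norm x" if "s \<in> {0..1}" for x s
      using mult_mono[OF B[OF that] K(2)[OF that, of x]] order_trans[OF norm_ge_zero B[OF that]]
      by (simp add: norm_mult mult.assoc)
  qed
qed

lemma linear_family_compose:
  assumes F: "linear_family F" and g: "bounded_linear g"
  shows "linear_family (\<lambda>x. F (g x))"
proof -
  obtain K where K: "K > 0" "\<And>x s. s \<in> {0..1} \<Longrightarrow> norm (F x s) \<le> K * norm x" using linear_family_bound[OF F] by blast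
  obtain L where L: "\<And>x. norm (g x) \<le> norm x * L" using bounded_linear.bounded[OF g] by auto
  show ?thesis
  proof (rule linear_familyI[of _ "K * L"])
    show "continuous_on {0..1} (F (g x))" for x by (rule linear_family_continuous[OF F])
    show "linear (\<lambda>x. F (g x) s)" if "s \<in> {0..1}" for s
      using bounded_linear_compose[OF linear_family_eval[OF F that] g] by (rule bounded_linear.linear)
    show "norm (F (g x) s) \<le> K * L * norm x" if "s \<in> {0..1}" for x s
      using order_trans[OF K(2)[OF that, of "g x"] mult_left_mono[OF L[of x], of K]] K(1) by (simp add: mult_ac)
  qed
qed

lemma linear_family_integral:
  assumes F: "linear_family F"
  shows "linear_family (\<lambda>x s. integral {0..s} (F x))"
proof -
  obtain K where K: "K > 0" "\<And>x s. s \<in> {0..1} \<Longrightarrow> norm (F x s) \<le> K * norm x" using linear_family_bound[OF F] by blast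
  have int: "F x integrable_on {0..s}" if "s \<in> {0..1}" for x s
    by (intro integrable_continuous_real continuous_on_subset[OF linear_family_continuous[OF F]]) (use that in auto)
  have lin: "linear (\<lambda>x. F x s)" if "s \<in> {0..1}" for s
    using linear_family_eval[OF F that] by (rule bounded_linear.linear)
  show ?thesis
  proof (rule linear_familyI[of _ K])
    show "continuous_on {0..1} (\<lambda>s. integral {0..s} (F x))" for x
      using int[of 1] by (intro indefinite_integral_continuous_1) auto
    show "linear (\<lambda>x. integral {0..s} (F x))" if s: "s \<in> {0..1}" for s
    proof (rule linearI)
      fix x y r
      have "integral {0..s} (F (x + y)) = integral {0..s} (\<lambda>r. F x r + F y r)"
        by (rule Henstock_Kurzweil_Integration.integral_cong) (use s lin in \<open>auto intro!: linear_add\<close>)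
      then show "integral {0..s} (F (x + y)) = integral {0..s} (F x) + integral {0..s} (F y)"
        using integral_add[OF int[OF s] int[OF s]] by simp
      have "integral {0..s} (F (r *\<^sub>R x)) = integral {0..s} (\<lambda>q. r *\<^sub>R F x q)"
        by (rule Henstock_Kurzweil_Integration.integral_cong) (use s lin in \<open>auto intro!: linear_scale\<close>)
      then show "integral {0..s} (F (r *\<^sub>R x)) = r *\<^sub>R integral {0..s} (F x)" by simp
    qed
    show "norm (integral {0..s} (F x)) \<le> K * norm x" if s: "s \<in> {0..1}" for x s
    proof -
      have "norm (integral {0..s} (F x)) \<le> (K * norm x) * (s - 0)"
        by (rule integral_bound) (use s K in \<open>auto intro!: continuous_on_subset[OF linear_family_continuous[OF F]]\<close>)
      also have "\<dots> \<le> (K * norm x) * 1" using s K(1) by (intro mult_left_mono) auto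
      finally show ?thesis by simp
    qed
  qed
qed

lemma integral_rep_l2_add:
  assumes "x \<in> {0..1}"
  shows "integral {0..x} (rep_l2 (v + w)) = integral {0..x} (rep_l2 v) + integral {0..x} (rep_l2 w)"
proof -
  have "v + w = abs_l2 (\<lambda>x. rep_l2 v x + rep_l2 w x)" by (simp add: abs_l2_add)
  then have "integral {0..x} (rep_l2 (v + w)) = integral {0..x} (\<lambda>x. rep_l2 v x + rep_l2 w x)"
    using integral_rep_l2[of "\<lambda>x. rep_l2 v x + rep_l2 w x" x] assms by (simp add: sq_integrable_add)
  then show ?thesis using assms by (simp add: integral_add sq_integrable_integrable_on)
qed

lemma integral_rep_l2_scaleR:
  assumes "x \<in> {0..1}"
  shows "integral {0..x} (rep_l2 (r *\<^sub>R v)) = r *\<^sub>R integral {0..x} (rep_l2 v)"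
proof -
  have "r *\<^sub>R v = abs_l2 (\<lambda>x. r *\<^sub>R rep_l2 v x)" by (simp add: abs_l2_scaleR)
  moreover have "sq_integrable (\<lambda>x. r *\<^sub>R rep_l2 v x)"
    using sq_integrable_cmult[of "rep_l2 v" "of_real r"] by (simp add: scaleR_conv_of_real)
  ultimately have "integral {0..x} (rep_l2 (r *\<^sub>R v)) = integral {0..x} (\<lambda>x. r *\<^sub>R rep_l2 v x)"
    using integral_rep_l2[of "\<lambda>x. r *\<^sub>R rep_l2 v x" x] assms by simp
  then show ?thesis by simp
qed

lemma linear_family_primitive: "linear_family (\<lambda>w s. integral {0..s} (rep_l2 w))"
proof (rule linear_familyI[of _ 1])
  show "continuous_on {0..1} (\<lambda>s. integral {0..s} (rep_l2 w))" for w
    by (intro indefinite_integral_continuous_1 sq_integrable_integrable_on) auto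
  show "linear (\<lambda>w. integral {0..s} (rep_l2 w))" if "s \<in> {0..1}" for s
    by (rule linearI) (simp_all add: integral_rep_l2_add[OF that] integral_rep_l2_scaleR[OF that])
  show "norm (integral {0..s} (rep_l2 w)) \<le> 1 * norm w" if "s \<in> {0..1}" for w s
    using norm_integral_rep_l2_le[OF that] by simp
qed

lemma bounded_linear_abs_l2:
  assumes F: "linear_family F"
  shows "bounded_linear (\<lambda>x. abs_l2 (F x))"
proof -
  obtain K where K: "K > 0" "\<And>x s. s \<in> {0..1} \<Longrightarrow> norm (F x s) \<le> K * norm x" using linear_family_bound[OF F] by blast
  have sq: "sq_integrable (F x)" for x by (rule sq_integrable_continuous[OF linear_family_continuous[OF F]])
  have lin: "linear (\<lambda>x. F x s)" if "s \<in> {0..1}" for s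
    using linear_family_eval[OF F that] by (rule bounded_linear.linear)
  have scale: "F (r *\<^sub>R x) s = of_real r * F x s" if "s \<in> {0..1}" for r x s
    using linear_scale[OF lin[OF that], of r x] by (simp add: scaleR_conv_of_real)
  have eq: "abs_l2 f = abs_l2 g" if "sq_integrable f" "sq_integrable g" "\<And>s. s \<in> {0..1} \<Longrightarrow> f s = g s" for f g
    using that by (intro abs_l2_eqI AE_I2) auto
  show ?thesis
  proof (rule bounded_linear_intro[of _ K])
    show "abs_l2 (F (x + y)) = abs_l2 (F x) + abs_l2 (F y)" for x y
      unfolding abs_l2_add[OF sq sq, symmetric]
      by (intro eq sq sq_integrable_add) (use lin in \<open>auto intro!: linear_add\<close>)
    show "abs_l2 (F (r *\<^sub>R x)) = r *\<^sub>R abs_l2 (F x)" for r x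
      unfolding abs_l2_scaleR[OF sq, symmetric]
      using sq_integrable_cmult[OF sq, of "of_real r" x]
      by (intro eq sq) (auto simp: scale scaleR_conv_of_real)
    show "norm (abs_l2 (F x)) \<le> norm x * K" for x
      using K(2) by (intro norm_abs_l2_le linear_family_continuous[OF F]) (simp add: mult.commute)
  qed
qed

lemma l2_mult_abs:
  assumes "sq_integrable f" "continuous_on {0..1} g"
  shows "l2_mult g (abs_l2 f) = abs_l2 (\<lambda>x. g x * f x)"
  unfolding l2_mult_def
proof (rule abs_l2_eqI)
  show "sq_integrable (\<lambda>x. g x * rep_l2 (abs_l2 f) x)" by (intro sq_integrable_mult_continuous assms) simp
  show "sq_integrable (\<lambda>x. g x * f x)" by (intro sq_integrable_mult_continuous assms)
  show "AE x in lebesgue_on {0..1}. g x * rep_l2 (abs_l2 f) x = g x * f x"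
    using rep_abs_l2[OF assms(1)] by eventually_elim simp
qed

lemma bounded_linear_l2_mult:
  assumes g: "continuous_on {0..1} g"
  shows "bounded_linear (l2_mult g)"
proof -
  obtain B where B: "\<And>x. x \<in> {0..1} \<Longrightarrow> norm (g x) \<le> B"
    using continuous_on_unit_interval_bounded[OF g] by blast
  have B0: "0 \<le> B" using order_trans[OF norm_ge_zero B[of 0]] by simp
  have sq: "sq_integrable (\<lambda>x. g x * rep_l2 w x)" for w by (intro sq_integrable_mult_continuous g) simp
  show ?thesis
  proof (rule bounded_linear_intro[of _ B])
    fix v w :: l2 and r :: real
    have "l2_mult g (abs_l2 (\<lambda>x. rep_l2 v x + rep_l2 w x)) = abs_l2 (\<lambda>x. g x * rep_l2 v x + g x * rep_l2 w x)"
      by (subst l2_mult_abs[OF _ g]) (auto simp: sq_integrable_add distrib_left)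
    then show "l2_mult g (v + w) = l2_mult g v + l2_mult g w"
      using abs_l2_add[of "rep_l2 v" "rep_l2 w"] abs_l2_add[OF sq sq, of v w] by (simp add: l2_mult_def)
    have "sq_integrable (\<lambda>x. r *\<^sub>R rep_l2 v x)"
      using sq_integrable_cmult[of "rep_l2 v" "of_real r"] by (simp add: scaleR_conv_of_real)
    then have "l2_mult g (abs_l2 (\<lambda>x. r *\<^sub>R rep_l2 v x)) = abs_l2 (\<lambda>x. r *\<^sub>R (g x * rep_l2 v x))"
      by (subst l2_mult_abs[OF _ g]) auto
    then show "l2_mult g (r *\<^sub>R v) = r *\<^sub>R l2_mult g v"
      using abs_l2_scaleR[of "rep_l2 v" r] abs_l2_scaleR[OF sq, of r v] by (simp add: l2_mult_def)
    have "(norm (l2_mult g v))\<^sup>2 = Re (LINT x|lebesgue_on {0..1}. (g x * rep_l2 v x) * cnj (g x * rep_l2 v x))"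
      unfolding l2_mult_def power2_norm_eq_inner using sq by (subst inner_l2.abs_eq) auto
    also have "\<dots> = (LINT x|lebesgue_on {0..1}. (norm (g x * rep_l2 v x))\<^sup>2)"
      by (simp add: complex_norm_square[symmetric] del: of_real_power complex_cnj_mult)
    also have "\<dots> \<le> (LINT x|lebesgue_on {0..1}. B\<^sup>2 * (norm (rep_l2 v x))\<^sup>2)"
    proof (rule integral_mono)
      show "integrable (lebesgue_on {0..1}) (\<lambda>x. (norm (g x * rep_l2 v x))\<^sup>2)"
        using sq[of v] by (simp add: sq_integrable_def)
      show "integrable (lebesgue_on {0..1}) (\<lambda>x. B\<^sup>2 * (norm (rep_l2 v x))\<^sup>2)"
        using sq_integrable_rep_l2[of v] by (simp add: sq_integrable_def)
      show "(norm (g x * rep_l2 v x))\<^sup>2 \<le> B\<^sup>2 * (norm (rep_l2 v x))\<^sup>2" if "x \<in> space (lebesgue_on {0..1})" for x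
        unfolding norm_mult power_mult_distrib
        using that B[of x] by (intro mult_right_mono power_mono) auto
    qed
    also have "\<dots> = (norm v * B)\<^sup>2" by (simp add: norm_l2_sq power_mult_distrib mult.commute)
    finally show "norm (l2_mult g v) \<le> norm v * B"
      by (rule power2_le_imp_le) (use B0 in simp)
  qed
qed

section \<open>Continuous representatives of displacement and slope\<close>

text \<open>For u in \<open>hl2\<close>, \<open>hU1 u\<close> and \<open>hU0 u\<close> represent u'
  and u, with zero data at 0. As integrals they do not depend on the representative that
  \<open>rep_l2\<close> picks.\<close>

definition hU1 :: "hl2 \<Rightarrow> real \<Rightarrow> complex" where
  "hU1 u x = integral {0..x} (rep_l2 (deriv2 u))"

definition hU0 :: "hl2 \<Rightarrow> real \<Rightarrow> complex" where
  "hU0 u x = integral {0..x} (hU1 u)"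

lemma bounded_linear_deriv2: "bounded_linear deriv2"
  by (rule bounded_linear_intro[of _ 1]) (auto simp: deriv2_add deriv2_scaleR norm_hl2_def inner_hl2_def norm_eq_sqrt_inner)

lemma norm_deriv2: "norm (deriv2 u) = norm u"
  by (simp add: norm_hl2_def inner_hl2_def norm_eq_sqrt_inner)

lemma deriv2_inject: "deriv2 u = deriv2 v \<longleftrightarrow> u = v"
proof
  assume "deriv2 u = deriv2 v"
  then have "deriv2 (u - v) = 0"
    using bounded_linear.linear[OF bounded_linear_deriv2] by (simp add: linear_diff)
  then show "u = v" by (simp add: deriv2_eq_0_iff)
qed simp

lemma linear_family_hU1: "linear_family hU1"
  unfolding hU1_def by (rule linear_family_compose[OF linear_family_primitive bounded_linear_deriv2])

lemma linear_family_hU0: "linear_family hU0"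
  unfolding hU0_def by (rule linear_family_integral[OF linear_family_hU1])

lemma AC_hU1: "AC (hU1 u) (rep_l2 (deriv2 u))"
  unfolding hU1_def using AC_primitive[of "rep_l2 (deriv2 u)" 0] by simp

lemma AC_hU0: "AC (hU0 u) (hU1 u)"
  unfolding hU0_def using AC_primitive[OF sq_integrable_continuous[OF linear_family_continuous[OF linear_family_hU1]], of 0] by simp

lemma hU_0 [simp]: "hU1 u 0 = 0" "hU0 u 0 = 0"
  by (simp_all add: hU1_def hU0_def)

lemma norm_hU1_le: "x \<in> {0..1} \<Longrightarrow> norm (hU1 u x) \<le> norm u"
  using norm_integral_rep_l2_le[of x "deriv2 u"] by (simp add: hU1_def norm_deriv2)

lemma norm_hU0_le: "x \<in> {0..1} \<Longrightarrow> norm (hU0 u x) \<le> norm u"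
proof -
  assume x: "x \<in> {0..1}"
  have "norm (integral {0..x} (hU1 u)) \<le> norm u * (x - 0)"
    by (rule integral_bound) (use x norm_hU1_le in \<open>auto intro!: continuous_on_subset[OF linear_family_continuous[OF linear_family_hU1]]\<close>)
  also have "\<dots> \<le> norm u * 1" using x by (intro mult_left_mono) auto
  finally show ?thesis by (simp add: hU0_def)
qed

lemma HL2_functions:
  assumes "w \<in> HL2"
  obtains y where "weak_deriv (weak_deriv w) = y" "w = abs_l2 (\<lambda>x. integral {0..x} (\<lambda>s. integral {0..s} (rep_l2 y)))"
    "weak_deriv w = abs_l2 (\<lambda>s. integral {0..s} (rep_l2 y))"
proof -
  obtain z y where zy: "has_weak_deriv w z" "has_weak_deriv z y" "boundary_val w 0 = 0" "boundary_val z 0 = 0"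
    using assms by (auto simp: HL2_iff)
  obtain f where f: "w = abs_l2 f" "AC f (rep_l2 z)" using has_weak_deriv_AC[OF zy(1)] by blast
  obtain g where g: "z = abs_l2 g" "AC g (rep_l2 y)" using has_weak_deriv_AC[OF zy(2)] by blast
  have 0: "f 0 = 0" "g 0 = 0"
    using boundary_val_eq[OF AC_continuous[OF f(2)] f(1), of 0] boundary_val_eq[OF AC_continuous[OF g(2)] g(1), of 0] zy by auto
  have gc: "g s = integral {0..s} (rep_l2 y)" if "s \<in> {0..1}" for s using AC_eq[OF g(2) that] 0 by simp
  have fc: "f x = integral {0..x} (\<lambda>s. integral {0..s} (rep_l2 y))" if x: "x \<in> {0..1}" for x
  proof -
    have "f x = integral {0..x} g"
      using AC_eq[OF f(2) x] 0 integral_rep_l2[of g x] sq_integrable_continuous[OF AC_continuous[OF g(2)]] x by (simp add: g(1))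
    also have "\<dots> = integral {0..x} (\<lambda>s. integral {0..s} (rep_l2 y))"
      by (rule Henstock_Kurzweil_Integration.integral_cong) (use x gc in auto)
    finally show ?thesis .
  qed
  have eq: "abs_l2 h = abs_l2 k" if "sq_integrable h" "\<And>s. s \<in> {0..1} \<Longrightarrow> h s = k s" for h k
    using that sq_integrable_cong[OF that] by (intro abs_l2_eqI AE_I2) auto
  show thesis
  proof (rule that[of y])
    show "weak_deriv (weak_deriv w) = y" using weak_deriv_eq[OF zy(1)] weak_deriv_eq[OF zy(2)] by simp
    show "w = abs_l2 (\<lambda>x. integral {0..x} (\<lambda>s. integral {0..s} (rep_l2 y)))"
      unfolding f(1) by (rule eq) (use fc sq_integrable_continuous[OF AC_continuous[OF f(2)]] in auto)
    show "weak_deriv w = abs_l2 (\<lambda>s. integral {0..s} (rep_l2 y))"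
      unfolding weak_deriv_eq[OF zy(1)] g(1) by (rule eq) (use gc sq_integrable_continuous[OF AC_continuous[OF g(2)]] in auto)
  qed
qed

lemma l2_of_hl2_eq: "l2_of_hl2 u = abs_l2 (hU0 u)"
  and weak_deriv_l2_of_hl2: "weak_deriv (l2_of_hl2 u) = abs_l2 (hU1 u)"
proof -
  obtain y where y: "weak_deriv (weak_deriv (l2_of_hl2 u)) = y"
    "l2_of_hl2 u = abs_l2 (\<lambda>x. integral {0..x} (\<lambda>s. integral {0..s} (rep_l2 y)))"
    "weak_deriv (l2_of_hl2 u) = abs_l2 (\<lambda>s. integral {0..s} (rep_l2 y))"
    using HL2_functions[OF l2_of_hl2[of u]] by blast
  have "y = deriv2 u" using y(1) by (simp add: deriv2_def)
  with y show "l2_of_hl2 u = abs_l2 (hU0 u)" "weak_deriv (l2_of_hl2 u) = abs_l2 (hU1 u)"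
    by (simp_all add: hU0_def[abs_def] hU1_def[abs_def])
qed

lemma bounded_linear_l2_of_hl2: "bounded_linear l2_of_hl2"
  unfolding l2_of_hl2_eq[abs_def] by (rule bounded_linear_abs_l2[OF linear_family_hU0])

text \<open>Inverse of \<open>deriv2\<close>, for square integrable f. Together with the isometry
  \<open>norm_deriv2\<close> it allows elements of \<open>hl2\<close> to be handled through their
  second derivatives.\<close>

definition hl2_primitive :: "(real \<Rightarrow> complex) \<Rightarrow> hl2" where
  "hl2_primitive f = hl2_of_l2 (abs_l2 (\<lambda>x. integral {0..x} (\<lambda>s. integral {0..s} f)))"

lemma deriv2_hl2_primitive:
  assumes "sq_integrable f"
  shows "deriv2 (hl2_primitive f) = abs_l2 f"
proof -
  define g where "g = (\<lambda>s. integral {0..s} f)"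
  define h where "h = (\<lambda>x. integral {0..x} g)"
  have g: "AC g f" using AC_primitive[OF assms, of 0] by (simp add: g_def)
  have h: "AC h g" using AC_primitive[OF sq_integrable_continuous[OF AC_continuous[OF g]], of 0] by (simp add: h_def)
  have d: "has_weak_deriv (abs_l2 h) (abs_l2 g)" "has_weak_deriv (abs_l2 g) (abs_l2 f)"
    using AC_has_weak_deriv[OF h] AC_has_weak_deriv[OF g] .
  have "boundary_val (abs_l2 h) 0 = 0" "boundary_val (abs_l2 g) 0 = 0"
    using boundary_val_eq[OF AC_continuous[OF h] refl, of 0] boundary_val_eq[OF AC_continuous[OF g] refl, of 0]
    by (simp_all add: g_def h_def)
  then have "abs_l2 h \<in> HL2" unfolding HL2_iff using d by blast
  then have "l2_of_hl2 (hl2_primitive f) = abs_l2 h"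
    unfolding hl2_primitive_def h_def g_def by (simp add: hl2_of_l2_inverse)
  then show ?thesis using d[THEN weak_deriv_eq] by (simp add: deriv2_def)
qed

lemma hU1_hl2_primitive:
  assumes "sq_integrable f" "x \<in> {0..1}"
  shows "hU1 (hl2_primitive f) x = integral {0..x} f"
  using assms by (simp add: hU1_def deriv2_hl2_primitive integral_rep_l2)

lemma bounded_linear_hl2_primitive:
  assumes F: "linear_family F"
  shows "bounded_linear (\<lambda>x. hl2_primitive (F x))"
proof -
  have sq: "sq_integrable (F x)" for x by (rule sq_integrable_continuous[OF linear_family_continuous[OF F]])
  interpret L: bounded_linear "\<lambda>x. abs_l2 (F x)" by (rule bounded_linear_abs_l2[OF F])
  obtain K where K: "\<And>x. norm (abs_l2 (F x)) \<le> norm x * K" using L.bounded by auto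
  show ?thesis
    by (rule bounded_linear_intro[of _ K])
      (simp_all add: K L.add L.scaleR deriv2_hl2_primitive sq deriv2_add deriv2_scaleR
        flip: deriv2_inject norm_deriv2)
qed

section \<open>The inverse of the beam operator\<close>

text \<open>The two derivatives of EI serve the regularity of 1/EI, through which \<open>R x\<close>
  reaches H^4; the first derivatives of EI and \<rho> also enter the sign conditions on the
  multiplier.\<close>

locale beam =
  fixes EI EI' EI'' \<rho> \<rho>' :: "real \<Rightarrow> real" and m J :: real
  assumes EI_deriv: "x \<in> {0..1} \<Longrightarrow> (EI has_real_derivative EI' x) (at x within {0..1})"
    and EI'_deriv: "x \<in> {0..1} \<Longrightarrow> (EI' has_real_derivative EI'' x) (at x within {0..1})"
    and EI''_continuous: "continuous_on {0..1} EI''"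
    and \<rho>_deriv: "x \<in> {0..1} \<Longrightarrow> (\<rho> has_real_derivative \<rho>' x) (at x within {0..1})"
    and \<rho>'_continuous: "continuous_on {0..1} \<rho>'"
    and EI_pos: "x \<in> {0..1} \<Longrightarrow> EI x > 0" and \<rho>_pos: "x \<in> {0..1} \<Longrightarrow> \<rho> x > 0"
    and m_pos: "m > 0" and J_pos: "J > 0"
begin

lemma EI_continuous: "continuous_on {0..1} EI" and EI'_continuous: "continuous_on {0..1} EI'"
  and \<rho>_continuous: "continuous_on {0..1} \<rho>"
  unfolding continuous_on_eq_continuous_within
  using DERIV_continuous[OF EI_deriv] DERIV_continuous[OF EI'_deriv] DERIV_continuous[OF \<rho>_deriv] by blast+

abbreviation cEI :: "real \<Rightarrow> complex" where "cEI \<equiv> \<lambda>s. of_real (EI s)"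
abbreviation c\<rho> :: "real \<Rightarrow> complex" where "c\<rho> \<equiv> \<lambda>s. of_real (\<rho> s)"
abbreviation iEI :: "real \<Rightarrow> complex" where "iEI \<equiv> \<lambda>s. of_real (inverse (EI s))"

lemma coefficient_continuous: "continuous_on {0..1} cEI" "continuous_on {0..1} c\<rho>" "continuous_on {0..1} iEI"
  by (intro continuous_intros EI_continuous \<rho>_continuous; use EI_pos in force)+

text \<open>For x = (u, v, \<lambda>, \<mu>) and p the displacement of \<open>R x\<close>, the
  equation A (R x) = x demands (EI p'')'' = - \<rho> v, (EI p'')'(1) = m \<lambda> and EI(1) p''(1)
  = - J \<mu>. \<open>shear\<close> is (EI p'')' and \<open>moment\<close> is EI p'', both
  integrated back from the tip; integrals over [s, 1] are written as differences of integrals from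
  0.\<close>

definition shear :: "state \<Rightarrow> real \<Rightarrow> complex" where
  "shear x s = (of_real m * fst (snd (snd x)) + integral {0..1} (rep_l2 (l2_mult c\<rho> (fst (snd x)))))
     + (- 1) * integral {0..s} (rep_l2 (l2_mult c\<rho> (fst (snd x))))"

definition moment :: "state \<Rightarrow> real \<Rightarrow> complex" where
  "moment x s = (of_real (- J) * snd (snd (snd x)) + (- 1) * integral {0..1} (shear x)) + integral {0..s} (shear x)"

text \<open>The velocity component of \<open>R x\<close> is the displacement of x, and membership in
  the domain of A forces the last two components to be its value and slope at the tip.\<close>

definition R :: "state \<Rightarrow> state" where
  "R x = (hl2_primitive (\<lambda>s. iEI s * moment x s), l2_of_hl2 (fst x), hU0 (fst x) 1, hU1 (fst x) 1)"

lemma bounded_linear_components: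
  "bounded_linear (\<lambda>x::state. fst x)" "bounded_linear (\<lambda>x::state. fst (snd x))"
  "bounded_linear (\<lambda>x::state. fst (snd (snd x)))" "bounded_linear (\<lambda>x::state. snd (snd (snd x)))"
  by (intro bounded_linear_intros)+

lemma linear_family_shear: "linear_family shear"
proof -
  have bl: "bounded_linear (\<lambda>x::state. l2_mult c\<rho> (fst (snd x)))"
    by (rule bounded_linear_compose[OF bounded_linear_l2_mult[OF coefficient_continuous(2)] bounded_linear_components(2)])
  note P = linear_family_compose[OF linear_family_primitive bl]
  show ?thesis
    unfolding shear_def
    by (intro linear_family_add linear_family_const linear_family_mult P bounded_linear_add
        bounded_linear_const_mult bounded_linear_components linear_family_eval[OF P]) auto
qed

lemma linear_family_moment: "linear_family moment"
  unfolding moment_def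
  by (intro linear_family_add linear_family_const linear_family_integral linear_family_shear bounded_linear_add
      bounded_linear_const_mult bounded_linear_components linear_family_eval[OF linear_family_integral[OF linear_family_shear]]) auto

lemma linear_family_curvature: "linear_family (\<lambda>x s. iEI s * moment x s)"
  by (intro linear_family_mult coefficient_continuous linear_family_moment)

lemma curvature_continuous: "continuous_on {0..1} (\<lambda>s. iEI s * moment x s)"
  by (rule linear_family_continuous[OF linear_family_curvature])

lemma curvature_sq: "sq_integrable (\<lambda>s. iEI s * moment x s)"
  by (rule sq_integrable_continuous[OF curvature_continuous])

lemma AC_shear: "AC (shear x) (\<lambda>s. - rep_l2 (l2_mult c\<rho> (fst (snd x))) s)"
proof -
  define w where "w = rep_l2 (l2_mult c\<rho> (fst (snd x)))"
  have "sq_integrable (\<lambda>s. - w s)" using sq_integrable_cmult[of w "- 1"] by (simp add: w_def)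
  from AC_primitive[OF this, of "of_real m * fst (snd (snd x)) + integral {0..1} w"] show ?thesis
    unfolding w_def by (rule AC_cong) (simp_all add: shear_def)
qed

lemma shear_1: "shear x 1 = of_real m * fst (snd (snd x))"
  by (simp add: shear_def)

lemma AC_moment: "AC (moment x) (shear x)"
  unfolding moment_def[abs_def]
  by (intro AC_primitive sq_integrable_continuous linear_family_continuous[OF linear_family_shear])

lemma moment_1: "moment x 1 = of_real (- J) * snd (snd (snd x))"
  by (simp add: moment_def)

lemma bounded_linear_R: "bounded_linear R"
  unfolding R_def
  by (intro bounded_linear_Pair bounded_linear_hl2_primitive linear_family_curvature
    bounded_linear_compose[OF bounded_linear_l2_of_hl2 bounded_linear_components(1)]
    linear_family_eval[OF linear_family_compose[OF linear_family_hU0 bounded_linear_components(1)]]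
    linear_family_eval[OF linear_family_compose[OF linear_family_hU1 bounded_linear_components(1)]]) auto

definition energy :: "state \<Rightarrow> state \<Rightarrow> real" where
  "energy x z = Re (energy_inner EI \<rho> m J x z)"

lemma energy_eq: "energy x z = inner (l2_mult cEI (deriv2 (fst x))) (deriv2 (fst z))
   + inner (l2_mult c\<rho> (fst (snd x))) (fst (snd z))
   + m * inner (fst (snd (snd x))) (fst (snd (snd z))) + J * inner (snd (snd (snd x))) (snd (snd (snd z)))"
proof -
  have *: "Re (LINT s|lebesgue_on {0..1}. g s * rep_l2 v s * cnj (rep_l2 w s)) = inner (l2_mult g v) w"
    if g: "continuous_on {0..1} g" for g v w
  proof -
    have "inner (l2_mult g v) w = inner (abs_l2 (\<lambda>s. g s * rep_l2 v s)) (abs_l2 (rep_l2 w))"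
      by (simp add: l2_mult_def)
    also have "\<dots> = Re (LINT s|lebesgue_on {0..1}. g s * rep_l2 v s * cnj (rep_l2 w s))"
      using sq_integrable_mult_continuous[OF sq_integrable_rep_l2 g] by (subst inner_l2.abs_eq) auto
    finally show ?thesis by simp
  qed
  have c: "Re (of_real k * a * cnj b) = k * inner a b" for k a b
    by (simp add: inner_complex_def algebra_simps)
  show ?thesis
    unfolding energy_def energy_inner_def
    by (simp only: split_beta plus_complex.sel *[OF coefficient_continuous(1)] *[OF coefficient_continuous(2)] c)
qed

lemma bounded_bilinear_energy: "bounded_bilinear energy"
proof -
  note bc = bounded_linear_components
  have b: "bounded_bilinear (\<lambda>x z. inner (f x) (g z))" if "bounded_linear f" "bounded_linear g"
    for f :: "state \<Rightarrow> 'b::real_inner" and g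
    by (rule bounded_bilinear.comp[OF bounded_bilinear_inner that])
  show ?thesis
    unfolding energy_eq[abs_def]
    by (intro bounded_bilinear_add bounded_bilinear_cmult b bc
       bounded_linear_compose[OF bounded_linear_l2_mult[OF coefficient_continuous(1)] bounded_linear_compose[OF bounded_linear_deriv2 bc(1)]]
       bounded_linear_compose[OF bounded_linear_l2_mult[OF coefficient_continuous(2)] bc(2)]
       bounded_linear_compose[OF bounded_linear_deriv2 bc(1)])
qed

lemma energy_coercive: "\<exists>c>0. \<forall>x. c * (norm x)\<^sup>2 \<le> energy x x"
proof -
  obtain c where c: "c > 0" "\<And>x. c * norm x \<le> energy_norm EI \<rho> m J x"
    using energy_norm_equivalent[of EI \<rho> m J] EI_continuous EI_pos \<rho>_continuous \<rho>_pos m_pos J_pos by blast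
  have "c\<^sup>2 * (norm x)\<^sup>2 \<le> energy x x" for x
  proof -
    have p: "(c * norm x)\<^sup>2 \<le> (energy_norm EI \<rho> m J x)\<^sup>2"
      using c by (intro power_mono) auto
    show ?thesis
    proof (cases "energy x x \<ge> 0")
      case True
      then show ?thesis using p by (simp add: energy_norm_def energy_def power_mult_distrib)
    next
      case False
      \<comment> \<open>\<open>sqrt\<close> is odd, so a negative value of \<open>energy x x\<close>
        would make the energy norm negative and contradict its lower bound.\<close>
      then have "energy_norm EI \<rho> m J x < 0" by (simp add: energy_norm_def energy_def)
      moreover have "0 \<le> c * norm x" using c(1) by simp
      ultimately have False using c(2)[of x] by linarith
      then show ?thesis ..
    qed
  qed
  then show ?thesis using c(1) by (intro exI[of _ "c\<^sup>2"]) auto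
qed

lemma inner_l2_mult:
  assumes "continuous_on {0..1} g"
  shows "inner (l2_mult (\<lambda>s. of_real (g s)) v) w = inner (l2_mult (\<lambda>s. of_real (g s)) w) v"
proof -
  have g: "continuous_on {0..1} (\<lambda>s. complex_of_real (g s))" by (intro continuous_intros assms)
  have sq: "sq_integrable (\<lambda>s. of_real (g s) * rep_l2 v s)" for v
    by (rule sq_integrable_mult_continuous[OF sq_integrable_rep_l2 g])
  have e: "inner (l2_mult (\<lambda>s. of_real (g s)) v) w = Re (integral {0..1} (\<lambda>s. of_real (g s) * rep_l2 v s * cnj (rep_l2 w s)))" for v w
    using inner_abs_l2[OF sq, of "rep_l2 w" v] by (simp add: l2_mult_def)
  have "((\<lambda>s. of_real (g s) * rep_l2 w s * cnj (rep_l2 v s)) integrable_on {0..1})"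
    using integrable_on_lebesgue_on[OF integrable_mult_cnj[OF sq sq_integrable_rep_l2]] by simp
  then have "((\<lambda>s. cnj (of_real (g s) * rep_l2 w s * cnj (rep_l2 v s))) has_integral
      cnj (integral {0..1} (\<lambda>s. of_real (g s) * rep_l2 w s * cnj (rep_l2 v s)))) {0..1}"
    using has_integral_linear[OF integrable_integral bounded_linear_cnj] unfolding o_def by blast
  then have "integral {0..1} (\<lambda>s. of_real (g s) * rep_l2 v s * cnj (rep_l2 w s)) =
      cnj (integral {0..1} (\<lambda>s. of_real (g s) * rep_l2 w s * cnj (rep_l2 v s)))"
    by (auto dest!: integral_unique simp: mult_ac)
  then show ?thesis unfolding e by simp
qed

lemma energy_sym: "energy x z = energy z x"
  unfolding energy_eq
  by (simp only: inner_l2_mult[OF EI_continuous, of "deriv2 (fst x)"] inner_l2_mult[OF \<rho>_continuous, of "fst (snd x)"]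
      inner_commute[of "fst (snd (snd x))"] inner_commute[of "snd (snd (snd x))"])

text \<open>Two integrations by parts throw both derivatives of u onto the moment, where moment' =
  shear and shear' = - \<rho> v. At 0 the boundary terms vanish as u(0) = u'(0) = 0; at 1 the moment
  and the shear are - J and m times the last two components of x.\<close>

lemma inner_moment:
  "Re (integral {0..1} (\<lambda>s. moment x s * cnj (rep_l2 (deriv2 u) s))) =
    - J * inner (snd (snd (snd x))) (hU1 u 1) - m * inner (fst (snd (snd x))) (hU0 u 1)
    - inner (l2_mult c\<rho> (fst (snd x))) (l2_of_hl2 u)"
proof -
  define v where "v = l2_mult c\<rho> (fst (snd x))"
  note A = AC_mult[OF AC_moment[of x] AC_cnj[OF AC_hU1[of u]]]
  note B = AC_mult[OF AC_shear[of x, folded v_def] AC_cnj[OF AC_hU0[of u]]]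
  have cont: "continuous_on {0..1} (\<lambda>s. shear x s * cnj (hU1 u s))"
    by (intro continuous_intros linear_family_continuous linear_family_shear linear_family_hU1)
  have i1: "(\<lambda>s. shear x s * cnj (hU1 u s)) integrable_on {0..1}"
    by (rule integrable_continuous_real[OF cont])
  have sqm: "sq_integrable (\<lambda>s. moment x s)" "sq_integrable (\<lambda>s. hU0 u s)"
    by (intro sq_integrable_continuous linear_family_continuous linear_family_moment linear_family_hU0)+
  have i2: "(\<lambda>s. moment x s * cnj (rep_l2 (deriv2 u) s)) integrable_on {0..1}"
    using integrable_on_lebesgue_on[OF integrable_mult_cnj[OF sqm(1) sq_integrable_rep_l2]] by simp
  have i3: "(\<lambda>s. rep_l2 v s * cnj (hU0 u s)) integrable_on {0..1}"
    using integrable_on_lebesgue_on[OF integrable_mult_cnj[OF sq_integrable_rep_l2 sqm(2)]] by simp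
  have 1: "integral {0..1} (\<lambda>s. shear x s * cnj (hU1 u s)) + integral {0..1} (\<lambda>s. moment x s * cnj (rep_l2 (deriv2 u) s))
    = moment x 1 * cnj (hU1 u 1)"
    using AC_integral[OF A] i1 i2 by (simp add: integral_add)
  have 2: "- integral {0..1} (\<lambda>s. rep_l2 v s * cnj (hU0 u s)) + integral {0..1} (\<lambda>s. shear x s * cnj (hU1 u s))
    = shear x 1 * cnj (hU0 u 1)"
    using AC_integral[OF B] i1 i3 integral_add[OF integrable_neg[OF i3] i1] by simp
  have "inner v (l2_of_hl2 u) = Re (integral {0..1} (\<lambda>s. rep_l2 v s * cnj (hU0 u s)))"
    using inner_abs_l2[OF sq_integrable_rep_l2 sqm(2), of v] by (simp add: l2_of_hl2_eq)
  moreover have "integral {0..1} (\<lambda>s. moment x s * cnj (rep_l2 (deriv2 u) s)) =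
      moment x 1 * cnj (hU1 u 1) - shear x 1 * cnj (hU0 u 1) - integral {0..1} (\<lambda>s. rep_l2 v s * cnj (hU0 u s))"
    using 1 2 by (simp add: algebra_simps)
  moreover have "Re (moment x 1 * cnj (hU1 u 1) - shear x 1 * cnj (hU0 u 1) - V) =
      - J * inner (snd (snd (snd x))) (hU1 u 1) - m * inner (fst (snd (snd x))) (hU0 u 1) - Re V" for V
    by (simp add: moment_1 shear_1 inner_complex_def algebra_simps)
  ultimately show ?thesis unfolding v_def by (simp only:)
qed

lemma EI_curvature: "l2_mult cEI (abs_l2 (\<lambda>s. iEI s * moment x s)) = abs_l2 (moment x)"
proof -
  have "l2_mult cEI (abs_l2 (\<lambda>s. iEI s * moment x s)) = abs_l2 (\<lambda>s. cEI s * (iEI s * moment x s))"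
    by (rule l2_mult_abs[OF curvature_sq coefficient_continuous(1)])
  also have "\<dots> = abs_l2 (moment x)"
  proof (intro abs_l2_eqI AE_I2)
    show m: "sq_integrable (moment x)"
      by (intro sq_integrable_continuous linear_family_continuous linear_family_moment)
    have eq: "cEI s * (iEI s * moment x s) = moment x s" if "s \<in> {0..1}" for s
      using EI_pos[OF that] by simp
    then show "cEI s * (iEI s * moment x s) = moment x s" if "s \<in> space (lebesgue_on {0..1})" for s
      using that by simp
    show "sq_integrable (\<lambda>s. cEI s * (iEI s * moment x s))"
      using eq by (intro sq_integrable_cong[OF m]) simp
  qed
  finally show ?thesis .
qed

text \<open>The weight EI of the energy cancels the factor 1/EI in the curvature of
  \<open>R x\<close>, so that \<open>inner_moment\<close> applies.\<close>

lemma energy_R_eq: "energy (R x) z =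
    - J * inner (snd (snd (snd x))) (hU1 (fst z) 1) - m * inner (fst (snd (snd x))) (hU0 (fst z) 1)
    - inner (l2_mult c\<rho> (fst (snd x))) (l2_of_hl2 (fst z))
    + inner (l2_mult c\<rho> (l2_of_hl2 (fst x))) (fst (snd z))
    + m * inner (hU0 (fst x) 1) (fst (snd (snd z))) + J * inner (hU1 (fst x) 1) (snd (snd (snd z)))"
proof -
  have "sq_integrable (moment x)"
    by (intro sq_integrable_continuous linear_family_continuous linear_family_moment)
  then have "inner (abs_l2 (moment x)) (deriv2 (fst z)) = Re (integral {0..1} (\<lambda>s. moment x s * cnj (rep_l2 (deriv2 (fst z)) s)))"
    using inner_abs_l2[of "moment x" "rep_l2 (deriv2 (fst z))"] by simp
  then show ?thesis
    unfolding energy_eq R_def fst_conv snd_conv deriv2_hl2_primitive[OF curvature_sq] EI_curvature inner_moment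
    by simp
qed

text \<open>In the formula for \<open>energy (R x) z\<close>, exchanging x and z exchanges terms of
  opposite sign.\<close>

lemma energy_skew: "energy (R x) z = - energy x (R z)"
  unfolding energy_sym[of x "R z"] energy_R_eq
  by (simp add: inner_l2_mult[OF \<rho>_continuous, of "fst (snd x)"] inner_l2_mult[OF \<rho>_continuous, of "fst (snd z)"]
      inner_commute[of "fst (snd (snd x))"] inner_commute[of "snd (snd (snd x))"]
      inner_commute[of "fst (snd (snd z))"] inner_commute[of "snd (snd (snd z))"])

end

section \<open>The multiplier estimate\<close>

lemma has_integral_Re: "f integrable_on S \<Longrightarrow> ((\<lambda>s. Re (f s)) has_integral Re (integral S f)) S"
  using has_integral_linear[OF integrable_integral bounded_linear_Re, of f S] unfolding o_def .

lemma has_integral_cnj': "f integrable_on S \<Longrightarrow> ((\<lambda>s. cnj (f s)) has_integral cnj (integral S f)) S"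
  using has_integral_linear[OF integrable_integral bounded_linear_cnj, of f S] unfolding o_def .

text \<open>The derivative of g |f|^2 is g' |f|^2 plus twice the real part of g f cnj h; integrate
  over [0, 1].\<close>

lemma weighted_square_identity:
  fixes g g' :: "real \<Rightarrow> real"
  assumes f: "AC f h" "continuous_on {0..1} h"
    and g: "\<And>x. x \<in> {0..1} \<Longrightarrow> (g has_real_derivative g' x) (at x within {0..1})" "continuous_on {0..1} g'"
  shows "2 * Re (integral {0..1} (\<lambda>s. of_real (g s) * f s * cnj (h s))) =
    g 1 * (norm (f 1))\<^sup>2 - g 0 * (norm (f 0))\<^sup>2 - integral {0..1} (\<lambda>s. g' s * (norm (f s))\<^sup>2)"
proof -
  have gc: "continuous_on {0..1} g"
    using DERIV_continuous[OF g(1)] unfolding continuous_on_eq_continuous_within by blast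
  note c = AC_continuous[OF f(1)] f(2) gc g(2)
  define F where "F = (\<lambda>s. g s * (norm (f s))\<^sup>2)"
  note A = AC_mult[OF AC_mult[OF AC_C1[OF g] f(1)] AC_cnj[OF f(1)]]
  define k where "k = (\<lambda>s. (of_real (g' s) * f s + of_real (g s) * h s) * cnj (f s) + of_real (g s) * f s * cnj (h s))"
  have kc: "continuous_on {0..1} k" unfolding k_def by (intro continuous_intros c)
  have hk: "(k has_integral of_real (g 1) * f 1 * cnj (f 1) - of_real (g 0) * f 0 * cnj (f 0)) {0..1}"
    using AC_integral[OF A] integrable_continuous_real[OF kc] unfolding k_def by (simp add: has_integral_integral)
  have "((\<lambda>s. Re (k s)) has_integral Re (of_real (g 1) * f 1 * cnj (f 1) - of_real (g 0) * f 0 * cnj (f 0))) {0..1}"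
    using has_integral_linear[OF hk bounded_linear_Re] by (simp add: o_def)
  moreover have n: "Re (of_real r * z * cnj z) = r * (norm z)\<^sup>2" for r z
    unfolding cmod_power2 by (simp add: power2_eq_square algebra_simps)
  ultimately have 1: "((\<lambda>s. Re (k s)) has_integral g 1 * (norm (f 1))\<^sup>2 - g 0 * (norm (f 0))\<^sup>2) {0..1}"
    by (simp only: minus_complex.sel n)
  have "((\<lambda>s. Re (of_real (g s) * f s * cnj (h s))) has_integral Re (integral {0..1} (\<lambda>s. of_real (g s) * f s * cnj (h s)))) {0..1}"
    by (intro has_integral_Re integrable_continuous_real continuous_intros c)
  note 2 = has_integral_mult_right[OF this, of 2]
  have "((\<lambda>s. g' s * (norm (f s))\<^sup>2) has_integral integral {0..1} (\<lambda>s. g' s * (norm (f s))\<^sup>2)) {0..1}"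
    by (intro integrable_integral integrable_continuous_real continuous_intros c)
  note 3 = has_integral_add[OF this 2]
  have "Re (k s) = g' s * (norm (f s))\<^sup>2 + 2 * Re (of_real (g s) * f s * cnj (h s))" for s
    unfolding k_def cmod_power2 by (simp add: power2_eq_square algebra_simps)
  then have "((\<lambda>s. Re (k s)) has_integral integral {0..1} (\<lambda>s. g' s * (norm (f s))\<^sup>2)
      + 2 * Re (integral {0..1} (\<lambda>s. of_real (g s) * f s * cnj (h s)))) {0..1}"
    using 3 by simp
  from has_integral_unique[OF 1 this] show ?thesis by simp
qed

context beam
begin

lemma bounded_linear_B_adj: "bounded_linear B_adj"
  unfolding B_adj_def split_beta by (intro bounded_linear_Pair bounded_linear_components)

sublocale skew_system energy R B_adj
proof (rule skew_system.intro)
  show "energy x y = energy y x" for x y by (rule energy_sym)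
  show "energy (R x) y = - energy x (R y)" for x y by (rule energy_skew)
qed (rule bounded_bilinear_energy energy_coercive bounded_linear_R bounded_linear_B_adj)+

lemma B_adj_eq: "B_adj x = (fst (snd (snd x)), snd (snd (snd x)))"
  by (simp add: B_adj_def split_beta)

lemma obs_0: "obs 0 x = (fst (snd (snd x)), snd (snd (snd x)))"
  by (simp add: obs_def B_adj_eq)

lemma obs_Suc: "obs (Suc n) x = (hU0 (fst ((R ^^ n) x)) 1, hU1 (fst ((R ^^ n) x)) 1)"
  by (simp add: obs_def B_adj_eq R_def)

text \<open>With \<zeta> = exp (N s), the derivative of \<zeta> \<rho> is \<zeta> (N \<rho> +
  \<rho>'), and \<zeta> (3 N EI - EI') is the combination 3 \<zeta>' EI - \<zeta> EI' that the
  elastic part of the multiplier identity produces. Taking N at least 1 plus the supremum of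
  |\<rho>'| / \<rho> + |EI'| / EI makes both large enough.\<close>

lemma weight_exists: "\<exists>N. \<forall>s\<in>{0..1}. \<rho> s \<le> N * \<rho> s + \<rho>' s \<and> EI s \<le> 3 * N * EI s - EI' s"
proof -
  have nz: "\<forall>s\<in>{0..1}. \<rho> s \<noteq> 0" "\<forall>s\<in>{0..1}. EI s \<noteq> 0" using \<rho>_pos EI_pos by force+
  have "continuous_on {0..1} (\<lambda>s. \<bar>\<rho>' s\<bar> / \<rho> s + \<bar>EI' s\<bar> / EI s)"
    by (intro continuous_intros \<rho>'_continuous \<rho>_continuous EI'_continuous EI_continuous nz)
  then obtain K where K: "\<And>s. s \<in> {0..1} \<Longrightarrow> norm (\<bar>\<rho>' s\<bar> / \<rho> s + \<bar>EI' s\<bar> / EI s) \<le> K"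
    by (rule continuous_on_unit_interval_bounded) blast
  have "\<rho> s \<le> (K + 1) * \<rho> s + \<rho>' s \<and> EI s \<le> 3 * (K + 1) * EI s - EI' s" if s: "s \<in> {0..1}" for s
  proof -
    have p: "\<rho> s > 0" "EI s > 0" using EI_pos \<rho>_pos s by auto
    have "0 \<le> \<bar>\<rho>' s\<bar> / \<rho> s" "0 \<le> \<bar>EI' s\<bar> / EI s" using p by auto
    then have "\<bar>\<rho>' s\<bar> / \<rho> s \<le> K" "\<bar>EI' s\<bar> / EI s \<le> K" using K[OF s] by auto
    then have k: "\<bar>\<rho>' s\<bar> \<le> K * \<rho> s" "\<bar>EI' s\<bar> \<le> K * EI s" using p by (simp_all add: pos_divide_le_eq)
    then have "0 \<le> K * EI s" by (meson abs_ge_zero order_trans)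
    then show ?thesis using k p by (simp add: distrib_right distrib_left abs_le_iff)
  qed
  then show ?thesis by blast
qed

lemma AC_hU1_R: "AC (hU1 (fst (R x))) (\<lambda>s. iEI s * moment x s)"
  using AC_primitive[OF curvature_sq, of 0 x]
  by (rule AC_cong) (simp_all only: R_def fst_conv hU1_hl2_primitive[OF curvature_sq] add_0)

lemma norm_fst_R: "norm (abs_l2 (\<lambda>s. iEI s * moment x s)) = norm (fst (R x))"
  unfolding R_def fst_conv norm_deriv2[symmetric] deriv2_hl2_primitive[OF curvature_sq] ..

lemma hU_continuous: "continuous_on {0..1} (hU0 u)" "continuous_on {0..1} (hU1 u)"
  by (intro linear_family_continuous linear_family_hU0 linear_family_hU1)+

lemma moment_continuous: "continuous_on {0..1} (moment x)" "continuous_on {0..1} (shear x)"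
  by (intro linear_family_continuous linear_family_moment linear_family_shear)+

lemma norm_R_sq: "(norm (R x))\<^sup>2 = (norm (fst (R x)))\<^sup>2 + (norm (l2_of_hl2 (fst x)))\<^sup>2 + (norm (obs 1 x))\<^sup>2"
  using obs_Suc[of 0 x] by (simp add: R_def norm_Pair)

text \<open>The multiplier is \<open>\<zeta> p'\<close> with \<open>\<zeta> s = exp (N s)\<close>; for large \<open>N\<close> its leading terms have a sign, and the
  remaining term, containing \<open>\<zeta>''\<close>, is of lower order.\<close>

definition multiplier_form :: "real \<Rightarrow> state \<Rightarrow> state \<Rightarrow> real" where
  "multiplier_form N x z =
     inner (l2_mult (\<lambda>s. of_real (exp (N * s))) (l2_mult c\<rho> (fst (snd z)))) (abs_l2 (hU1 (fst x)))"

lemma exp_continuous: "continuous_on {0..1} (\<lambda>s. complex_of_real (exp (N * s)))"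
  by (intro continuous_intros)

lemma bounded_bilinear_multiplier_form: "bounded_bilinear (multiplier_form N)"
proof -
  have b1: "bounded_linear (\<lambda>z::state. l2_mult (\<lambda>s. of_real (exp (N * s))) (l2_mult c\<rho> (fst (snd z))))"
    by (rule bounded_linear_compose[OF bounded_linear_l2_mult[OF exp_continuous]
        bounded_linear_compose[OF bounded_linear_l2_mult[OF coefficient_continuous(2)] bounded_linear_components(2)]])
  have b2: "bounded_linear (\<lambda>x::state. abs_l2 (hU1 (fst x)))"
    by (rule bounded_linear_abs_l2[OF linear_family_compose[OF linear_family_hU1 bounded_linear_components(1)]])
  note this = bounded_bilinear.comp[OF bounded_bilinear_inner b1 b2]
  from bounded_bilinear.flip[OF this] show ?thesis
    unfolding multiplier_form_def[abs_def] .
qed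

text \<open>The velocity of \<open>R x\<close> is the displacement u of x, so the integrand is
  \<zeta> \<rho> u cnj u', whose real part is half a weighted derivative of |u|^2. Integration by
  parts gives it a sign, up to the tip value u(1).\<close>

lemma multiplier_first:
  assumes N: "\<And>s. s \<in> {0..1} \<Longrightarrow> \<rho> s \<le> N * \<rho> s + \<rho>' s" and "N \<ge> 0"
    and \<rho>0: "\<And>s. s \<in> {0..1} \<Longrightarrow> \<rho>0 \<le> \<rho> s" "\<rho>0 > 0"
  shows "2 * multiplier_form N x (R x) \<le>
    exp N * \<rho> 1 * (norm (obs 1 x))\<^sup>2 - \<rho>0 * (norm (l2_of_hl2 (fst x)))\<^sup>2"
proof -
  define u where "u = fst x"
  define g where "g = (\<lambda>s. exp (N * s) * \<rho> s)"
  define g' where "g' = (\<lambda>s. exp (N * s) * (N * \<rho> s + \<rho>' s))"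
  have g: "(g has_real_derivative g' s) (at s within {0..1})" if "s \<in> {0..1}" for s
    unfolding g_def g'_def using \<rho>_deriv[OF that]
    by (auto intro!: derivative_eq_intros simp: algebra_simps)
  have g'c: "continuous_on {0..1} g'"
    unfolding g'_def by (intro continuous_intros \<rho>_continuous \<rho>'_continuous)
  have sq: "sq_integrable (hU0 u)" "sq_integrable (hU1 u)"
    by (intro sq_integrable_continuous hU_continuous)+
  have "l2_mult (\<lambda>s. of_real (exp (N * s))) (l2_mult c\<rho> (l2_of_hl2 u)) = abs_l2 (\<lambda>s. of_real (g s) * hU0 u s)"
    unfolding l2_of_hl2_eq l2_mult_abs[OF sq(1) coefficient_continuous(2)]
      l2_mult_abs[OF sq_integrable_mult_continuous[OF sq(1) coefficient_continuous(2)] exp_continuous]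
    by (simp add: g_def mult.assoc)
  moreover have "sq_integrable (\<lambda>s. of_real (g s) * hU0 u s)"
    unfolding g_def by (intro sq_integrable_mult_continuous sq continuous_intros \<rho>_continuous)
  ultimately have "multiplier_form N x (R x) = Re (integral {0..1} (\<lambda>s. of_real (g s) * hU0 u s * cnj (hU1 u s)))"
    using inner_abs_l2[of "\<lambda>s. of_real (g s) * hU0 u s" "hU1 u"] sq by (simp add: multiplier_form_def R_def u_def)
  then have "2 * multiplier_form N x (R x) = g 1 * (norm (hU0 u 1))\<^sup>2 - integral {0..1} (\<lambda>s. g' s * (norm (hU0 u s))\<^sup>2)"
    using weighted_square_identity[OF AC_hU0 hU_continuous(2) g g'c] by simp
  moreover have "\<rho>0 * (norm (l2_of_hl2 u))\<^sup>2 \<le> integral {0..1} (\<lambda>s. g' s * (norm (hU0 u s))\<^sup>2)"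
  proof -
    have "\<rho>0 * (norm (l2_of_hl2 u))\<^sup>2 = integral {0..1} (\<lambda>s. \<rho>0 * (norm (hU0 u s))\<^sup>2)"
      unfolding l2_of_hl2_eq norm_abs_l2_sq[OF hU_continuous(1)] by simp
    also have "\<dots> \<le> integral {0..1} (\<lambda>s. g' s * (norm (hU0 u s))\<^sup>2)"
    proof (intro integral_le integrable_continuous_real continuous_intros hU_continuous g'c)
      fix s :: real assume s: "s \<in> {0..1}"
      have "1 * \<rho>0 \<le> exp (N * s) * (N * \<rho> s + \<rho>' s)"
        using s N[OF s] \<rho>0(1)[OF s] \<rho>0(2) \<open>N \<ge> 0\<close> by (intro mult_mono) auto
      then show "\<rho>0 * (norm (hU0 u s))\<^sup>2 \<le> g' s * (norm (hU0 u s))\<^sup>2"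
        by (intro mult_right_mono) (auto simp: g'_def)
    qed
    finally show ?thesis .
  qed
  moreover have "g 1 * (norm (hU0 u 1))\<^sup>2 \<le> exp N * \<rho> 1 * (norm (obs 1 x))\<^sup>2"
    using obs_Suc[of 0 x] \<rho>_pos[of 1] by (simp add: g_def u_def norm_Pair)
  ultimately show ?thesis by (simp add: u_def)
qed

text \<open>Let p be the displacement of \<open>R x\<close>, M = EI p'' and S = M'. As \<rho> v = -
  S', integrating \<zeta> \<rho> v cnj p' by parts produces S \<zeta> cnj p'', in real part half a
  weighted derivative of |M|^2, and S \<zeta>' cnj p', which a second integration by parts turns
  into M \<zeta>' cnj p'' and the lower order term M \<zeta>'' cnj p'. The terms quadratic in M
  combine to - 1/2 times the integral of \<zeta> (3 N EI - EI') |M|^2 / EI^2.\<close>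

lemma multiplier_second:
  assumes N: "\<And>s. s \<in> {0..1} \<Longrightarrow> EI s \<le> 3 * N * EI s - EI' s" and "N \<ge> 0"
    and E0: "\<And>s. s \<in> {0..1} \<Longrightarrow> E0 \<le> EI s" "E0 > 0"
  shows "\<exists>K>0. \<forall>x. multiplier_form N (R x) x \<le> - (E0 / 2) * (norm (fst (R x)))\<^sup>2
    + K * norm (fst (R x)) * norm (abs_l2 (hU1 (fst (R x)))) + K * ((norm (obs 0 x))\<^sup>2 + (norm (obs 2 x))\<^sup>2)"
proof -
  define \<zeta> where "\<zeta> = (\<lambda>s::real. exp (N * s))"
  define \<zeta>1 where "\<zeta>1 = (\<lambda>s. N * \<zeta> s)"
  define \<zeta>2 where "\<zeta>2 = (\<lambda>s. N * \<zeta>1 s)"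
  have \<zeta>c: "continuous_on {0..1} \<zeta>" "continuous_on {0..1} \<zeta>1" "continuous_on {0..1} \<zeta>2"
    unfolding \<zeta>_def \<zeta>1_def \<zeta>2_def by (intro continuous_intros)+
  have \<zeta>d: "(\<zeta> has_real_derivative \<zeta>1 s) (at s within {0..1})" "(\<zeta>1 has_real_derivative \<zeta>2 s) (at s within {0..1})" for s
    unfolding \<zeta>_def \<zeta>1_def \<zeta>2_def by (auto intro!: derivative_eq_intros)
  have \<zeta>_ge: "\<zeta> s \<ge> 1" if "s \<in> {0..1}" for s using that \<open>N \<ge> 0\<close> by (simp add: \<zeta>_def)
  \<comment> \<open>As p'' = M / EI, the product S \<zeta> cnj p'' equals g S cnj M.\<close>
  define g where "g = (\<lambda>s. \<zeta> s * inverse (EI s))"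
  define g' where "g' = (\<lambda>s. \<zeta>1 s * inverse (EI s) - \<zeta> s * EI' s * (inverse (EI s))\<^sup>2)"
  have gd: "(g has_real_derivative g' s) (at s within {0..1})" if "s \<in> {0..1}" for s
    unfolding g_def g'_def using EI_deriv[OF that] \<zeta>d(1)[of s] EI_pos[OF that]
    by (auto intro!: derivative_eq_intros simp: power2_eq_square)
  have nz: "\<forall>s\<in>{0..1}. EI s \<noteq> 0" using EI_pos by force
  have gc: "continuous_on {0..1} g" "continuous_on {0..1} g'"
    unfolding g_def g'_def by (intro continuous_intros \<zeta>c EI_continuous EI'_continuous nz)+
  define w2 where "w2 = (\<lambda>s. complex_of_real (\<zeta>2 s * EI s))"
  have w2c: "continuous_on {0..1} w2" unfolding w2_def by (intro continuous_intros \<zeta>c EI_continuous)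
  obtain K2 where K2: "K2 > 0" "\<And>v. norm (l2_mult w2 v) \<le> norm v * K2"
    using bounded_linear.pos_bounded[OF bounded_linear_l2_mult[OF w2c]] by auto
  define K where "K = K2 + m * \<zeta> 1 + J * \<zeta>1 1 + g 1 * J\<^sup>2"
  have g1: "g 1 \<ge> 0" "g 0 \<ge> 0" using EI_pos[of 1] EI_pos[of 0] \<zeta>_ge[of 1] \<zeta>_ge[of 0] by (auto simp: g_def)
  have \<zeta>1: "\<zeta> 1 \<ge> 0" "\<zeta>1 1 \<ge> 0" using \<zeta>_ge[of 1] \<open>N \<ge> 0\<close> by (auto simp: \<zeta>1_def)
  have nn: "0 \<le> m * \<zeta> 1" "0 \<le> J * \<zeta>1 1" "0 \<le> g 1 * J\<^sup>2"
    using g1 \<zeta>1 m_pos J_pos by auto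
  then have K: "K > 0" "K2 \<le> K" using K2(1) by (auto simp: K_def)
  have "multiplier_form N (R x) x \<le> - (E0 / 2) * (norm (fst (R x)))\<^sup>2
    + K * norm (fst (R x)) * norm (abs_l2 (hU1 (fst (R x)))) + K * ((norm (obs 0 x))\<^sup>2 + (norm (obs 2 x))\<^sup>2)" for x
  proof -
    define M S where "M = moment x" and "S = shear x"
    define k where "k = (\<lambda>s. iEI s * M s)"
    define P where "P = hU1 (fst (R x))"
    define w where "w = rep_l2 (l2_mult c\<rho> (fst (snd x)))"
    have MS: "AC M S" "AC S (\<lambda>s. - w s)" "continuous_on {0..1} M" "continuous_on {0..1} S"
      using AC_moment[of x] AC_shear[of x] moment_continuous[of x] by (simp_all add: M_def S_def w_def)
    have Pk: "AC P k" "continuous_on {0..1} P" "continuous_on {0..1} k" "P 0 = 0"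
      using AC_hU1_R[of x] hU_continuous(2) curvature_continuous[of x] by (simp_all add: P_def k_def M_def)
    have \<zeta>AC: "AC (\<lambda>s. of_real (\<zeta> s)) (\<lambda>s. of_real (\<zeta>1 s))" "AC (\<lambda>s. of_real (\<zeta>1 s)) (\<lambda>s. of_real (\<zeta>2 s))"
      by (intro AC_C1 \<zeta>d \<zeta>c)+
    have cc: "continuous_on {0..1} (\<lambda>s. complex_of_real (\<zeta> s))" "continuous_on {0..1} (\<lambda>s. complex_of_real (\<zeta>1 s))"
      "continuous_on {0..1} (\<lambda>s. complex_of_real (\<zeta>2 s))"
      by (intro continuous_intros \<zeta>c)+
    have int: "f integrable_on {0..1}" if "continuous_on {0..1} f" for f :: "real \<Rightarrow> complex"
      by (rule integrable_continuous_real[OF that])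
    \<comment> \<open>I1 gives the form itself, I3 and I5 become quadratic in the moment, I4 is of
      lower order, and I2 is eliminated between the two integrations by parts.\<close>
    define I1 I2 I3 I4 I5 where "I1 = integral {0..1} (\<lambda>s. of_real (\<zeta> s) * w s * cnj (P s))"
      and "I2 = integral {0..1} (\<lambda>s. S s * of_real (\<zeta>1 s) * cnj (P s))"
      and "I3 = integral {0..1} (\<lambda>s. S s * of_real (\<zeta> s) * cnj (k s))"
      and "I4 = integral {0..1} (\<lambda>s. M s * of_real (\<zeta>2 s) * cnj (P s))"
      and "I5 = integral {0..1} (\<lambda>s. M s * of_real (\<zeta>1 s) * cnj (k s))"
    have sqw: "sq_integrable (\<lambda>s. of_real (\<zeta> s) * w s)"
      unfolding w_def by (intro sq_integrable_mult_continuous cc) simp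
    have V: "multiplier_form N (R x) x = Re I1"
      using inner_abs_l2[OF sqw sq_integrable_continuous[OF Pk(2)]]
      by (simp add: multiplier_form_def I1_def l2_mult_def[of "\<lambda>s. complex_of_real (exp (N * s))"] \<zeta>_def w_def P_def)
    have iw: "(\<lambda>s. of_real (\<zeta> s) * w s * cnj (P s)) integrable_on {0..1}"
      using integrable_on_lebesgue_on[OF integrable_mult_cnj[OF sqw sq_integrable_continuous[OF Pk(2)]]] by simp
    have e1: "- I1 + I2 + I3 = S 1 * of_real (\<zeta> 1) * cnj (P 1)"
    proof -
      have "((\<lambda>s. - (of_real (\<zeta> s) * w s * cnj (P s)) + S s * of_real (\<zeta>1 s) * cnj (P s) + S s * of_real (\<zeta> s) * cnj (k s))
          has_integral - I1 + I2 + I3) {0..1}"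
        unfolding I1_def I2_def I3_def
        by (intro has_integral_add has_integral_neg integrable_integral iw int continuous_intros MS Pk cc)
      moreover have "integral {0..1} (\<lambda>s. (- w s * of_real (\<zeta> s) + S s * of_real (\<zeta>1 s)) * cnj (P s) + S s * of_real (\<zeta> s) * cnj (k s))
          = S 1 * of_real (\<zeta> 1) * cnj (P 1)"
        using AC_integral[OF AC_mult[OF AC_mult[OF MS(2) \<zeta>AC(1)] AC_cnj[OF Pk(1)]]] Pk(4) by simp
      ultimately show ?thesis by (simp add: integral_unique algebra_simps)
    qed
    have e2: "I2 + I4 + I5 = M 1 * of_real (\<zeta>1 1) * cnj (P 1)"
    proof -
      have "((\<lambda>s. S s * of_real (\<zeta>1 s) * cnj (P s) + M s * of_real (\<zeta>2 s) * cnj (P s) + M s * of_real (\<zeta>1 s) * cnj (k s))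
          has_integral I2 + I4 + I5) {0..1}"
        unfolding I2_def I4_def I5_def
        by (intro has_integral_add integrable_integral int continuous_intros MS Pk cc)
      moreover have "integral {0..1} (\<lambda>s. (S s * of_real (\<zeta>1 s) + M s * of_real (\<zeta>2 s)) * cnj (P s) + M s * of_real (\<zeta>1 s) * cnj (k s))
          = M 1 * of_real (\<zeta>1 1) * cnj (P 1)"
        using AC_integral[OF AC_mult[OF AC_mult[OF MS(1) \<zeta>AC(2)] AC_cnj[OF Pk(1)]]] Pk(4) by simp
      ultimately show ?thesis by (simp add: integral_unique algebra_simps)
    qed
    have e3: "2 * Re I3 = g 1 * (norm (M 1))\<^sup>2 - g 0 * (norm (M 0))\<^sup>2 - integral {0..1} (\<lambda>s. g' s * (norm (M s))\<^sup>2)"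
    proof -
      have "cnj I3 = integral {0..1} (\<lambda>s. of_real (g s) * M s * cnj (S s))"
      proof -
        have "((\<lambda>s. cnj (S s * of_real (\<zeta> s) * cnj (k s))) has_integral cnj I3) {0..1}"
          unfolding I3_def by (intro has_integral_cnj' int continuous_intros MS Pk cc)
        then have "cnj I3 = integral {0..1} (\<lambda>s. cnj (S s * of_real (\<zeta> s) * cnj (k s)))" by (simp add: integral_unique)
        also have "\<dots> = integral {0..1} (\<lambda>s. of_real (g s) * M s * cnj (S s))"
          by (rule arg_cong[where f = "integral _"]) (simp add: g_def k_def fun_eq_iff)
        finally show ?thesis .
      qed
      then have "Re (cnj I3) = Re (integral {0..1} (\<lambda>s. of_real (g s) * M s * cnj (S s)))"
        by (rule arg_cong)
      then have "2 * Re I3 = 2 * Re (integral {0..1} (\<lambda>s. of_real (g s) * M s * cnj (S s)))" by simp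
      then show ?thesis using weighted_square_identity[OF MS(1,4) gd gc(2)] by simp
    qed
    have e5: "Re I5 = integral {0..1} (\<lambda>s. \<zeta>1 s * inverse (EI s) * (norm (M s))\<^sup>2)"
    proof -
      have "((\<lambda>s. Re (M s * of_real (\<zeta>1 s) * cnj (k s))) has_integral Re I5) {0..1}"
        unfolding I5_def by (intro has_integral_Re int continuous_intros MS Pk cc)
      moreover have "Re (M s * of_real (\<zeta>1 s) * cnj (k s)) = \<zeta>1 s * inverse (EI s) * (norm (M s))\<^sup>2" for s
      proof -
        have "Re (z * of_real a * cnj (of_real i * z)) = a * i * (norm z)\<^sup>2" for z and a i :: real
          unfolding cmod_power2 by (simp add: power2_eq_square algebra_simps)
        then show ?thesis by (simp only: k_def)
      qed
      ultimately show ?thesis by (simp add: integral_unique)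
    qed
    have ck1: "continuous_on {0..1} (\<lambda>s. \<zeta>1 s * inverse (EI s) * (norm (M s))\<^sup>2)"
      by (intro continuous_on_mult continuous_on_inverse continuous_on_power continuous_on_norm \<zeta>c EI_continuous MS nz)
    have ck2: "continuous_on {0..1} (\<lambda>s. g' s * (norm (M s))\<^sup>2)"
      by (intro continuous_on_mult continuous_on_power continuous_on_norm MS gc)
    note ck = ck1 ck2
    \<comment> \<open>The factor 3 consists of 2 from I5 and 1 from the derivative of \<zeta> in g'.
      The choice of N makes the coefficient of |M|^2 at least EI / EI^2, and M = EI p'' brings back
      the norm of p''.\<close>
    have pos: "E0 * (norm (fst (R x)))\<^sup>2 \<le> 2 * Re I5 + integral {0..1} (\<lambda>s. g' s * (norm (M s))\<^sup>2)"
    proof -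
      have "E0 * (norm (fst (R x)))\<^sup>2 = integral {0..1} (\<lambda>s. E0 * (norm (k s))\<^sup>2)"
        using norm_abs_l2_sq[OF Pk(3)] norm_fst_R[of x] by (simp add: k_def M_def)
      also have "\<dots> \<le> integral {0..1} (\<lambda>s. 2 * (\<zeta>1 s * inverse (EI s) * (norm (M s))\<^sup>2) + g' s * (norm (M s))\<^sup>2)"
      proof (rule integral_le)
        show "(\<lambda>s. E0 * (norm (k s))\<^sup>2) integrable_on {0..1}"
          by (intro integrable_continuous_real continuous_intros Pk)
        show "(\<lambda>s. 2 * (\<zeta>1 s * inverse (EI s) * (norm (M s))\<^sup>2) + g' s * (norm (M s))\<^sup>2) integrable_on {0..1}"
          by (intro integrable_continuous_real continuous_on_add continuous_on_mult_left ck)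
        fix s :: real assume s: "s \<in> {0..1}"
        define i where "i = inverse (EI s)"
        have i: "i > 0" "EI s * i = 1" using EI_pos[OF s] by (auto simp: i_def)
        have "E0 * (norm (k s))\<^sup>2 = (E0 * i\<^sup>2) * (norm (M s))\<^sup>2"
          using i(1) by (simp add: k_def norm_mult power_mult_distrib i_def norm_inverse)
        also have "\<dots> \<le> (2 * (\<zeta>1 s * i) + g' s) * (norm (M s))\<^sup>2"
        proof (rule mult_right_mono)
          have "E0 * i\<^sup>2 \<le> 1 * (EI s * i\<^sup>2)" using E0(1)[OF s] by (simp add: mult_right_mono)
          also have "\<dots> \<le> \<zeta> s * ((3 * N * EI s - EI' s) * i\<^sup>2)"
            using \<zeta>_ge[OF s] N[OF s] EI_pos[OF s] by (intro mult_mono mult_right_mono mult_nonneg_nonneg) auto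
          also have "\<dots> = 3 * N * \<zeta> s * (EI s * i) * i - \<zeta> s * EI' s * i\<^sup>2"
            by (simp add: power2_eq_square algebra_simps)
          also have "\<dots> = 2 * (\<zeta>1 s * i) + g' s"
            unfolding i(2) by (simp add: \<zeta>1_def g'_def i_def)
          finally show "E0 * i\<^sup>2 \<le> 2 * (\<zeta>1 s * i) + g' s" .
        qed simp
        finally show "E0 * (norm (k s))\<^sup>2 \<le> 2 * (\<zeta>1 s * inverse (EI s) * (norm (M s))\<^sup>2) + g' s * (norm (M s))\<^sup>2"
          by (simp add: i_def algebra_simps)
      qed
      also have "\<dots> = 2 * Re I5 + integral {0..1} (\<lambda>s. g' s * (norm (M s))\<^sup>2)"
        unfolding e5 using integral_add[OF integrable_continuous_real[OF continuous_on_mult_left[OF ck(1), of 2]] integrable_continuous_real[OF ck(2)]]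
        by simp
      finally show ?thesis .
    qed
    \<comment> \<open>M is replaced by EI p'', so that the bound is in terms of the norm of p in
      \<open>hl2\<close>.\<close>
    have b4: "- Re I4 \<le> K2 * norm (fst (R x)) * norm (abs_l2 P)"
    proof -
      have sqk: "sq_integrable k" by (rule sq_integrable_continuous[OF Pk(3)])
      have "l2_mult w2 (abs_l2 k) = abs_l2 (\<lambda>s. w2 s * k s)"
        by (rule l2_mult_abs[OF sqk w2c])
      then have "inner (l2_mult w2 (abs_l2 k)) (abs_l2 P) = Re (integral {0..1} (\<lambda>s. w2 s * k s * cnj (P s)))"
        using inner_abs_l2[OF sq_integrable_mult_continuous[OF sqk w2c] sq_integrable_continuous[OF Pk(2)]] by simp
      also have "integral {0..1} (\<lambda>s. w2 s * k s * cnj (P s)) = I4"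
        unfolding I4_def by (rule Henstock_Kurzweil_Integration.integral_cong) (use nz in \<open>simp add: w2_def k_def\<close>)
      finally have "\<bar>Re I4\<bar> \<le> norm (l2_mult w2 (abs_l2 k)) * norm (abs_l2 P)"
        using Cauchy_Schwarz_ineq2[of "l2_mult w2 (abs_l2 k)" "abs_l2 P"] by simp
      also have "\<dots> \<le> norm (abs_l2 k) * K2 * norm (abs_l2 P)"
        using K2(2) by (rule mult_right_mono) simp
      also have "norm (abs_l2 k) = norm (fst (R x))" using norm_fst_R[of x] by (simp add: k_def M_def)
      finally show ?thesis by (simp add: mult_ac)
    qed
    \<comment> \<open>S(1) = m \<lambda> and M(1) = - J \<mu> belong to \<open>obs 0 x\<close>, and
      p'(1) to \<open>obs 2 x\<close>. So all boundary terms are observations except the one with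
      M(0), which has a favourable sign.\<close>
    define o0 o2 where "o0 = norm (obs 0 x)" and "o2 = norm (obs 2 x)"
    have o0: "norm (S 1) \<le> m * o0" "norm (M 1) \<le> J * o0"
      using m_pos J_pos norm_fst_le[of "fst (snd (snd x))" "snd (snd (snd x))"]
        norm_snd_le[of "snd (snd (snd x))" "fst (snd (snd x))"]
      by (simp_all add: S_def M_def shear_1 moment_1 norm_mult o0_def obs_0)
    have o2: "norm (P 1) \<le> o2"
      using norm_snd_le[of "hU1 (fst (R x)) 1" "hU0 (fst (R x)) 1"] obs_Suc[of 1 x]
      by (simp add: P_def o2_def numeral_2_eq_2)
    have oo: "0 \<le> o0" "0 \<le> o2" by (auto simp: o0_def o2_def)
    have o02: "o0 * o2 \<le> o0\<^sup>2 + o2\<^sup>2"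
    proof -
      have "0 \<le> o0 * o2" using oo by simp
      then show ?thesis using sum_squares_bound[of o0 o2] by linarith
    qed
    have bS: "\<bar>Re (S 1 * of_real (\<zeta> 1) * cnj (P 1))\<bar> \<le> m * \<zeta> 1 * (o0 * o2)"
    proof -
      have "\<bar>Re (S 1 * of_real (\<zeta> 1) * cnj (P 1))\<bar> \<le> norm (S 1 * of_real (\<zeta> 1) * cnj (P 1))" by (rule abs_Re_le_cmod)
      also have "\<dots> = \<zeta> 1 * (norm (S 1) * norm (P 1))" using \<zeta>1 by (simp add: norm_mult)
      also have "\<dots> \<le> \<zeta> 1 * (m * o0 * o2)" using o0 o2 \<zeta>1 m_pos oo by (intro mult_left_mono mult_mono) auto
      finally show ?thesis by (simp add: mult_ac)
    qed
    have bM: "\<bar>Re (M 1 * of_real (\<zeta>1 1) * cnj (P 1))\<bar> \<le> J * \<zeta>1 1 * (o0 * o2)"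
    proof -
      have "\<bar>Re (M 1 * of_real (\<zeta>1 1) * cnj (P 1))\<bar> \<le> norm (M 1 * of_real (\<zeta>1 1) * cnj (P 1))" by (rule abs_Re_le_cmod)
      also have "\<dots> = \<zeta>1 1 * (norm (M 1) * norm (P 1))" using \<zeta>1 by (simp add: norm_mult)
      also have "\<dots> \<le> \<zeta>1 1 * (J * o0 * o2)" using o0 o2 \<zeta>1 J_pos oo by (intro mult_left_mono mult_mono) auto
      finally show ?thesis by (simp add: mult_ac)
    qed
    have bg: "g 1 * (norm (M 1))\<^sup>2 \<le> g 1 * J\<^sup>2 * o0\<^sup>2"
      using mult_left_mono[OF power_mono[OF o0(2), of 2] g1(1)] by (simp add: power_mult_distrib)
    have bg0: "0 \<le> g 0 * (norm (M 0))\<^sup>2" "0 \<le> g 1 * J\<^sup>2 * o0\<^sup>2" using g1 by auto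
    have "I1 = I3 + (M 1 * of_real (\<zeta>1 1) * cnj (P 1) - I4 - I5) - S 1 * of_real (\<zeta> 1) * cnj (P 1)"
      using e1 e2 by (simp add: algebra_simps) (metis add.commute add.left_commute)
    then have "Re I1 = Re I3 + (Re (M 1 * of_real (\<zeta>1 1) * cnj (P 1)) - Re I4 - Re I5) - Re (S 1 * of_real (\<zeta> 1) * cnj (P 1))"
      by (simp only: plus_complex.sel minus_complex.sel)
    then have "Re I1 \<le> - (E0 * (norm (fst (R x)))\<^sup>2) / 2 + g 1 * J\<^sup>2 * o0\<^sup>2 + K2 * norm (fst (R x)) * norm (abs_l2 P)
        + J * \<zeta>1 1 * (o0 * o2) + m * \<zeta> 1 * (o0 * o2)"
      using e3 pos b4 bM bS bg bg0 by linarith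
    also have "\<dots> \<le> - (E0 * (norm (fst (R x)))\<^sup>2) / 2 + g 1 * J\<^sup>2 * (o0\<^sup>2 + o2\<^sup>2) + K * norm (fst (R x)) * norm (abs_l2 P)
        + J * \<zeta>1 1 * (o0\<^sup>2 + o2\<^sup>2) + m * \<zeta> 1 * (o0\<^sup>2 + o2\<^sup>2)"
      using nn o02 K by (intro add_mono mult_left_mono mult_right_mono order_refl) auto
    also have "\<dots> \<le> - (E0 / 2) * (norm (fst (R x)))\<^sup>2 + K * norm (fst (R x)) * norm (abs_l2 P) + K * (o0\<^sup>2 + o2\<^sup>2)"
      using K2(1) mult_nonneg_nonneg[of K2 "o0\<^sup>2 + o2\<^sup>2"] by (simp add: K_def algebra_simps)
    finally show ?thesis unfolding V P_def o0_def o2_def .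
  qed
  with K(1) show ?thesis by blast
qed

text \<open>Interpolation between p'' and p, where p is the displacement of \<open>R x\<close>: the
  integral of |p'|^2 is p'(1) cnj (p(1)) minus that of p'' cnj p. Since p is the velocity component
  of \<open>R (R x)\<close>, its L^2 norm is at most |R (R x)|.\<close>

lemma norm_hU1_R: "(norm (abs_l2 (hU1 (fst (R x)))))\<^sup>2 \<le> (norm (obs 2 x))\<^sup>2 + norm (fst (R x)) * norm (R (R x))"
proof -
  define p where "p = fst (R x)"
  define k where "k = (\<lambda>s. iEI s * moment x s)"
  have kc: "continuous_on {0..1} k" using curvature_continuous[of x] by (simp add: k_def)
  have AC: "AC (hU1 p) k" using AC_hU1_R[of x] by (simp add: p_def k_def)
  have "((\<lambda>s. k s * cnj (hU0 p s) + hU1 p s * cnj (hU1 p s)) has_integral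
      integral {0..1} (\<lambda>s. k s * cnj (hU0 p s)) + integral {0..1} (\<lambda>s. hU1 p s * cnj (hU1 p s))) {0..1}"
    by (intro has_integral_add integrable_integral integrable_continuous_real continuous_intros hU_continuous kc)
  moreover have "integral {0..1} (\<lambda>s. k s * cnj (hU0 p s) + hU1 p s * cnj (hU1 p s)) = hU1 p 1 * cnj (hU0 p 1)"
    using AC_integral[OF AC_mult[OF AC AC_cnj[OF AC_hU0[of p]]]] by simp
  ultimately have "integral {0..1} (\<lambda>s. k s * cnj (hU0 p s)) + integral {0..1} (\<lambda>s. hU1 p s * cnj (hU1 p s)) = hU1 p 1 * cnj (hU0 p 1)"
    by (simp add: integral_unique)
  then have "Re (integral {0..1} (\<lambda>s. hU1 p s * cnj (hU1 p s))) = Re (hU1 p 1 * cnj (hU0 p 1)) - Re (integral {0..1} (\<lambda>s. k s * cnj (hU0 p s)))"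
    by (metis add_diff_cancel_left' minus_complex.sel(1))
  moreover have "Re (integral {0..1} (\<lambda>s. hU1 p s * cnj (hU1 p s))) = (norm (abs_l2 (hU1 p)))\<^sup>2"
    using inner_abs_l2[of "hU1 p" "hU1 p"] sq_integrable_continuous[OF hU_continuous(2)] by (simp add: power2_norm_eq_inner)
  moreover have "- Re (integral {0..1} (\<lambda>s. k s * cnj (hU0 p s))) \<le> norm p * norm (R (R x))"
  proof -
    have "Re (integral {0..1} (\<lambda>s. k s * cnj (hU0 p s))) = inner (abs_l2 k) (l2_of_hl2 p)"
      unfolding l2_of_hl2_eq using inner_abs_l2[OF sq_integrable_continuous[OF kc] sq_integrable_continuous[OF hU_continuous(1)]] by simp
    moreover have "\<bar>inner (abs_l2 k) (l2_of_hl2 p)\<bar> \<le> norm (abs_l2 k) * norm (l2_of_hl2 p)" by (rule Cauchy_Schwarz_ineq2)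
    moreover have "norm (abs_l2 k) = norm p" using norm_fst_R[of x] by (simp add: k_def p_def)
    moreover have "norm (l2_of_hl2 p) \<le> norm (R (R x))"
    proof (rule power2_le_imp_le)
      show "(norm (l2_of_hl2 p))\<^sup>2 \<le> (norm (R (R x)))\<^sup>2" using norm_R_sq[of "R x"] by (simp add: p_def)
    qed simp
    then have "norm p * norm (l2_of_hl2 p) \<le> norm p * norm (R (R x))" by (rule mult_left_mono) simp
    ultimately show ?thesis by simp
  qed
  moreover have "Re (hU1 p 1 * cnj (hU0 p 1)) \<le> (norm (obs 2 x))\<^sup>2"
  proof -
    have "Re (hU1 p 1 * cnj (hU0 p 1)) \<le> norm (hU1 p 1) * norm (hU0 p 1)"
      using complex_Re_le_cmod[of "hU1 p 1 * cnj (hU0 p 1)"] by (simp add: norm_mult)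
    also have "\<dots> \<le> (norm (hU0 p 1))\<^sup>2 + (norm (hU1 p 1))\<^sup>2"
    proof -
      have "0 \<le> norm (hU1 p 1) * norm (hU0 p 1)" by simp
      then show ?thesis using sum_squares_bound[of "norm (hU1 p 1)" "norm (hU0 p 1)"] by linarith
    qed
    also have "\<dots> = (norm (obs 2 x))\<^sup>2"
      using obs_Suc[of 1 x] by (simp add: p_def norm_Pair numeral_2_eq_2)
    finally show ?thesis .
  qed
  ultimately show ?thesis by (simp add: p_def)
qed

lemma key_estimate:
  "\<exists>V \<epsilon> C. bounded_bilinear V \<and> \<epsilon> > 0 \<and> (\<forall>x. V x (R x) + V (R x) x \<le>
     - \<epsilon> * (norm (R x))\<^sup>2 + C * ((\<Sum>j\<le>2. (norm (obs j x))\<^sup>2) + (norm (R (R x)))\<^sup>2))"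
proof -
  obtain N0 where N0: "\<And>s. s \<in> {0..1} \<Longrightarrow> \<rho> s \<le> N0 * \<rho> s + \<rho>' s" "\<And>s. s \<in> {0..1} \<Longrightarrow> EI s \<le> 3 * N0 * EI s - EI' s"
    using weight_exists by blast
  define N where "N = max N0 0"
  have N: "\<rho> s \<le> N * \<rho> s + \<rho>' s" "EI s \<le> 3 * N * EI s - EI' s" if "s \<in> {0..1}" for s
  proof -
    have "N0 * \<rho> s \<le> N * \<rho> s" "N0 * EI s \<le> N * EI s"
      using \<rho>_pos[OF that] EI_pos[OF that] by (auto simp: N_def intro!: mult_right_mono)
    then show "\<rho> s \<le> N * \<rho> s + \<rho>' s" "EI s \<le> 3 * N * EI s - EI' s" using N0[OF that] by linarith+
  qed
  have N': "N \<ge> 0" by (simp add: N_def)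
  have low: "\<exists>g0>0. \<forall>s\<in>{0..1}. g0 \<le> g s" if gc: "continuous_on {0..1} g" and gp: "\<And>s. s \<in> {0..1} \<Longrightarrow> g s > 0" for g :: "real \<Rightarrow> real"
  proof -
    obtain s0 where "s0 \<in> {0..1}" "\<And>s. s \<in> {0..1} \<Longrightarrow> g s0 \<le> g s"
      using continuous_attains_inf[OF _ _ gc] by force
    then show ?thesis using gp by (intro exI[of _ "g s0"]) auto
  qed
  obtain \<rho>0 where \<rho>0: "\<rho>0 > 0" "\<And>s. s \<in> {0..1} \<Longrightarrow> \<rho>0 \<le> \<rho> s" using low[OF \<rho>_continuous \<rho>_pos] by blast
  obtain E0 where E0: "E0 > 0" "\<And>s. s \<in> {0..1} \<Longrightarrow> E0 \<le> EI s" using low[OF EI_continuous EI_pos] by blast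
  obtain K where K: "K > 0" "\<And>x. multiplier_form N (R x) x \<le> - (E0 / 2) * (norm (fst (R x)))\<^sup>2
    + K * norm (fst (R x)) * norm (abs_l2 (hU1 (fst (R x)))) + K * ((norm (obs 0 x))\<^sup>2 + (norm (obs 2 x))\<^sup>2)"
    using multiplier_second[OF N(2) N' E0(2,1)] by blast
  \<comment> \<open>Of the E0 / 2 in \<open>multiplier_second\<close>, two applications of Young's
    inequality take E0 / 8 each. The constant C below also contains \<epsilon>, because |R x|^2
    includes the observation \<open>obs 1 x\<close>, for which the multiplier gives no
    dissipation.\<close>
  define \<epsilon> where "\<epsilon> = min (E0 / 4) (\<rho>0 / 2)"
  define A where "A = 2 * K\<^sup>2 / E0"
  define C where "C = exp N * \<rho> 1 + \<epsilon> + K + A + 2 * A\<^sup>2 / E0"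
  have \<epsilon>: "\<epsilon> > 0" "\<epsilon> \<le> E0 / 4" "\<epsilon> \<le> \<rho>0 / 2" using E0 \<rho>0 by (auto simp: \<epsilon>_def)
  have A: "A > 0" using K E0 by (simp add: A_def)
  have pos: "0 \<le> exp N * \<rho> 1" "0 \<le> 2 * A\<^sup>2 / E0" using \<rho>_pos[of 1] E0 by auto
  have "multiplier_form N x (R x) + multiplier_form N (R x) x \<le>
     - \<epsilon> * (norm (R x))\<^sup>2 + C * ((\<Sum>j\<le>2. (norm (obs j x))\<^sup>2) + (norm (R (R x)))\<^sup>2)" for x
  proof -
    define a b q r where "a = norm (fst (R x))" and "b = norm (l2_of_hl2 (fst x))"
      and "q = norm (abs_l2 (hU1 (fst (R x))))" and "r = norm (R (R x))"
    define o0 o1 o2 where "o0 = (norm (obs 0 x))\<^sup>2" and "o1 = (norm (obs 1 x))\<^sup>2" and "o2 = (norm (obs 2 x))\<^sup>2"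
    have nn: "0 \<le> o0" "0 \<le> o1" "0 \<le> o2" "0 \<le> r\<^sup>2" "0 \<le> a\<^sup>2" "0 \<le> b\<^sup>2" by (auto simp: o0_def o1_def o2_def)
    have young: "t * k \<le> E0 / 8 * t\<^sup>2 + 2 / E0 * k\<^sup>2" for t k
    proof -
      have "0 \<le> (E0 * t - 4 * k)\<^sup>2 / (8 * E0)" using E0(1) by simp
      also have "\<dots> = E0 / 8 * t\<^sup>2 + 2 / E0 * k\<^sup>2 - t * k" using E0(1) by (simp add: power2_eq_square field_simps)
      finally show ?thesis by simp
    qed
    have s: "(\<Sum>j\<le>2. (norm (obs j x))\<^sup>2) = o0 + o1 + o2"
      by (simp add: o0_def o1_def o2_def numeral_2_eq_2)
    have "multiplier_form N x (R x) \<le> exp N * \<rho> 1 * o1 / 2 - \<rho>0 / 2 * b\<^sup>2"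
      using multiplier_first[OF N(1) N' \<rho>0(2,1), of x] by (simp add: b_def o1_def)
    moreover have "multiplier_form N (R x) x \<le> - (E0 / 2) * a\<^sup>2 + K * a * q + K * (o0 + o2)"
      using K(2)[of x] by (simp add: a_def q_def o0_def o2_def)
    moreover have "K * a * q \<le> E0 / 4 * a\<^sup>2 + A * o2 + 2 * A\<^sup>2 / E0 * r\<^sup>2"
    proof -
      have "K * a * q = a * (K * q)" by simp
      also have "\<dots> \<le> E0 / 8 * a\<^sup>2 + 2 / E0 * (K * q)\<^sup>2" by (rule young)
      also have "2 / E0 * (K * q)\<^sup>2 = A * q\<^sup>2" by (simp add: A_def power_mult_distrib)
      also have "A * q\<^sup>2 \<le> A * (o2 + a * r)"
        using norm_hU1_R[of x] A by (intro mult_left_mono) (auto simp: q_def o2_def a_def r_def)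
      also have "A * (o2 + a * r) = A * o2 + a * (A * r)" by (simp add: algebra_simps)
      also have "a * (A * r) \<le> E0 / 8 * a\<^sup>2 + 2 / E0 * (A * r)\<^sup>2" by (rule young)
      finally show ?thesis by (simp add: power_mult_distrib)
    qed
    ultimately have "multiplier_form N x (R x) + multiplier_form N (R x) x \<le>
      - (E0 / 4) * a\<^sup>2 - \<rho>0 / 2 * b\<^sup>2 + exp N * \<rho> 1 * o1 / 2 + K * (o0 + o2) + A * o2 + 2 * A\<^sup>2 / E0 * r\<^sup>2"
      by linarith
    also have "\<dots> \<le> - \<epsilon> * a\<^sup>2 - \<epsilon> * b\<^sup>2 + exp N * \<rho> 1 * o1 + K * (o0 + o2) + A * o2 + 2 * A\<^sup>2 / E0 * r\<^sup>2"
      using mult_right_mono[OF \<epsilon>(2) nn(5)] mult_right_mono[OF \<epsilon>(3) nn(6)] mult_nonneg_nonneg[OF pos(1) nn(2)] by linarith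
    also have "\<dots> \<le> - \<epsilon> * a\<^sup>2 - \<epsilon> * b\<^sup>2 - \<epsilon> * o1 + C * (o0 + o1 + o2 + r\<^sup>2)"
    proof -
      have "0 \<le> exp N * \<rho> 1 * t" "0 \<le> \<epsilon> * t" "0 \<le> K * t" "0 \<le> A * t" "0 \<le> 2 * A\<^sup>2 / E0 * t" if "0 \<le> t" for t
        using that \<epsilon>(1) K(1) A by (auto intro!: mult_nonneg_nonneg[OF pos(1)] mult_nonneg_nonneg[OF pos(2)] simp del: times_divide_eq_left)
      note this[OF nn(1)] this[OF nn(2)] this[OF nn(3)] this[OF nn(4)]
      then show ?thesis unfolding C_def distrib_right distrib_left by linarith
    qed
    also have "\<dots> = - \<epsilon> * (norm (R x))\<^sup>2 + C * ((\<Sum>j\<le>2. (norm (obs j x))\<^sup>2) + (norm (R (R x)))\<^sup>2)"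
      unfolding s norm_R_sq[of x] by (simp add: a_def b_def o1_def r_def algebra_simps)
    finally show ?thesis .
  qed
  then show ?thesis using bounded_bilinear_multiplier_form \<epsilon>(1) by blast
qed

end

section \<open>The low-frequency estimate\<close>

text \<open>The integral runs from s to 1, where the weight exp (N (1 - s)) is smallest. The
  exponential thereby gains the factor 1 / N, whereas constants gain nothing.\<close>

lemma AC_exp_bound:
  assumes F: "AC F f" and f: "continuous_on {0..1} f" and "N \<ge> 1" "0 \<le> a" "0 \<le> b"
    and bound: "\<And>s. s \<in> {0..1} \<Longrightarrow> norm (f s) \<le> a + b * exp (N * (1 - s))" and s: "s \<in> {0..1}"
  shows "norm (F s) \<le> norm (F 1) + a + b / N * exp (N * (1 - s))"
proof -
  have "integral {0..s} f + integral {s..1} f = integral {0..1} f"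
    using s by (intro Henstock_Kurzweil_Integration.integral_combine integrable_continuous_real f) auto
  then have Fs: "F s = F 1 - integral {s..1} f"
    using AC_eq[OF F s] AC_eq[OF F, of 1] by (simp add: eq_diff_eq)
  have "((\<lambda>r. a + b * exp (N * (1 - r))) has_integral
      (a * 1 - b / N * exp (N * (1 - 1))) - (a * s - b / N * exp (N * (1 - s)))) {s..1}"
    using s \<open>N \<ge> 1\<close>
    by (intro fundamental_theorem_of_calculus)
      (auto intro!: derivative_eq_intros simp flip: has_real_derivative_iff_has_vector_derivative)
  note hi = this
  have "norm (integral {s..1} f) \<le> integral {s..1} (\<lambda>r. a + b * exp (N * (1 - r)))"
  proof (rule integral_norm_bound_integral)
    show "f integrable_on {s..1}"
      using s by (intro integrable_continuous_real continuous_on_subset[OF f]) auto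
    show "(\<lambda>r. a + b * exp (N * (1 - r))) integrable_on {s..1}" using hi by (rule has_integral_integrable)
  qed (use bound s in auto)
  also have "\<dots> = (a * 1 - b / N * exp (N * (1 - 1))) - (a * s - b / N * exp (N * (1 - s)))"
    using hi by (rule integral_unique)
  also have "\<dots> \<le> a + b / N * exp (N * (1 - s))"
  proof -
    have "0 \<le> b / N" "0 \<le> a * s" using assms s by auto
    then show ?thesis by simp
  qed
  finally show ?thesis using norm_triangle_ineq4[of "F 1" "integral {s..1} f"] by (simp add: Fs)
qed

context beam
begin

text \<open>The velocity of \<open>R y\<close> is the displacement of y. So the shear has a
  continuous derivative in place of a representative of a class in \<open>l2\<close>, as pointwise
  bounds require.\<close>

lemma AC_shear_R: "AC (shear (R y)) (\<lambda>s. - (c\<rho> s * hU0 (fst y) s))"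
proof -
  define w where "w = (\<lambda>s. c\<rho> s * hU0 (fst y) s)"
  have wc: "continuous_on {0..1} w" unfolding w_def by (intro continuous_on_mult coefficient_continuous hU_continuous)
  then have w: "sq_integrable w" by (rule sq_integrable_continuous)
  have l: "l2_mult c\<rho> (fst (snd (R y))) = abs_l2 w"
    unfolding R_def fst_conv snd_conv l2_of_hl2_eq w_def
    by (intro l2_mult_abs sq_integrable_continuous hU_continuous coefficient_continuous)
  have "AC (\<lambda>s. shear (R y) 0 + integral {0..s} (\<lambda>s. - w s)) (\<lambda>s. - w s)"
    using sq_integrable_cmult[OF w, of "- 1"] by (intro AC_primitive) simp
  then have "AC (shear (R y)) (\<lambda>s. - w s)"
    by (rule AC_cong) (simp_all add: shear_def l integral_rep_l2[OF w])
  then show ?thesis by (simp add: w_def)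
qed

text \<open>A weighted supremum bound on the displacement with a weight that decreases towards the
  tip; in such norms a Volterra operator acting from the tip is of size O(1/N).\<close>

definition exp_bounded :: "real \<Rightarrow> real \<Rightarrow> state \<Rightarrow> bool" where
  "exp_bounded N M y \<longleftrightarrow> (\<forall>s\<in>{0..1}. norm (hU0 (fst y) s) \<le> M * exp (N * (1 - s)))"

lemma exp_bounded_mono: "exp_bounded N M y \<Longrightarrow> M \<le> M' \<Longrightarrow> exp_bounded N M' y"
  unfolding exp_bounded_def by (meson exp_ge_zero mult_right_mono order_trans)

lemma exp_bounded_nonneg:
  assumes "exp_bounded N M y"
  shows "0 \<le> M"
  using assms[unfolded exp_bounded_def, rule_format, of 1] order_trans[OF norm_ge_zero] by fastforce

lemma norm_obs: "norm (fst (obs j y)) \<le> norm (obs j y)" "norm (snd (obs j y)) \<le> norm (obs j y)"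
  using norm_fst_le[of "fst (obs j y)" "snd (obs j y)"] norm_snd_le[of "snd (obs j y)" "fst (obs j y)"] by simp_all

text \<open>The displacement of y is integrated twice from the tip, with \<rho> and 1/EI as
  coefficients, and the values at the tip come from \<open>obs 1 y\<close>. Each integration gains 1
  / N; one gain is enough and the other is given up.\<close>

lemma curvature_bound:
  assumes \<rho>1: "\<And>s. s \<in> {0..1} \<Longrightarrow> \<rho> s \<le> \<rho>1" and E0: "\<And>s. s \<in> {0..1} \<Longrightarrow> E0 \<le> EI s" "E0 > 0"
    and "N \<ge> 1" and M: "exp_bounded N M y" and s: "s \<in> {0..1}"
  shows "norm (iEI s * moment (R y) s) \<le> (J + m) / E0 * norm (obs 1 y) + \<rho>1 / E0 / N * M * exp (N * (1 - s))"
proof -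
  define o1 where "o1 = norm (obs 1 y)"
  have o1: "norm (hU0 (fst y) 1) \<le> o1" "norm (hU1 (fst y) 1) \<le> o1" "0 \<le> o1"
    using norm_obs[of 1 y] obs_Suc[of 0 y] by (simp_all add: o1_def)
  have \<rho>1_pos: "\<rho>1 > 0" using \<rho>1[of 1] \<rho>_pos[of 1] by simp
  have M0: "0 \<le> M" using M by (rule exp_bounded_nonneg)
  have wb: "norm (- (c\<rho> s * hU0 (fst y) s)) \<le> 0 + \<rho>1 * M * exp (N * (1 - s))" if "s \<in> {0..1}" for s
  proof -
    have "\<rho> s * norm (hU0 (fst y) s) \<le> \<rho>1 * (M * exp (N * (1 - s)))"
      using M[unfolded exp_bounded_def, rule_format, OF that] \<rho>1[OF that] \<rho>_pos[OF that] \<rho>1_pos by (intro mult_mono) auto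
    then show ?thesis using \<rho>_pos[OF that] by (simp add: norm_mult)
  qed
  have wc: "continuous_on {0..1} (\<lambda>s. - (c\<rho> s * hU0 (fst y) s))"
    by (intro continuous_on_minus continuous_on_mult coefficient_continuous hU_continuous)
  have rM: "0 \<le> \<rho>1 * M" using \<rho>1_pos M0 by simp
  have sh: "norm (shear (R y) s) \<le> m * o1 + \<rho>1 * M / N * exp (N * (1 - s))" if "s \<in> {0..1}" for s
  proof -
    have "norm (shear (R y) s) \<le> norm (shear (R y) 1) + 0 + \<rho>1 * M / N * exp (N * (1 - s))"
      by (rule AC_exp_bound[OF AC_shear_R wc \<open>N \<ge> 1\<close> order_refl rM wb that])
    moreover have "norm (shear (R y) 1) \<le> m * o1"
      using o1 m_pos by (simp add: shear_1 R_def norm_mult)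
    ultimately show ?thesis by simp
  qed
  have mo: "norm (moment (R y) s) \<le> (J + m) * o1 + \<rho>1 * M / N * exp (N * (1 - s))"
  proof -
    have "norm (moment (R y) s) \<le> norm (moment (R y) 1) + m * o1 + \<rho>1 * M / N / N * exp (N * (1 - s))"
      using s \<rho>1_pos M0 m_pos o1 \<open>N \<ge> 1\<close>
      by (intro AC_exp_bound[OF AC_moment _ \<open>N \<ge> 1\<close> _ _ sh] moment_continuous) auto
    moreover have "norm (moment (R y) 1) \<le> J * o1"
      using o1 J_pos by (simp add: moment_1 R_def norm_mult)
    moreover have "\<rho>1 * M / N / N * exp (N * (1 - s)) \<le> \<rho>1 * M / N * exp (N * (1 - s))"
    proof (rule mult_right_mono)
      have "\<rho>1 * M / N / N \<le> \<rho>1 * M / N / 1" using \<rho>1_pos M0 \<open>N \<ge> 1\<close> by (intro divide_left_mono) auto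
      then show "\<rho>1 * M / N / N \<le> \<rho>1 * M / N" by simp
    qed simp
    ultimately show ?thesis by (simp add: distrib_right)
  qed
  have "norm (iEI s * moment (R y) s) = norm (moment (R y) s) / EI s"
    using EI_pos[OF s] by (simp add: norm_mult norm_inverse divide_inverse mult.commute)
  also have "\<dots> \<le> norm (moment (R y) s) / E0"
    using E0 EI_pos[OF s] s by (intro divide_left_mono) auto
  also have "\<dots> \<le> ((J + m) * o1 + \<rho>1 * M / N * exp (N * (1 - s))) / E0"
    using mo E0(2) by (intro divide_right_mono) auto
  also have "\<dots> = (J + m) / E0 * o1 + \<rho>1 / E0 / N * M * exp (N * (1 - s))"
    using E0(2) by (simp add: field_simps)
  finally show ?thesis by (simp add: o1_def)
qed

text \<open>Integrating from the observed end \<open>x = 1\<close>, the map \<open>R\<^sup>2\<close> acts on the first component as a Volterra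
  operator up to boundary data, so that the weight \<open>exp (N (1 - s))\<close> gains a factor \<open>1/N\<close>.\<close>

lemma exp_bounded_step:
  assumes \<rho>1: "\<And>s. s \<in> {0..1} \<Longrightarrow> \<rho> s \<le> \<rho>1" and E0: "\<And>s. s \<in> {0..1} \<Longrightarrow> E0 \<le> EI s" "E0 > 0"
    and "N \<ge> 1" and M: "exp_bounded N M y"
  shows "exp_bounded N (\<rho>1 / E0 / N * M + ((J + m) / E0 + 2) * (norm (obs 1 y) + norm (obs 3 y))) (R (R y))"
  unfolding exp_bounded_def
proof
  fix s :: real assume s: "s \<in> {0..1}"
  define p where "p = fst (R (R y))"
  define a where "a = (J + m) / E0 * norm (obs 1 y)"
  define b where "b = \<rho>1 / E0 / N * M"
  have \<rho>1_pos: "\<rho>1 > 0" using \<rho>1[of 1] \<rho>_pos[of 1] by simp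
  have M0: "0 \<le> M" using M by (rule exp_bounded_nonneg)
  have ab: "0 \<le> a" "0 \<le> b" using J_pos m_pos E0(2) \<rho>1_pos M0 \<open>N \<ge> 1\<close> by (auto simp: a_def b_def)
  have bN: "b / N \<le> b" using ab \<open>N \<ge> 1\<close> by (simp add: divide_le_eq mult_left_mono[of 1 N b, simplified])
  have o3: "norm (hU0 p 1) \<le> norm (obs 3 y)" "norm (hU1 p 1) \<le> norm (obs 3 y)"
    using norm_obs[of 3 y] obs_Suc[of 2 y] by (simp_all add: p_def numeral_2_eq_2 numeral_3_eq_3)
  have 1: "norm (hU1 p s) \<le> (norm (obs 3 y) + a) + b * exp (N * (1 - s))" if "s \<in> {0..1}" for s
  proof -
    have "norm (iEI s * moment (R y) s) \<le> a + b * exp (N * (1 - s))" if "s \<in> {0..1}" for s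
      unfolding a_def b_def by (rule curvature_bound[OF \<rho>1 E0 \<open>N \<ge> 1\<close> M that])
    from AC_exp_bound[OF AC_hU1_R curvature_continuous \<open>N \<ge> 1\<close> ab this that]
    have "norm (hU1 p s) \<le> norm (hU1 p 1) + a + b / N * exp (N * (1 - s))"
      unfolding p_def .
    moreover have "b / N * exp (N * (1 - s)) \<le> b * exp (N * (1 - s))" using bN by (rule mult_right_mono) simp
    ultimately show ?thesis using o3 by linarith
  qed
  have "norm (hU0 p s) \<le> norm (hU0 p 1) + (norm (obs 3 y) + a) + b / N * exp (N * (1 - s))"
    using ab s by (intro AC_exp_bound[OF AC_hU0 hU_continuous(2) \<open>N \<ge> 1\<close>] 1) auto
  also have "\<dots> \<le> (2 * norm (obs 3 y) + a) * 1 + b * exp (N * (1 - s))"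
    using o3 mult_right_mono[OF bN, of "exp (N * (1 - s))"] by simp
  \<comment> \<open>Constants are absorbed by the weight, which is at least 1.\<close>
  also have "\<dots> \<le> (2 * norm (obs 3 y) + a) * exp (N * (1 - s)) + b * exp (N * (1 - s))"
    using ab s \<open>N \<ge> 1\<close> by (intro add_mono mult_left_mono order_refl) auto
  also have "\<dots> \<le> (b + ((J + m) / E0 + 2) * (norm (obs 1 y) + norm (obs 3 y))) * exp (N * (1 - s))"
  proof -
    have "0 \<le> (J + m) / E0 * norm (obs 3 y)" using J_pos m_pos E0(2) by simp
    then have "2 * norm (obs 3 y) + a + b \<le> b + ((J + m) / E0 + 2) * (norm (obs 1 y) + norm (obs 3 y))"
      unfolding a_def distrib_right distrib_left using norm_ge_zero[of "obs 1 y"] by linarith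
    then show ?thesis unfolding distrib_right[symmetric] by (intro mult_right_mono) (auto simp: add.commute)
  qed
  finally show "norm (hU0 (fst (R (R y))) s) \<le> (\<rho>1 / E0 / N * M + ((J + m) / E0 + 2) * (norm (obs 1 y) + norm (obs 3 y))) * exp (N * (1 - s))"
    by (simp only: p_def b_def)
qed

lemma obs_funpow: "obs j ((R ^^ n) y) = obs (j + n) y"
  by (simp add: obs_def funpow_add)

text \<open>The coefficient of |y| is exactly \<theta>^k, while C may grow with k. Each step adds
  the observations 1 and 3 of R^(2k) y, that is, those of index 2k + 1 and 2k + 3 of y.\<close>

lemma exp_bounded_iterate:
  assumes "\<And>s. s \<in> {0..1} \<Longrightarrow> \<rho> s \<le> \<rho>1" and "\<And>s. s \<in> {0..1} \<Longrightarrow> E0 \<le> EI s" "E0 > 0" and "N \<ge> 1"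
    and \<theta>: "\<rho>1 / E0 / N \<le> \<theta>"
  shows "\<exists>C\<ge>0. \<forall>y. exp_bounded N (\<theta> ^ k * norm y + C * (\<Sum>j\<le>2 * k + 1. norm (obs j y))) ((R ^^ (2 * k)) y)"
proof (induction k)
  case 0
  have "exp_bounded N (norm y) y" for y
    unfolding exp_bounded_def
  proof
    fix s :: real assume s: "s \<in> {0..1}"
    have "norm (hU0 (fst y) s) \<le> norm (fst y)" using s by (rule norm_hU0_le)
    also have "\<dots> \<le> norm y * 1" using norm_fst_le[of "fst y" "snd y"] by simp
    also have "\<dots> \<le> norm y * exp (N * (1 - s))" using s \<open>N \<ge> 1\<close> by (intro mult_left_mono) auto
    finally show "norm (hU0 (fst y) s) \<le> norm y * exp (N * (1 - s))" .
  qed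
  then show ?case by (intro exI[of _ 0]) simp
next
  case (Suc k)
  then obtain C where C: "C \<ge> 0" "\<And>y. exp_bounded N (\<theta> ^ k * norm y + C * (\<Sum>j\<le>2 * k + 1. norm (obs j y))) ((R ^^ (2 * k)) y)"
    by auto
  define D where "D = (J + m) / E0 + 2"
  have D: "D \<ge> 0" using J_pos m_pos assms(3) by (simp add: D_def)
  have \<theta>0: "\<theta> \<ge> 0"
    using \<theta> assms(1)[of 1] \<rho>_pos[of 1] assms(3,4) by (smt (verit) atLeastAtMost_iff divide_nonneg_nonneg)
  have "exp_bounded N (\<theta> ^ Suc k * norm y + (\<theta> * C + D) * (\<Sum>j\<le>2 * Suc k + 1. norm (obs j y))) ((R ^^ (2 * Suc k)) y)" for y
  proof -
    define z where "z = (R ^^ (2 * k)) y"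
    define S where "S = (\<Sum>j\<le>2 * k + 1. norm (obs j y))"
    define S' where "S' = (\<Sum>j\<le>2 * Suc k + 1. norm (obs j y))"
    have S: "S \<le> S'" unfolding S_def S'_def by (intro sum_mono2) auto
    have S0: "0 \<le> S" by (simp add: S_def sum_nonneg)
    have o: "norm (obs (2 * k + 1) y) + norm (obs (2 * k + 3) y) \<le> S'"
    proof -
      have "(\<Sum>j\<in>{2 * k + 1, 2 * k + 3}. norm (obs j y)) \<le> S'"
        unfolding S'_def by (intro sum_mono2) auto
      then show ?thesis by simp
    qed
    have z13: "obs 1 z = obs (2 * k + 1) y" "obs 3 z = obs (2 * k + 3) y"
      by (simp_all add: z_def obs_funpow add.commute)
    have "exp_bounded N (\<rho>1 / E0 / N * (\<theta> ^ k * norm y + C * S) + D * (norm (obs 1 z) + norm (obs 3 z))) (R (R z))"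
      unfolding D_def by (rule exp_bounded_step[OF assms(1-4) C(2)[of y, folded z_def S_def]])
    moreover have "\<rho>1 / E0 / N * (\<theta> ^ k * norm y + C * S) + D * (norm (obs 1 z) + norm (obs 3 z))
       \<le> \<theta> ^ Suc k * norm y + (\<theta> * C + D) * S'"
    proof -
      have "\<rho>1 / E0 / N * (\<theta> ^ k * norm y + C * S) \<le> \<theta> * (\<theta> ^ k * norm y + C * S)"
        using \<theta> \<theta>0 C(1) S0 by (intro mult_right_mono) auto
      moreover have "\<theta> * C * S \<le> \<theta> * C * S'" using S \<theta>0 C(1) by (intro mult_left_mono) auto
      moreover have "D * (norm (obs 1 z) + norm (obs 3 z)) \<le> D * S'" using o D unfolding z13 by (rule mult_left_mono)
      ultimately show ?thesis by (simp add: algebra_simps)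
    qed
    moreover have "R (R z) = (R ^^ (2 * Suc k)) y" by (simp add: z_def)
    ultimately show ?thesis unfolding S'_def by (simp only: exp_bounded_mono)
  qed
  then show ?case using C(1) D \<theta>0 by (intro exI[of _ "\<theta> * C + D"]) auto
qed

text \<open>N depends on \<theta> and the coefficients only, so the loss exp N in passing from the
  weighted bound to the norm does not depend on k. The two extra powers of \<open>R\<close> are
  spent on this passage: with z = R^(2k) y, the curvature of R (R z) is controlled by the
  displacement of z, and its velocity is the displacement of R z.\<close>

lemma power_decay:
  assumes "\<theta> > 0"
  shows "\<exists>K. \<forall>k. \<exists>C. \<forall>y. norm ((R ^^ (2 * k + 2)) y) \<le> K * \<theta> ^ k * norm y + C * (\<Sum>j\<le>2 * k + 3. norm (obs j y))"
proof -
  obtain s1 where s1: "s1 \<in> {0..1}" "\<And>s. s \<in> {0..1} \<Longrightarrow> \<rho> s \<le> \<rho> s1"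
    using continuous_attains_sup[OF _ _ \<rho>_continuous] by force
  obtain s0 where s0: "s0 \<in> {0..1}" "\<And>s. s \<in> {0..1} \<Longrightarrow> EI s0 \<le> EI s"
    using continuous_attains_inf[OF _ _ EI_continuous] by force
  define \<rho>1 E0 where "\<rho>1 = \<rho> s1" and "E0 = EI s0"
  have \<rho>1: "\<rho>1 > 0" "\<And>s. s \<in> {0..1} \<Longrightarrow> \<rho> s \<le> \<rho>1" and E0: "\<And>s. s \<in> {0..1} \<Longrightarrow> E0 \<le> EI s" "E0 > 0"
    using s0 s1 \<rho>_pos EI_pos by (auto simp: \<rho>1_def E0_def)
  define N where "N = max 1 (\<rho>1 / E0 / \<theta>)"
  have N: "N \<ge> 1" "\<rho>1 / E0 / N \<le> \<theta>"
  proof -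
    show "N \<ge> 1" by (simp add: N_def)
    have "\<rho>1 / E0 / \<theta> \<le> N" by (simp add: N_def)
    then have "\<rho>1 / E0 \<le> N * \<theta>" using pos_divide_le_eq[OF \<open>\<theta> > 0\<close>] by blast
    then show "\<rho>1 / E0 / N \<le> \<theta>" using pos_divide_le_eq[of N "\<rho>1 / E0" \<theta>] \<open>N \<ge> 1\<close> by (simp add: mult.commute)
  qed
  obtain KR where KR: "KR > 0" "\<And>x. norm (R x) \<le> norm x * KR" using R.pos_bounded by auto
  define c where "c = \<rho>1 / E0 / N"
  define D where "D = (J + m) / E0"
  have c: "c \<ge> 0" and D: "D \<ge> 0" using \<rho>1 E0(2) N(1) J_pos m_pos by (auto simp: c_def D_def)
  have "\<exists>C. \<forall>y. norm ((R ^^ (2 * k + 2)) y) \<le> (exp N * (c + KR)) * \<theta> ^ k * norm y + C * (\<Sum>j\<le>2 * k + 3. norm (obs j y))" for k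
  proof -
    obtain C where C: "C \<ge> 0" "\<And>y. exp_bounded N (\<theta> ^ k * norm y + C * (\<Sum>j\<le>2 * k + 1. norm (obs j y))) ((R ^^ (2 * k)) y)"
      using exp_bounded_iterate[OF \<rho>1(2) E0 N] by blast
    have "norm ((R ^^ (2 * k + 2)) y) \<le> (exp N * (c + KR)) * \<theta> ^ k * norm y
       + (D + c * exp N * C + exp N * C + 1) * (\<Sum>j\<le>2 * k + 3. norm (obs j y))" for y
    proof -
      define z where "z = (R ^^ (2 * k)) y"
      define S where "S = (\<Sum>j\<le>2 * k + 3. norm (obs j y))"
      define M where "M = \<theta> ^ k * norm y + C * S"
      define M' where "M' = \<theta> ^ k * (norm y * KR) + C * S"
      have S0: "0 \<le> S" by (simp add: S_def sum_nonneg)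
      have obsS: "norm (obs j y) \<le> S" if "j \<le> 2 * k + 3" for j
        unfolding S_def using that by (intro member_le_sum) auto
      have M: "exp_bounded N M z"
        unfolding z_def
      proof (rule exp_bounded_mono[OF C(2)])
        have "(\<Sum>j\<le>2 * k + 1. norm (obs j y)) \<le> S" unfolding S_def by (intro sum_mono2) auto
        then show "\<theta> ^ k * norm y + C * (\<Sum>j\<le>2 * k + 1. norm (obs j y)) \<le> M"
          using C(1) unfolding M_def by (intro add_left_mono mult_left_mono)
      qed
      \<comment> \<open>The iterated bound is used a second time with R y in place of y, which
        raises the indices of the observations by one.\<close>
      have "R z = (R ^^ (2 * k)) (R y)" by (simp add: z_def funpow_swap1)
      then have M': "exp_bounded N M' (R z)"
      proof (simp only:, intro exp_bounded_mono[OF C(2)])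
        have "(\<Sum>j\<le>2 * k + 1. norm (obs j (R y))) = (\<Sum>j\<in>{1..2 * k + 2}. norm (obs j y))"
          unfolding obs_R by (rule sum.reindex_bij_witness[of _ "\<lambda>j. j - 1" Suc]) auto
        also have "\<dots> \<le> S" unfolding S_def by (intro sum_mono2) auto
        finally show "\<theta> ^ k * norm (R y) + C * (\<Sum>j\<le>2 * k + 1. norm (obs j (R y))) \<le> M'"
          using C(1) KR(2)[of y] \<open>\<theta> > 0\<close> unfolding M'_def by (intro add_mono mult_left_mono) auto
      qed
      have M0: "0 \<le> M" "0 \<le> M'" using exp_bounded_nonneg[OF M] exp_bounded_nonneg[OF M'] by auto
      have e: "exp (N * (1 - s)) \<le> exp N" if "s \<in> {0..1}" for s
        using that N(1) by (simp add: algebra_simps)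
      have z1: "obs 1 z = obs (2 * k + 1) y" "obs 1 (R z) = obs (2 * k + 2) y"
        by (simp_all add: z_def obs_funpow obs_R add.commute)
      have oz: "norm (obs 1 z) \<le> S" unfolding z1 by (rule obsS) simp
      have "norm (fst (R (R z))) \<le> D * S + c * M * exp N"
        unfolding norm_fst_R[symmetric]
      proof (rule norm_abs_l2_le[OF curvature_continuous])
        fix s :: real assume s: "s \<in> {0..1}"
        have "norm (iEI s * moment (R z) s) \<le> D * norm (obs 1 z) + c * M * exp (N * (1 - s))"
          unfolding D_def c_def by (rule curvature_bound[OF \<rho>1(2) E0 N(1) M s])
        also have "\<dots> \<le> D * S + c * M * exp N"
          using D c M0 by (intro add_mono mult_left_mono oz e[OF s]) auto
        finally show "norm (iEI s * moment (R z) s) \<le> D * S + c * M * exp N" .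
      qed
      moreover have "norm (l2_of_hl2 (fst (R z))) \<le> M' * exp N"
        unfolding l2_of_hl2_eq
      proof (rule norm_abs_l2_le[OF hU_continuous(1)])
        fix s :: real assume s: "s \<in> {0..1}"
        have "norm (hU0 (fst (R z)) s) \<le> M' * exp (N * (1 - s))" using M' s by (simp add: exp_bounded_def)
        also have "\<dots> \<le> M' * exp N" using e[OF s] M0(2) by (rule mult_left_mono)
        finally show "norm (hU0 (fst (R z)) s) \<le> M' * exp N" .
      qed
      moreover have "norm (obs 1 (R z)) \<le> S" unfolding z1 by (rule obsS) simp
      moreover have "norm (R (R z)) \<le> norm (fst (R (R z))) + norm (l2_of_hl2 (fst (R z))) + norm (obs 1 (R z))"
      proof (rule power2_le_imp_le)
        show "(norm (R (R z)))\<^sup>2 \<le> (norm (fst (R (R z))) + norm (l2_of_hl2 (fst (R z))) + norm (obs 1 (R z)))\<^sup>2"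
          unfolding norm_R_sq[of "R z"] by (simp add: power2_sum)
      qed simp
      ultimately have "norm (R (R z)) \<le> D * S + c * M * exp N + M' * exp N + S" by linarith
      also have "\<dots> = (exp N * (c + KR)) * \<theta> ^ k * norm y + (D + c * exp N * C + exp N * C + 1) * S"
        by (simp add: M_def M'_def algebra_simps)
      finally show ?thesis by (simp add: z_def S_def)
    qed
    then show ?thesis by blast
  qed
  then show ?thesis by blast
qed

lemma dissipation_exists:
  "\<exists>W \<epsilon> C. bounded_bilinear W \<and> \<epsilon> > 0 \<and>
    (\<forall>x. W x (R x) + W (R x) x \<le> - \<epsilon> * (norm (R x))\<^sup>2 + C * (norm (B_adj x))\<^sup>2)"
proof -
  obtain V \<epsilon> C where V: "bounded_bilinear V" "\<epsilon> > 0"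
    "\<And>x. V x (R x) + V (R x) x \<le> - \<epsilon> * (norm (R x))\<^sup>2 + C * ((\<Sum>j\<le>2. (norm (obs j x))\<^sup>2) + (norm (R (R x)))\<^sup>2)"
    using key_estimate by blast
  show ?thesis
    by (rule dissipation_form[OF V low_frequency_bound[OF power_decay]])
qed

end

section \<open>The SCOLE model\<close>

lemma AC_rep_abs:
  assumes "AC f (rep_l2 (abs_l2 g))" "sq_integrable g"
  shows "AC f g"
  unfolding AC_def
proof (intro conjI ballI assms(2))
  show "f x = f 0 + integral {0..x} g" if "x \<in> {0..1}" for x
    using AC_eq[OF assms(1) that] integral_rep_l2[OF assms(2) that] by simp
qed

lemma boundary_val_abs: "continuous_on {0..1} f \<Longrightarrow> x \<in> {0..1} \<Longrightarrow> boundary_val (abs_l2 f) x = f x"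
  by (rule boundary_val_eq) auto

lemma weak_deriv_abs: "AC f g \<Longrightarrow> weak_deriv (abs_l2 f) = abs_l2 g"
  by (rule weak_deriv_eq[OF AC_has_weak_deriv])

lemma boundary_val_l2_of_hl2:
  "boundary_val (l2_of_hl2 u) 1 = hU0 u 1" "boundary_val (weak_deriv (l2_of_hl2 u)) 1 = hU1 u 1"
  unfolding weak_deriv_l2_of_hl2 unfolding l2_of_hl2_eq
  by (simp_all add: boundary_val_abs linear_family_continuous linear_family_hU0 linear_family_hU1)

lemma l2_mult_inverse:
  assumes g: "continuous_on {0..1} g" and h: "continuous_on {0..1} h" and gh: "\<And>s. s \<in> {0..1} \<Longrightarrow> g s * h s = 1"
  shows "l2_mult g (l2_mult h w) = w"
proof -
  have "l2_mult g (l2_mult h w) = abs_l2 (\<lambda>s. g s * (h s * rep_l2 w s))"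
    unfolding l2_mult_def[of h] by (intro l2_mult_abs sq_integrable_mult_continuous g h) simp
  also have "\<dots> = abs_l2 (rep_l2 w)"
  proof (intro abs_l2_eqI AE_I2)
    show "sq_integrable (\<lambda>s. g s * (h s * rep_l2 w s))" by (intro sq_integrable_mult_continuous g h) simp
    show "g s * (h s * rep_l2 w s) = rep_l2 w s" if "s \<in> space (lebesgue_on {0..1})" for s
      using gh[of s] that by (simp add: mult.assoc[symmetric])
  qed simp
  finally show ?thesis by simp
qed

lemma sobolev_4_iff:
  "w \<in> sobolev 4 \<longleftrightarrow> (\<exists>z1 z2 z3 z4. has_weak_deriv w z1 \<and> has_weak_deriv z1 z2 \<and> has_weak_deriv z2 z3 \<and> has_weak_deriv z3 z4)"
proof -
  have 4: "4 = Suc (Suc (Suc (Suc 0)))" by simp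
  show ?thesis unfolding 4 sobolev.simps by blast
qed

section \<open>The operators \<open>A\<close> and \<open>R\<close> are inverse to each other\<close>

context beam
begin

abbreviation A :: "state \<Rightarrow> state" where "A \<equiv> scole_op EI \<rho> m J"

lemma i\<rho>_continuous: "continuous_on {0..1} (\<lambda>s. complex_of_real (inverse (\<rho> s)))"
  using \<rho>_pos by (intro continuous_intros \<rho>_continuous) force

text \<open>The curvature of \<open>R x\<close> is the moment, which is in H^2, times 1/EI, which is
  C^2; so the displacement is in H^4. Compatibility of the tip components is built into
  \<open>R\<close>.\<close>

lemma R_in_domain: "R x \<in> scole_dom"
proof -
  have nz: "EI s \<noteq> 0" if "s \<in> {0..1}" for s using EI_pos[OF that] by simp
  define g0 g1 g2 where "g0 = (\<lambda>s. inverse (EI s))" and "g1 = (\<lambda>s. - (EI' s * (inverse (EI s))\<^sup>2))"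
    and "g2 = (\<lambda>s. - (EI'' s * (inverse (EI s))\<^sup>2) + 2 * (EI' s)\<^sup>2 * (inverse (EI s)) ^ 3)"
  have gd: "(g0 has_real_derivative g1 s) (at s within {0..1})" "(g1 has_real_derivative g2 s) (at s within {0..1})"
    if "s \<in> {0..1}" for s
    unfolding g0_def g1_def g2_def
    using EI_deriv[OF that] EI'_deriv[OF that] nz[OF that]
    by (auto intro!: derivative_eq_intros simp: power2_eq_square power3_eq_cube)
  have nz': "\<forall>s\<in>{0..1}. EI s \<noteq> 0" using nz by blast
  have gc: "continuous_on {0..1} g1" "continuous_on {0..1} g2"
    unfolding g1_def g2_def by (intro continuous_intros EI_continuous EI'_continuous EI''_continuous nz')+
  define c0 c1 where "c0 = (\<lambda>s. complex_of_real (g0 s))" and "c1 = (\<lambda>s. complex_of_real (g1 s))"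
  have G0: "AC c0 c1" and G1: "AC c1 (\<lambda>s. of_real (g2 s))"
    unfolding c0_def c1_def by (intro AC_C1 gd gc; assumption)+
  have K: "AC (\<lambda>s. c0 s * moment x s) (\<lambda>s. c1 s * moment x s + c0 s * shear x s)"
    by (rule AC_mult[OF G0 AC_moment])
  note K1 = AC_add[OF AC_mult[OF G1 AC_moment[of x]] AC_mult[OF G0 AC_shear[of x]]]
  have c: "(\<lambda>s. iEI s * moment x s) = (\<lambda>s. c0 s * moment x s)" by (simp add: c0_def g0_def)
  have "l2_of_hl2 (fst (R x)) \<in> sobolev 4"
    unfolding sobolev_4_iff l2_of_hl2_eq
    using AC_has_weak_deriv[OF AC_hU0] AC_has_weak_deriv[OF AC_hU1_R[of x, unfolded c]] AC_has_weak_deriv[OF K] AC_has_weak_deriv[OF K1]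
    by blast
  then show ?thesis
    unfolding scole_dom_def using l2_of_hl2[of "fst x"] by (simp add: R_def boundary_val_l2_of_hl2)
qed

lemma A_R: "A (R x) = x"
proof -
  define v where "v = fst (snd x)"
  define w where "w = l2_mult c\<rho> v"
  have EIp: "l2_mult cEI (deriv2 (fst (R x))) = abs_l2 (moment x)"
    unfolding R_def fst_conv deriv2_hl2_primitive[OF curvature_sq] by (rule EI_curvature)
  have d1: "weak_deriv (abs_l2 (moment x)) = abs_l2 (shear x)" by (rule weak_deriv_abs[OF AC_moment])
  have d2: "weak_deriv (abs_l2 (shear x)) = - w"
  proof -
    have "weak_deriv (abs_l2 (shear x)) = abs_l2 (\<lambda>s. - rep_l2 w s)"
      unfolding w_def v_def by (rule weak_deriv_abs[OF AC_shear])
    also have "\<dots> = - abs_l2 (rep_l2 w)" using abs_l2_scaleR[of "rep_l2 w" "- 1"] by simp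
    finally show ?thesis by simp
  qed
  interpret i: bounded_linear "l2_mult (\<lambda>s. complex_of_real (inverse (\<rho> s)))"
    by (rule bounded_linear_l2_mult[OF i\<rho>_continuous])
  have "l2_mult (\<lambda>s. of_real (inverse (\<rho> s))) w = v"
    unfolding w_def
  proof (rule l2_mult_inverse[OF i\<rho>_continuous coefficient_continuous(2)])
    show "complex_of_real (inverse (\<rho> s)) * c\<rho> s = 1" if "s \<in> {0..1}" for s
      using \<rho>_pos[OF that] by simp
  qed
  then have 2: "- l2_mult (\<lambda>s. of_real (inverse (\<rho> s))) (- w) = v" by (simp only: i.neg minus_minus)
  have 3: "inverse (of_real m) * boundary_val (abs_l2 (shear x)) 1 = fst (snd (snd x))"
    using m_pos by (simp add: boundary_val_abs moment_continuous shear_1)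
  have 4: "- inverse (of_real J) * of_real (EI 1) * boundary_val (deriv2 (fst (R x))) 1 = snd (snd (snd x))"
  proof -
    have "boundary_val (deriv2 (fst (R x))) 1 = iEI 1 * moment x 1"
      unfolding R_def fst_conv deriv2_hl2_primitive[OF curvature_sq]
      by (rule boundary_val_abs[OF curvature_continuous]) simp
    then show ?thesis using J_pos EI_pos[of 1] by (simp add: moment_1 field_simps)
  qed
  have "A (R x) = (fst x, v, fst (snd (snd x)), snd (snd (snd x)))"
    using EIp d1 d2 2 3 4 by (simp add: scole_op_def split_beta R_def l2_of_hl2_inverse)
  then show ?thesis by (simp add: v_def)
qed

text \<open>For x in the domain, \<open>shear (A x)\<close> and \<open>moment (A x)\<close> recover
  (EI u'')' and EI u'': the derivatives agree by construction, and the last two components of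
  \<open>A x\<close> supply the values at 1.\<close>

lemma R_A:
  assumes x: "x \<in> scole_dom"
  shows "R (A x) = x"
proof -
  obtain u v l \<mu> where x_eq: "x = (u, v, l, \<mu>)" by (cases x)
  have dom: "l2_of_hl2 u \<in> sobolev 4" "v \<in> HL2" "boundary_val v 1 = l" "boundary_val (weak_deriv v) 1 = \<mu>"
    using x by (auto simp: scole_dom_def x_eq)
  obtain z1 z2 z3 z4 where z: "has_weak_deriv (l2_of_hl2 u) z1" "has_weak_deriv z1 z2" "has_weak_deriv z2 z3" "has_weak_deriv z3 z4"
    using dom(1) unfolding sobolev_4_iff by blast
  have z2: "z2 = deriv2 u" using weak_deriv_eq[OF z(1)] weak_deriv_eq[OF z(2)] by (simp add: deriv2_def)
  obtain f2 where f2: "z2 = abs_l2 f2" "AC f2 (rep_l2 z3)" using has_weak_deriv_AC[OF z(3)] by blast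
  obtain f3 where f3: "z3 = abs_l2 f3" "AC f3 (rep_l2 z4)" using has_weak_deriv_AC[OF z(4)] by blast
  have f23: "AC f2 f3"
    using f2(2) unfolding f3(1) by (rule AC_rep_abs[OF _ sq_integrable_continuous[OF AC_continuous[OF f3(2)]]])
  define h where "h = (\<lambda>s. cEI s * f2 s)"
  define h1 where "h1 = (\<lambda>s. of_real (EI' s) * f2 s + cEI s * f3 s)"
  define h2 where "h2 = (\<lambda>s. (of_real (EI'' s) * f2 s + of_real (EI' s) * f3 s) + (of_real (EI' s) * f3 s + cEI s * rep_l2 z4 s))"
  note E0 = AC_C1[OF EI_deriv EI'_continuous] and E1 = AC_C1[OF EI'_deriv EI''_continuous]
  have hh1: "AC h h1" unfolding h_def h1_def by (rule AC_mult[OF E0 f23])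
  have hh2: "AC h1 h2" unfolding h1_def h2_def by (rule AC_add[OF AC_mult[OF E1 f23] AC_mult[OF E0 f3(2)]])
  have h: "l2_mult cEI (deriv2 u) = abs_l2 h"
    unfolding z2[symmetric] f2(1) h_def
    by (rule l2_mult_abs[OF sq_integrable_continuous[OF AC_continuous[OF f23]] coefficient_continuous(1)])
  have Ax: "A x = (hl2_of_l2 v, - l2_mult (\<lambda>s. of_real (inverse (\<rho> s))) (abs_l2 h2), inverse (of_real m) * h1 1, - inverse (of_real J) * of_real (EI 1) * f2 1)"
  proof -
    have "boundary_val (deriv2 u) 1 = f2 1" "boundary_val (abs_l2 h1) 1 = h1 1"
      using boundary_val_abs[OF AC_continuous[OF hh2], of 1] boundary_val_abs[OF AC_continuous[OF f23], of 1]
      by (simp_all add: z2[symmetric] f2(1))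
    then show ?thesis
      unfolding scole_op_def x_eq prod.case h weak_deriv_abs[OF hh1] weak_deriv_abs[OF hh2] by simp
  qed
  interpret c: bounded_linear "l2_mult c\<rho>" by (rule bounded_linear_l2_mult[OF coefficient_continuous(2)])
  have "l2_mult c\<rho> (l2_mult (\<lambda>s. of_real (inverse (\<rho> s))) (abs_l2 h2)) = abs_l2 h2"
  proof (rule l2_mult_inverse[OF coefficient_continuous(2) i\<rho>_continuous])
    show "c\<rho> s * complex_of_real (inverse (\<rho> s)) = 1" if "s \<in> {0..1}" for s
      using \<rho>_pos[OF that] by simp
  qed
  then have w: "l2_mult c\<rho> (fst (snd (A x))) = - abs_l2 h2" by (simp add: Ax c.neg)
  have iw: "integral {0..s} (rep_l2 (l2_mult c\<rho> (fst (snd (A x))))) = - (h1 s - h1 0)" if "s \<in> {0..1}" for s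
  proof -
    have "integral {0..s} (rep_l2 (- abs_l2 h2)) = - integral {0..s} (rep_l2 (abs_l2 h2))"
      using integral_rep_l2_scaleR[OF that, of "- 1" "abs_l2 h2"] by simp
    then show ?thesis
      unfolding w integral_rep_l2[OF AC_sq[OF hh2] that] using AC_eq[OF hh2 that] by simp
  qed
  have sh: "shear (A x) s = h1 s" if "s \<in> {0..1}" for s
    unfolding shear_def iw[OF that] using iw[of 1] m_pos by (simp add: Ax)
  have ish: "integral {0..s} (shear (A x)) = h s - h 0" if "s \<in> {0..1}" for s
  proof -
    have "integral {0..s} (shear (A x)) = integral {0..s} h1"
      by (rule Henstock_Kurzweil_Integration.integral_cong) (use that sh in auto)
    then show ?thesis using AC_eq[OF hh1 that] by simp
  qed
  have mo: "moment (A x) s = h s" if "s \<in> {0..1}" for s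
    unfolding moment_def ish[OF that] using ish[of 1] J_pos by (simp add: Ax h_def)
  have cu: "iEI s * moment (A x) s = f2 s" if "s \<in> {0..1}" for s
    using mo[OF that] EI_pos[OF that] by (simp add: h_def)
  have "abs_l2 (\<lambda>s. iEI s * moment (A x) s) = abs_l2 f2"
    by (intro abs_l2_eqI AE_I2 curvature_sq sq_integrable_continuous AC_continuous[OF f23]) (use cu in auto)
  then have 1: "hl2_primitive (\<lambda>s. iEI s * moment (A x) s) = u"
    unfolding deriv2_inject[symmetric] deriv2_hl2_primitive[OF curvature_sq] using z2 f2(1) by simp
  have v: "l2_of_hl2 (hl2_of_l2 v) = v" by (rule hl2_of_l2_inverse[OF dom(2)])
  have "hU0 (hl2_of_l2 v) 1 = l" "hU1 (hl2_of_l2 v) 1 = \<mu>"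
    using boundary_val_l2_of_hl2[of "hl2_of_l2 v"] dom(3,4) by (simp_all add: v)
  then show ?thesis unfolding R_def 1 unfolding Ax fst_conv v unfolding x_eq by simp
qed

lemma generator_R:
  assumes "is_generator T scole_dom A"
  shows "((\<lambda>h. (T h (R z) - R z) /\<^sub>R h) \<longlongrightarrow> z) (at_right 0)"
proof -
  have "R z \<in> scole_dom \<and> z = A (R z)" using R_in_domain A_R by simp
  then show ?thesis using assms unfolding is_generator_def by blast
qed

text \<open>T t maps the right derivative at 0 of T h (R z), which is z, to that of T h (T t (R z)).
  Hence T t (R z) is in the domain with A (T t (R z)) = T t z, and applying \<open>R\<close> gives
  the claim.\<close>

lemma semigroup_commutes:
  assumes T: "c0_semigroup T" and gen: "is_generator T scole_dom A" and "t \<ge> 0"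
  shows "R (T t z) = T t (R z)"
proof -
  define y where "y = R z"
  interpret Tt: bounded_linear "T t" using T \<open>t \<ge> 0\<close> by (simp add: c0_semigroup_def)
  have "((\<lambda>h. (T h y - y) /\<^sub>R h) \<longlongrightarrow> z) (at_right 0)"
    unfolding y_def by (rule generator_R[OF gen])
  then have "((\<lambda>h. T t ((T h y - y) /\<^sub>R h)) \<longlongrightarrow> T t z) (at_right 0)" by (rule Tt.tendsto)
  moreover have "\<forall>\<^sub>F h in at_right 0. T t ((T h y - y) /\<^sub>R h) = (T h (T t y) - T t y) /\<^sub>R h"
    unfolding eventually_at_filter
  proof (intro always_eventually allI impI)
    fix h :: real assume "h \<noteq> 0" "h \<in> {0<..}"
    then have "T t (T h y) = T h (T t y)"
      using T \<open>t \<ge> 0\<close> unfolding c0_semigroup_def by (metis add.commute greaterThan_iff less_imp_le)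
    then show "T t ((T h y - y) /\<^sub>R h) = (T h (T t y) - T t y) /\<^sub>R h" by (simp add: Tt.scaleR Tt.diff)
  qed
  ultimately have "((\<lambda>h. (T h (T t y) - T t y) /\<^sub>R h) \<longlongrightarrow> T t z) (at_right 0)"
    by (rule Lim_transform_eventually)
  then have "T t y \<in> scole_dom \<and> T t z = A (T t y)"
    using gen unfolding is_generator_def by blast
  then show ?thesis using R_A[of "T t y"] by (simp add: y_def)
qed

lemma bounded_linear_B_op: "bounded_linear B_op"
  unfolding B_op_def split_beta
  by (intro bounded_linear_Pair bounded_linear_zero bounded_linear_fst bounded_linear_snd)

sublocale closed_loop energy R B_adj B_op
  by (intro closed_loop.intro skew_system_axioms closed_loop_axioms.intro bounded_linear_B_op)

section \<open>The control space and the feedback law\<close>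

lemma control_inner_eq:
  "control_inner m J a b = of_real m * fst a * cnj (fst b) + of_real J * snd a * cnj (snd b)"
  by (simp add: control_inner_def split_beta)

lemma control_inner_sym: "Re (control_inner m J a b) = Re (control_inner m J b a)"
  by (simp add: control_inner_eq algebra_simps)

lemma energy_B_op: "energy x (B_op d) = Re (control_inner m J d (B_adj x))"
  by (simp add: energy_def B_adj_adjoint[symmetric] control_inner_sym[of d])

lemma control_norm_sq: "Re (control_inner m J w w) = m * (norm (fst w))\<^sup>2 + J * (norm (snd w))\<^sup>2"
  unfolding control_inner_eq cmod_power2 by (simp add: power2_eq_square algebra_simps)

lemma control_norm_bounds:
  "min m J * (norm w)\<^sup>2 \<le> (control_norm m J w)\<^sup>2" "(control_norm m J w)\<^sup>2 \<le> max m J * (norm w)\<^sup>2"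
proof -
  have nn: "0 \<le> m * (norm (fst w))\<^sup>2 + J * (norm (snd w))\<^sup>2" using m_pos J_pos by simp
  have cn: "(control_norm m J w)\<^sup>2 = m * (norm (fst w))\<^sup>2 + J * (norm (snd w))\<^sup>2"
    using nn by (simp add: control_norm_def control_norm_sq)
  have n: "(norm w)\<^sup>2 = (norm (fst w))\<^sup>2 + (norm (snd w))\<^sup>2"
    by (cases w) (simp add: norm_Pair)
  show "min m J * (norm w)\<^sup>2 \<le> (control_norm m J w)\<^sup>2" "(control_norm m J w)\<^sup>2 \<le> max m J * (norm w)\<^sup>2"
    unfolding cn n distrib_left by (intro add_mono mult_right_mono; simp)+
qed

text \<open>The abstract loop asks for bounds on balls. Near 0 they come from the Lipschitz and the
  quadratic condition, away from 0 from compactness and the constant lower bound c. A linear upper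
  bound presupposes \<phi>(0) = 0, which the one-sided conditions and continuity imply.\<close>

lemma feedback_properties:
  assumes lip: "\<forall>w. \<exists>r>0. \<exists>L. lipschitz_on L (ball w r) \<phi>" and "\<delta> > 0" "c > 0"
    and small: "\<forall>w. control_norm m J w \<le> \<delta> \<longrightarrow> Re (control_inner m J (\<phi> w) w) \<ge> c * (control_norm m J w)\<^sup>2"
    and large: "\<forall>w. control_norm m J w > \<delta> \<longrightarrow> Re (control_inner m J (\<phi> w) w) \<ge> c"
  shows "continuous_on UNIV \<phi>"
    and "\<exists>\<kappa>>0. \<exists>L. \<forall>w. norm w \<le> r \<longrightarrow>
      norm (\<phi> w) \<le> L * norm w \<and> \<kappa> * (norm w)\<^sup>2 \<le> Re (control_inner m J (\<phi> w) w)"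
proof -
  show cont: "continuous_on UNIV \<phi>"
    unfolding continuous_on_eq_continuous_at[OF open_UNIV]
  proof
    fix w
    obtain r L where "r > 0" "lipschitz_on L (ball w r) \<phi>" using lip by blast
    then show "isCont \<phi> w"
      using lipschitz_on_continuous_on[of L "ball w r" \<phi>] continuous_on_eq_continuous_at[OF open_ball, of w r \<phi>] by simp
  qed
  have lower: "c * (control_norm m J w)\<^sup>2 \<le> Re (control_inner m J (\<phi> w) w)" if "control_norm m J w \<le> \<delta>" for w
    using small that by blast
  \<comment> \<open>Testing at w = - t \<phi>(0) with small t > 0 and dividing by t gives -
    |\<phi>(0)|^2 \<ge> 0 in the limit, in the weighted norm.\<close>
  have zero: "\<phi> 0 = 0"
  proof -
    define f where "f = (\<lambda>t::real. Re (control_inner m J (\<phi> (t *\<^sub>R (- \<phi> 0))) (- \<phi> 0)))"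
    have f: "(f \<longlongrightarrow> Re (control_inner m J (\<phi> (0 *\<^sub>R (- \<phi> 0))) (- \<phi> 0))) (at_right 0)"
    proof -
      have "isCont (\<lambda>t. \<phi> (t *\<^sub>R (- \<phi> 0))) 0"
        by (rule isCont_o2[where g = \<phi>]) (use cont continuous_on_eq_continuous_at[OF open_UNIV, of \<phi>] in \<open>auto intro!: continuous_intros simp del: split_paired_All\<close>)
      then have l: "((\<lambda>t. \<phi> (t *\<^sub>R (- \<phi> 0))) \<longlongrightarrow> \<phi> (0 *\<^sub>R (- \<phi> 0))) (at_right 0)"
        unfolding isCont_def by (rule tendsto_within_subset) simp
      show ?thesis
        unfolding f_def control_inner_eq by (intro tendsto_intros l)
    qed
    have "\<forall>\<^sub>F t in at_right 0. 0 \<le> f t"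
    proof -
      have "((\<lambda>t. control_norm m J (t *\<^sub>R (- \<phi> 0))) \<longlongrightarrow> control_norm m J (0 *\<^sub>R (- \<phi> 0))) (at_right 0)"
        unfolding control_norm_def control_inner_eq by (intro tendsto_intros)
      then have "((\<lambda>t. control_norm m J (t *\<^sub>R (- \<phi> 0))) \<longlongrightarrow> 0) (at_right 0)"
        by (simp add: control_norm_def control_inner_eq)
      from order_tendstoD(2)[OF this \<open>\<delta> > 0\<close>] show ?thesis
        using eventually_at_right_less[of 0]
      proof eventually_elim
        case (elim t)
        have "0 \<le> c * (control_norm m J (t *\<^sub>R (- \<phi> 0)))\<^sup>2" using \<open>c > 0\<close> by simp
        also have "\<dots> \<le> Re (control_inner m J (\<phi> (t *\<^sub>R (- \<phi> 0))) (t *\<^sub>R (- \<phi> 0)))" using elim by (intro lower) simp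
        also have "\<dots> = t * f t" by (simp add: f_def control_inner_eq algebra_simps)
        finally show ?case using elim(2) by (simp add: zero_le_mult_iff)
      qed
    qed
    then have "0 \<le> Re (control_inner m J (\<phi> (0 *\<^sub>R (- \<phi> 0))) (- \<phi> 0))"
      by (rule tendsto_lowerbound[OF f]) simp
    also have "\<dots> = - (m * (norm (fst (\<phi> 0)))\<^sup>2 + J * (norm (snd (\<phi> 0)))\<^sup>2)"
      unfolding control_norm_sq[symmetric] by (simp add: control_inner_eq)
    finally have "m * (norm (fst (\<phi> 0)))\<^sup>2 + J * (norm (snd (\<phi> 0)))\<^sup>2 \<le> 0" by simp
    moreover have "0 \<le> m * (norm (fst (\<phi> 0)))\<^sup>2" "0 \<le> J * (norm (snd (\<phi> 0)))\<^sup>2" using m_pos J_pos by auto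
    ultimately have "m * (norm (fst (\<phi> 0)))\<^sup>2 = 0" "J * (norm (snd (\<phi> 0)))\<^sup>2 = 0" by linarith+
    then show ?thesis using m_pos J_pos by (simp add: prod_eq_iff)
  qed
  obtain r0 L0 where r0: "r0 > 0" "lipschitz_on L0 (ball 0 r0) \<phi>" using lip by blast
  have "bounded (\<phi> ` cball 0 r)"
    by (intro compact_imp_bounded compact_continuous_image continuous_on_subset[OF cont]) auto
  then obtain M where "\<forall>y\<in>\<phi> ` cball 0 r. norm y \<le> M" unfolding bounded_iff by blast
  then have M: "norm (\<phi> w) \<le> M" if "norm w \<le> r" for w
    using that by (metis imageI mem_cball_0)
  \<comment> \<open>Outside the Lipschitz ball around 0, the constant bound M becomes linear because
    |w| \<ge> r0.\<close>
  have upper: "norm (\<phi> w) \<le> (\<bar>L0\<bar> + \<bar>M\<bar> / r0) * norm w" if "norm w \<le> r" for w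
  proof (cases "norm w < r0")
    case True
    have "norm (\<phi> w) \<le> L0 * norm w"
      using lipschitz_onD[OF r0(2), of w 0] True r0(1) zero by (simp add: dist_norm)
    also have "\<dots> \<le> (\<bar>L0\<bar> + \<bar>M\<bar> / r0) * norm w"
      using r0(1) by (intro mult_right_mono) (auto intro: order_trans[OF abs_ge_self])
    finally show ?thesis .
  next
    case False
    have "norm (\<phi> w) \<le> \<bar>M\<bar>" using M[OF that] by simp
    also have "\<dots> \<le> \<bar>M\<bar> / r0 * norm w"
    proof -
      have "\<bar>M\<bar> / r0 * r0 \<le> \<bar>M\<bar> / r0 * norm w" using False r0(1) by (intro mult_left_mono) auto
      then show ?thesis using r0(1) by simp
    qed
    also have "\<dots> \<le> (\<bar>L0\<bar> + \<bar>M\<bar> / r0) * norm w" by (intro mult_right_mono) auto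
    finally show ?thesis .
  qed
  \<comment> \<open>For small w the quadratic condition applies, with \<open>min m J\<close> passing
    to the type class norm. For the other w in the ball, |w|^2 / (r^2 + 1) \<le> 1 turns the
    constant c into a quadratic bound.\<close>
  define k where "k = min (c * min m J) (c / (r\<^sup>2 + 1))"
  have k: "k > 0" using \<open>c > 0\<close> m_pos J_pos by (simp add: k_def add_nonneg_pos)
  have "k * (norm w)\<^sup>2 \<le> Re (control_inner m J (\<phi> w) w)" if "norm w \<le> r" for w
  proof (cases "control_norm m J w \<le> \<delta>")
    case True
    have "k * (norm w)\<^sup>2 \<le> c * min m J * (norm w)\<^sup>2" by (intro mult_right_mono) (auto simp: k_def)
    also have "\<dots> \<le> c * (control_norm m J w)\<^sup>2"
      unfolding mult.assoc using \<open>c > 0\<close> by (intro mult_left_mono control_norm_bounds) auto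
    also note lower[OF True]
    finally show ?thesis .
  next
    case False
    have "k * (norm w)\<^sup>2 \<le> c / (r\<^sup>2 + 1) * (r\<^sup>2 + 1)"
    proof (rule mult_mono)
      have "(norm w)\<^sup>2 \<le> r\<^sup>2" using that by (intro power_mono) auto
      then show "(norm w)\<^sup>2 \<le> r\<^sup>2 + 1" by simp
    qed (use \<open>c > 0\<close> in \<open>auto simp: k_def\<close>)
    also have "\<dots> = c" using add_nonneg_pos[of "r\<^sup>2" 1] by simp
    also have "\<dots> \<le> Re (control_inner m J (\<phi> w) w)" using large False not_le by blast
    finally show ?thesis .
  qed
  with k upper show "\<exists>\<kappa>>0. \<exists>L. \<forall>w. norm w \<le> r \<longrightarrow>
      norm (\<phi> w) \<le> L * norm w \<and> \<kappa> * (norm w)\<^sup>2 \<le> Re (control_inner m J (\<phi> w) w)" by blast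
qed

end

theorem proposition3p3:
  fixes EI \<rho> \<zeta> :: "real \<Rightarrow> real"
    and m J a b \<delta> c :: real
    and \<phi>\<^sub>1 \<phi>\<^sub>2 :: "complex \<times> complex \<Rightarrow> complex"
    and \<phi> :: "control \<Rightarrow> control"
  assumes "C_k 4 EI" and "\<exists>\<epsilon>>0. \<forall>x\<in>{0..1}. EI x \<ge> \<epsilon>"
    and "C_k 4 \<rho>" and "\<exists>\<epsilon>>0. \<forall>x\<in>{0..1}. \<rho> x \<ge> \<epsilon>"
    and "m > 0" and "J > 0"
    and "a > 0" and "b > 0" and "C_k 2 \<zeta>" and "\<zeta> 0 = 0"
    and "\<forall>x\<in>{0..1}. 2 * (1 - a) * \<rho> x - deriv01 (\<lambda>y. \<rho> y * \<zeta> y) x < - b"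
    and "\<forall>x\<in>{0..1}. EI x * (1 - a - 2 * deriv01 \<zeta> x) + 1/2 * deriv01 (\<lambda>y. EI y * \<zeta> y) x < - b"
    and "\<phi> = (\<lambda>w. (inverse m * \<phi>\<^sub>1 w, inverse J * \<phi>\<^sub>2 w))"
    and "\<forall>w\<^sub>1 w\<^sub>2. Re (control_inner m J (\<phi> w\<^sub>1 - \<phi> w\<^sub>2) (w\<^sub>1 - w\<^sub>2)) \<ge> 0"
    and "\<forall>w. \<exists>r>0. \<exists>L. lipschitz_on L (ball w r) \<phi>"
    and "\<delta> > 0" and "c > 0"
    and "\<forall>w. control_norm m J w \<le> \<delta> \<longrightarrow> Re (control_inner m J (\<phi> w) w) \<ge> c * (control_norm m J w)\<^sup>2"
    and "\<forall>w. control_norm m J w > \<delta> \<longrightarrow> Re (control_inner m J (\<phi> w) w) \<ge> c"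
  shows "(\<forall>T x. c0_semigroup T \<and> is_generator T scole_dom (scole_op EI \<rho> m J) \<and> mild_solution T \<phi> x \<longrightarrow>
           ((\<lambda>t. energy_norm EI \<rho> m J (x t)) \<longlongrightarrow> 0) at_top) \<and>
         (\<forall>x. classical_solution scole_dom (scole_op EI \<rho> m J) \<phi> x \<longrightarrow>
           (\<lambda>t. energy_norm EI \<rho> m J (x t)) \<in> O[at_top](\<lambda>t. t powr (-1/2)))"
proof -
  have 4: "4 = Suc (Suc (Suc (Suc 0)))" by simp
  have cont: "continuous_on {0..1} f" if "\<forall>x\<in>{0..1}. (f has_real_derivative f' x) (at x within {0..1})" for f f' :: "real \<Rightarrow> real"
    unfolding continuous_on_eq_continuous_within using that DERIV_continuous by blast
  obtain EI' EI'' EI3 where EI: "\<forall>x\<in>{0..1}. (EI has_real_derivative EI' x) (at x within {0..1})"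
    "\<forall>x\<in>{0..1}. (EI' has_real_derivative EI'' x) (at x within {0..1})"
    "\<forall>x\<in>{0..1}. (EI'' has_real_derivative EI3 x) (at x within {0..1})"
    using assms(1) unfolding 4 C_k.simps by blast
  obtain \<rho>' \<rho>'' where \<rho>: "\<forall>x\<in>{0..1}. (\<rho> has_real_derivative \<rho>' x) (at x within {0..1})"
    "\<forall>x\<in>{0..1}. (\<rho>' has_real_derivative \<rho>'' x) (at x within {0..1})"
    using assms(3) unfolding 4 C_k.simps by blast
  interpret beam EI EI' EI'' \<rho> \<rho>' m J
  proof
    show "continuous_on {0..1} EI''" "continuous_on {0..1} \<rho>'" using cont EI(3) \<rho>(2) by blast+
    show "EI x > 0" "\<rho> x > 0" if "x \<in> {0..1}" for x using assms(2,4) that by force+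
  qed (use EI \<rho> assms(5,6) in auto)
  note fb = feedback_properties[OF assms(15-19)]
  obtain W \<epsilon> C where W: "bounded_bilinear W" "\<epsilon> > 0"
    "\<And>x. W x (R x) + W (R x) x \<le> - \<epsilon> * (norm (R x))\<^sup>2 + C * (norm (B_adj x))\<^sup>2"
    using dissipation_exists by blast
  interpret loop: dissipative_loop energy R B_adj B_op \<phi> W \<epsilon> C
  proof (intro dissipative_loop.intro dissipative_loop_axioms.intro)
    show "closed_loop energy R B_adj B_op" by (rule closed_loop_axioms)
    show "continuous_on UNIV \<phi>" by (rule fb(1))
    show "0 \<le> energy (x - z) (B_op (\<phi> (B_adj x) - \<phi> (B_adj z)))" for x z
      unfolding energy_B_op Bs.diff using assms(14) by blast
    show "\<exists>\<kappa>>0. \<exists>L. \<forall>x. norm x \<le> r \<longrightarrow> norm (\<phi> (B_adj x)) \<le> L * norm (B_adj x) \<and> \<kappa> * (norm (B_adj x))\<^sup>2 \<le> energy x (B_op (\<phi> (B_adj x)))" for r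
    proof -
      obtain K where K: "K > 0" "\<And>x. norm (B_adj x) \<le> norm x * K" using Bs.pos_bounded by auto
      \<comment> \<open>States in the ball of radius r have observations in the ball of radius r
        K.\<close>
      obtain \<kappa> L where kL: "\<kappa> > 0" "\<And>w. norm w \<le> r * K \<Longrightarrow> norm (\<phi> w) \<le> L * norm w \<and> \<kappa> * (norm w)\<^sup>2 \<le> Re (control_inner m J (\<phi> w) w)"
        using fb(2)[of "r * K"] by blast
      have "norm (B_adj x) \<le> r * K" if "norm x \<le> r" for x
        using K(2)[of x] mult_right_mono[OF that, of K] K(1) by linarith
      then show ?thesis using kL unfolding energy_B_op by blast
    qed
  qed (use W in auto)
  have en: "energy_norm EI \<rho> m J z = sqrt (energy z z)" for z by (simp add: energy_norm_def energy_def)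
  have fc: "continuous_on {0..} (\<lambda>t. \<phi> (B_adj (x t)))" if "continuous_on {0..} x" for x :: "real \<Rightarrow> state"
    by (intro continuous_on_compose2[OF fb(1)] Bs.continuous_on that) auto
  show ?thesis
  proof (intro conjI allI impI)
    fix T x
    assume "c0_semigroup T \<and> is_generator T scole_dom A \<and> mild_solution T \<phi> x"
    then have T: "c0_semigroup T" and gen: "is_generator T scole_dom A" and mild: "mild_solution T \<phi> x" by auto
    have xc: "continuous_on {0..} x" using mild unfolding mild_solution_def by blast
    \<comment> \<open>The variation of constants formula becomes the equation for R x; that A
      generates T enters through \<open>semigroup_commutes\<close> and
      \<open>generator_R\<close>.\<close>
    have "((\<lambda>t. R (x t)) has_vector_derivative x t - R (B_op (\<phi> (B_adj (x t))))) (at t within {0..})" if "t \<ge> 0" for t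
    proof (rule mild_semigroup_derivative[where T = T and R = R and B = B_op and b = "\<lambda>t. \<phi> (B_adj (x t))"])
      show "bounded_linear (T t)" if "t \<ge> 0" for t using T that unfolding c0_semigroup_def by blast
      show "T 0 x = x" for x using T unfolding c0_semigroup_def by blast
      show "T (s + t) x = T s (T t x)" if "s \<ge> 0" "t \<ge> 0" for s t x
        using T that unfolding c0_semigroup_def by blast
      show "((\<lambda>t. T t x) \<longlongrightarrow> x) (at_right 0)" for x using T unfolding c0_semigroup_def by blast
      show "R (T t x) = T t (R x)" if "t \<ge> 0" for t x using semigroup_commutes[OF T gen that] .
      show "((\<lambda>h. (T h (R z) - R z) /\<^sub>R h) \<longlongrightarrow> z) (at_right 0)" for z
        by (rule generator_R[OF gen])
      show "\<exists>I. ((\<lambda>s. T (t - s) (B_op (\<phi> (B_adj (x s))))) has_integral I) {0..t} \<and> x t = T t (x 0) - I" if "t \<ge> 0" for t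
        using mild that unfolding mild_solution_def by blast
    qed (fact R bounded_linear_B_op xc fc[OF xc] that)+
    then have "solves x (\<lambda>t. \<phi> (B_adj (x t)))" using xc fc[OF xc] unfolding solves_def by blast
    from tendsto_real_sqrt[OF loop.energy_tendsto_zero[OF this]]
    show "((\<lambda>t. energy_norm EI \<rho> m J (x t)) \<longlongrightarrow> 0) at_top" by (simp add: en)
  next
    fix x assume "classical_solution scole_dom A \<phi> x"
    then obtain x' where x': "continuous_on {0..} x'"
      and x: "\<And>t. t \<ge> 0 \<Longrightarrow> (x has_vector_derivative x' t) (at t within {0..})"
        "\<And>t. t \<ge> 0 \<Longrightarrow> x t \<in> scole_dom" "\<And>t. t \<ge> 0 \<Longrightarrow> x' t = A (x t) - B_op (\<phi> (B_adj (x t)))"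
      unfolding classical_solution_def by blast
    have xc: "continuous_on {0..} x"
      using x(1) by (auto simp: continuous_on_eq_continuous_within intro: has_vector_derivative_continuous)
    \<comment> \<open>Here it suffices to apply \<open>R\<close> to the equation, as R (A x) = x on
      the domain.\<close>
    have "((\<lambda>t. R (x t)) has_vector_derivative x t - R (B_op (\<phi> (B_adj (x t))))) (at t within {0..})" if "t \<ge> 0" for t
      using bounded_linear.has_vector_derivative[OF R x(1)[OF that]] x(3)[OF that] R_A[OF x(2)[OF that]] by (simp add: R.diff)
    then have sol: "solves x (\<lambda>t. \<phi> (B_adj (x t)))" using xc fc[OF xc] unfolding solves_def by blast
    \<comment> \<open>A bound for x' on [0, 1] gives the Lipschitz estimate at time 0 on which the
      rate rests; a mild solution offers only continuity there.\<close>
    have "continuous_on {0..1} x'" using x' by (rule continuous_on_subset) auto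
    then obtain k where k: "\<And>s. s \<in> {0..1} \<Longrightarrow> norm (x' s) \<le> k" by (rule continuous_on_unit_interval_bounded) blast
    have "norm (x h - x 0) \<le> k * h" if "0 \<le> h" "h \<le> 1" for h
      using vector_derivative_norm_bound[OF x(1), of 0 h k] k that by simp
    then obtain D where D: "\<And>t. t > 0 \<Longrightarrow> energy (x t) (x t) \<le> D / t"
      using loop.energy_rate[OF sol zero_less_one] by blast
    show "(\<lambda>t. energy_norm EI \<rho> m J (x t)) \<in> O[at_top](\<lambda>t. t powr (-1/2))"
    proof (rule bigoI)
      show "\<forall>\<^sub>F t in at_top. norm (energy_norm EI \<rho> m J (x t)) \<le> sqrt D * norm (t powr (-1/2))"
        using eventually_gt_at_top[of 0]
      proof eventually_elim
        case (elim t)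
        have "sqrt (energy (x t) (x t)) \<le> sqrt (D / t)" using D[OF elim] by (rule real_sqrt_le_mono)
        also have "sqrt (D / t) = sqrt D * t powr (-1/2)"
        proof -
          have "t powr (-1/2) = inverse (sqrt t)"
            using elim powr_minus[of t "1/2"] powr_half_sqrt[of t] by simp
          then show ?thesis by (simp only: real_sqrt_divide divide_inverse[of "sqrt D" "sqrt t"])
        qed
        finally show ?case unfolding en by (simp add: e_nonneg)
      qed
    qed
  qed
qed

end
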